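(* Let $(A,\mu)$ be a Poisson Hopf-Galois algebra and $(U(A),\alpha,\beta)$ its Poisson enveloping algebra. Let $\xi=\alpha\otimes\alpha\otimes\beta+\alpha\otimes\beta\otimes\alpha+\beta\otimes\alpha\otimes\alpha: A\otimes A\otimes A\to U(A)\otimes U(A)^{op}\otimes U(A)$, and let $U(\mu):U(A)\to U(A)\otimes U(A)^{op}\otimes U(A)$ be the algebra homomorphism induced by $\mu$. Then $(U(A),U(\mu))$ satisfies $$U(\mu)\alpha=(\alpha\otimes\alpha\otimes\alpha)\mu,\qquad U(\mu)\beta=\xi\mu.$$ Moreover, $(U(A),U(\mu))$ is a Hopf-Galois algebra if and only if $$\beta+m_{U(A)}(id\otimes m_{U(A)})(\alpha\otimes\beta\otimes\alpha)\mu=0,$$ that is, $\beta(a)=-\alpha(a_{(1)})\beta(a_{(2)})\alpha(a_{(3)})$ for all $a\in A$, where $m_{U(A)}$ is the multiplication of $U(A)$.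
   Context: Everything is over a fixed field $k$; algebras are associative and unital, and $\otimes=\otimes_k$. A Hopf-Galois algebra is a non-zero algebra $R$ together with an algebra map $\mu:R\to R\otimes R^{op}\otimes R$ (tensor product algebra; called the Hopf-Galois map), written $\mu(r)=r_{(1)}\otimes r_{(2)}\otimes r_{(3)}$ with summation suppressed, such that $(\mu\otimes id\otimes id)\circ\mu=(id\otimes id\otimes\mu)\circ\mu$, $(m\otimes id)\circ\mu=\eta\otimes id$ and $(id\otimes m)\circ\mu=id\otimes\eta$, where $m$ and $\eta$ are the multiplication and unit of $R$. A Poisson algebra is a commutative algebra $A$ with a bilinear map $\{\cdot,\cdot\}:A\otimes A\to A$ making $A$ a Lie algebra and satisfying $\{a,bc\}=\{a,b\}c+b\{a,c\}$. A Poisson Hopf-Galois algebra is a Poisson algebra $R$ that is also a Hopf-Galois algebra (with the same multiplication) such that $\mu(\{a,b\})=\{\mu(a),\mu(b)\}$ for all $a,b\in R$, where the Poisson bracket on $R\otimes R^{op}\otimes R$ (as an algebra equal to $R\otimes R\otimes R$, since $R$ is commutative) is $$\{x\otimes y\otimes z,\,x'\otimes y'\otimes z'\}=\{x,x'\}\otimes yy'\otimes zz'-xx'\otimes\{y,y'\}\otimes zz'+xx'\otimes yy'\otimes\{z,z'\}.$$ For an algebra $B$, $B_L$ denotes $B$ with the commutator bracket $[x,y]=xy-yx$. The Poisson enveloping algebra of a Poisson algebra $A$ is a triple $(U(A),\alpha,\beta)$, where $U(A)$ is an algebra, $\alpha:A\to U(A)$ is an algebra homomorphism and $\beta:A\to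 U(A)_L$ is a Lie homomorphism with $$\alpha(\{a,b\})=[\beta(a),\alpha(b)],\qquad \beta(ab)=\alpha(a)\beta(b)+\alpha(b)\beta(a)\qquad(a,b\in A),$$ and which is universal: for any algebra $B$, algebra homomorphism $\gamma:A\to B$ and Lie homomorphism $\delta:(A,\{\cdot,\cdot\})\to B_L$ with $\gamma(\{a,b\})=[\delta(a),\gamma(b)]$ and $\delta(ab)=\gamma(a)\delta(b)+\gamma(b)\delta(a)$ for all $a,b\in A$, there is a unique algebra homomorphism $h:U(A)\to B$ with $h\alpha=\gamma$ and $h\beta=\delta$. It exists and is unique up to isomorphism. Definition of $U(\mu)$: for a Poisson homomorphism $\phi:A\to B$ of Poisson algebras (an algebra homomorphism preserving brackets), $U(\phi):U(A)\to U(B)$ denotes the unique algebra homomorphism with $U(\phi)\alpha_A=\alpha_B\phi$ and $U(\phi)\beta_A=\beta_B\phi$, where $(U(A),\alpha_A,\beta_A)$ and $(U(B),\alpha_B,\beta_B)$ are the Poisson enveloping algebras. $U(\mu)$ is this map for the Poisson homomorphism $\mu:A\to A\otimes A\otimes A$, where $A\otimes A\otimes A$ carries the bracket displayed above (minus sign in the middle factor) and its Poisson enveloping algebra is taken to be $(U(A)\otimes U(A)^{op}\otimes U(A),\ \alpha\otimes\alpha\otimes\alpha,\ \xi)$. *)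

theory Defs
  imports "HOL-Algebra.Module" "HOL-Algebra.AbelCoset"
begin

section \<open>Algebras over a field\<close>

text \<open>
  The library locale \<^locale>\<open>algebra\<close> is restricted to commutative algebras over a commutative
  ring, hence the following.
\<close>

definition k_algebra :: "'k ring \<Rightarrow> ('k, 'a) module \<Rightarrow> bool" where
  "k_algebra K B \<longleftrightarrow> field K \<and> ring B \<and> module K B \<and>
     (\<forall>c\<in>carrier K. \<forall>x\<in>carrier B. \<forall>y\<in>carrier B.
        (c \<odot>\<^bsub>B\<^esub> x) \<otimes>\<^bsub>B\<^esub> y = c \<odot>\<^bsub>B\<^esub> (x \<otimes>\<^bsub>B\<^esub> y) \<and>
        x \<otimes>\<^bsub>B\<^esub> (c \<odot>\<^bsub>B\<^esub> y) = c \<odot>\<^bsub>B\<^esub> (x \<otimes>\<^bsub>B\<^esub> y))"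

definition lin_hom :: "'k ring \<Rightarrow> ('k, 'a) module \<Rightarrow> ('k, 'b) module \<Rightarrow> ('a \<Rightarrow> 'b) set" where
  "lin_hom K M N = {h \<in> carrier M \<rightarrow> carrier N.
     (\<forall>x\<in>carrier M. \<forall>y\<in>carrier M. h (x \<oplus>\<^bsub>M\<^esub> y) = h x \<oplus>\<^bsub>N\<^esub> h y) \<and>
     (\<forall>c\<in>carrier K. \<forall>x\<in>carrier M. h (c \<odot>\<^bsub>M\<^esub> x) = c \<odot>\<^bsub>N\<^esub> h x)}"

definition alg_hom :: "'k ring \<Rightarrow> ('k, 'a) module \<Rightarrow> ('k, 'b) module \<Rightarrow> ('a \<Rightarrow> 'b) set" where
  "alg_hom K B C = ring_hom B C \<inter> lin_hom K B C"

definition op_alg :: "('k, 'a) module \<Rightarrow> ('k, 'a) module" where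
  "op_alg B = B\<lparr>mult := (\<lambda>x y. y \<otimes>\<^bsub>B\<^esub> x)\<rparr>"


section \<open>Tensor products\<close>

text \<open>
  The tensor product of a list \<open>[M\<^sub>1, \<dots>, M\<^sub>n]\<close> of vector spaces (living in a common type) is the
  free vector space on the set of words \<open>[x\<^sub>1, \<dots>, x\<^sub>n]\<close> with \<open>x\<^sub>i \<in> M\<^sub>i\<close>, modulo the subspace spanned
  by the multilinearity relations. With lists, \<open>(M\<^sub>1 \<otimes> M\<^sub>2) \<otimes> M\<^sub>3\<close> and \<open>M\<^sub>1 \<otimes> (M\<^sub>2 \<otimes> M\<^sub>3)\<close> need not
  be identified by hand. The underlying vector space does not depend on the multiplications of the
  factors, so \<open>R\<close> may be replaced by its opposite when only linear maps are concerned.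
\<close>

definition free_space :: "'k ring \<Rightarrow> 'w set \<Rightarrow> ('k, 'w \<Rightarrow> 'k) module" where
  "free_space K W = \<lparr>
     carrier = {f. (\<forall>w. f w \<in> carrier K) \<and> (\<forall>w. w \<notin> W \<longrightarrow> f w = \<zero>\<^bsub>K\<^esub>) \<and> finite {w. f w \<noteq> \<zero>\<^bsub>K\<^esub>}},
     mult = undefined, one = undefined,
     zero = (\<lambda>w. \<zero>\<^bsub>K\<^esub>), add = (\<lambda>f g w. f w \<oplus>\<^bsub>K\<^esub> g w), smult = (\<lambda>c f w. c \<otimes>\<^bsub>K\<^esub> f w)\<rparr>"

definition single :: "'k ring \<Rightarrow> 'w \<Rightarrow> 'w \<Rightarrow> 'k" where
  "single K w = (\<lambda>v. if v = w then \<one>\<^bsub>K\<^esub> else \<zero>\<^bsub>K\<^esub>)"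

definition words :: "('k, 'a) module list \<Rightarrow> 'a list set" where
  "words Ms = listset (map carrier Ms)"

definition multilinear_relations ::
    "'k ring \<Rightarrow> ('k, 'a) module list \<Rightarrow> ('a list \<Rightarrow> 'k) set" where
  "multilinear_relations K Ms = (let F = free_space K (words Ms) in
     {single K (xs[i := x \<oplus>\<^bsub>Ms ! i\<^esub> y]) \<ominus>\<^bsub>F\<^esub> (single K (xs[i := x]) \<oplus>\<^bsub>F\<^esub> single K (xs[i := y])) | xs i x y.
        xs \<in> words Ms \<and> i < length Ms \<and> x \<in> carrier (Ms ! i) \<and> y \<in> carrier (Ms ! i)} \<union>
     {single K (xs[i := c \<odot>\<^bsub>Ms ! i\<^esub> x]) \<ominus>\<^bsub>F\<^esub> c \<odot>\<^bsub>F\<^esub> single K (xs[i := x]) | xs i c x.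
        xs \<in> words Ms \<and> i < length Ms \<and> c \<in> carrier K \<and> x \<in> carrier (Ms ! i)})"

definition tensor_null :: "'k ring \<Rightarrow> ('k, 'a) module list \<Rightarrow> ('a list \<Rightarrow> 'k) set" where
  "tensor_null K Ms =
     \<Inter>{H. submodule H K (free_space K (words Ms)) \<and> multilinear_relations K Ms \<subseteq> H}"

definition tensor_space ::
    "'k ring \<Rightarrow> ('k, 'a) module list \<Rightarrow> ('k, ('a list \<Rightarrow> 'k) set) module" where
  "tensor_space K Ms = (let F = free_space K (words Ms); N = tensor_null K Ms in
     \<lparr>carrier = a_rcosets\<^bsub>F\<^esub> N, mult = undefined, one = undefined,
      zero = N, add = set_add F, smult = (\<lambda>c X. \<Union>f\<in>X. N +>\<^bsub>F\<^esub> (c \<odot>\<^bsub>F\<^esub> f))\<rparr>)"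

definition pure_tensor ::
    "'k ring \<Rightarrow> ('k, 'a) module list \<Rightarrow> 'a list \<Rightarrow> ('a list \<Rightarrow> 'k) set" where
  "pure_tensor K Ms xs = tensor_null K Ms +>\<^bsub>free_space K (words Ms)\<^esub> single K xs"

definition lin_extend ::
    "'k ring \<Rightarrow> ('k, 'b) module \<Rightarrow> ('w \<Rightarrow> 'b) \<Rightarrow> ('w \<Rightarrow> 'k) \<Rightarrow> 'b" where
  "lin_extend K N \<phi> f = (\<Oplus>\<^bsub>N\<^esub>w\<in>{w. f w \<noteq> \<zero>\<^bsub>K\<^esub>}. f w \<odot>\<^bsub>N\<^esub> \<phi> w)"

text \<open>
  For \<open>\<phi>\<close> multilinear on \<open>words Ms\<close>, \<open>tensor_lift K N \<phi>\<close> is the linear map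
  from the tensor product to \<open>N\<close> with \<open>x\<^sub>1 \<otimes> \<dots> \<otimes> x\<^sub>n \<mapsto> \<phi> [x\<^sub>1, \<dots>, x\<^sub>n]\<close>: the linear extension of \<open>\<phi>\<close> is
  then constant on cosets, so that its image of a coset is a singleton.
\<close>

definition tensor_lift ::
    "'k ring \<Rightarrow> ('k, 'b) module \<Rightarrow> ('a list \<Rightarrow> 'b) \<Rightarrow> ('a list \<Rightarrow> 'k) set \<Rightarrow> 'b" where
  "tensor_lift K N \<phi> X = the_elem (lin_extend K N \<phi> ` X)"

definition tensor_lift3 ::
    "'k ring \<Rightarrow> ('k, 'b) module \<Rightarrow> ('a \<Rightarrow> 'a \<Rightarrow> 'a \<Rightarrow> 'b) \<Rightarrow> ('a list \<Rightarrow> 'k) set \<Rightarrow> 'b" where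
  "tensor_lift3 K N f = tensor_lift K N (\<lambda>xs. f (xs ! 0) (xs ! 1) (xs ! 2))"

text \<open>\<open>f\<^sub>1 \<otimes> \<dots> \<otimes> f\<^sub>n\<close> for a list of linear maps with values in \<open>Ns\<close>.\<close>

definition tensor_map ::
    "'k ring \<Rightarrow> ('k, 'b) module list \<Rightarrow> ('a \<Rightarrow> 'b) list \<Rightarrow> ('a list \<Rightarrow> 'k) set \<Rightarrow> ('b list \<Rightarrow> 'k) set" where
  "tensor_map K Ns fs = tensor_lift K (tensor_space K Ns)
     (\<lambda>xs. pure_tensor K Ns (map2 (\<lambda>f x. f x) fs xs))"

text \<open>
  The canonical map \<open>(X, Y) \<mapsto> X \<otimes> Y\<close> from a pair of tensor products to the tensor product of
  the concatenated list \<open>Ms\<close> of factors.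
\<close>

definition tensor_append ::
    "'k ring \<Rightarrow> ('k, 'a) module list \<Rightarrow> ('a list \<Rightarrow> 'k) set \<Rightarrow> ('a list \<Rightarrow> 'k) set \<Rightarrow> ('a list \<Rightarrow> 'k) set" where
  "tensor_append K Ms X Y = tensor_lift K (tensor_space K Ms)
     (\<lambda>xs. tensor_lift K (tensor_space K Ms) (\<lambda>ys. pure_tensor K Ms (xs @ ys)) Y) X"

definition tensor_mult ::
    "'k ring \<Rightarrow> ('k, 'a) module list \<Rightarrow> ('a list \<Rightarrow> 'k) set \<Rightarrow> ('a list \<Rightarrow> 'k) set \<Rightarrow> ('a list \<Rightarrow> 'k) set" where
  "tensor_mult K Bs X Y = tensor_lift K (tensor_space K Bs)
     (\<lambda>xs. tensor_lift K (tensor_space K Bs)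
        (\<lambda>ys. pure_tensor K Bs (map2 (\<lambda>B (x, y). x \<otimes>\<^bsub>B\<^esub> y) Bs (zip xs ys))) Y) X"

definition tensor_algebra ::
    "'k ring \<Rightarrow> ('k, 'a) module list \<Rightarrow> ('k, ('a list \<Rightarrow> 'k) set) module" where
  "tensor_algebra K Bs = (tensor_space K Bs)
     \<lparr>mult := tensor_mult K Bs, one := pure_tensor K Bs (map one Bs)\<rparr>"


section \<open>Hopf-Galois algebras\<close>

abbreviation triple :: "('k, 'a) module \<Rightarrow> ('k, 'a) module list" where
  "triple R \<equiv> [R, op_alg R, R]"

definition hopf_galois_algebra ::
    "'k ring \<Rightarrow> ('k, 'a) module \<Rightarrow> ('a \<Rightarrow> ('a list \<Rightarrow> 'k) set) \<Rightarrow> bool" where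
  "hopf_galois_algebra K R \<mu> \<longleftrightarrow>
     k_algebra K R \<and> carrier R \<noteq> {\<zero>\<^bsub>R\<^esub>} \<and>
     \<mu> \<in> alg_hom K R (tensor_algebra K (triple R)) \<and>
     (let T2 = [R, R]; T5 = [R, op_alg R, R, op_alg R, R];
          \<mu>_id_id = tensor_lift3 K (tensor_space K T5)
            (\<lambda>x y z. tensor_append K T5 (\<mu> x) (pure_tensor K [op_alg R, R] [y, z]));
          id_id_\<mu> = tensor_lift3 K (tensor_space K T5)
            (\<lambda>x y z. tensor_append K T5 (pure_tensor K [R, op_alg R] [x, y]) (\<mu> z));
          m_id = tensor_lift3 K (tensor_space K T2) (\<lambda>x y z. pure_tensor K T2 [x \<otimes>\<^bsub>R\<^esub> y, z]);
          id_m = tensor_lift3 K (tensor_space K T2) (\<lambda>x y z. pure_tensor K T2 [x, y \<otimes>\<^bsub>R\<^esub> z])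
      in \<forall>r\<in>carrier R.
           \<mu>_id_id (\<mu> r) = id_id_\<mu> (\<mu> r) \<and>
           m_id (\<mu> r) = pure_tensor K T2 [\<one>\<^bsub>R\<^esub>, r] \<and>
           id_m (\<mu> r) = pure_tensor K T2 [r, \<one>\<^bsub>R\<^esub>])"


section \<open>Poisson algebras\<close>

definition poisson_algebra :: "'k ring \<Rightarrow> ('k, 'a) module \<Rightarrow> ('a \<Rightarrow> 'a \<Rightarrow> 'a) \<Rightarrow> bool" where
  "poisson_algebra K A br \<longleftrightarrow>
     k_algebra K A \<and> cring A \<and>
     (\<forall>a\<in>carrier A. br a \<in> lin_hom K A A) \<and>
     (\<forall>b\<in>carrier A. (\<lambda>a. br a b) \<in> lin_hom K A A) \<and>
     (\<forall>a\<in>carrier A. br a a = \<zero>\<^bsub>A\<^esub>) \<and>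
     (\<forall>a\<in>carrier A. \<forall>b\<in>carrier A. \<forall>c\<in>carrier A.
        br a (br b c) \<oplus>\<^bsub>A\<^esub> br b (br c a) \<oplus>\<^bsub>A\<^esub> br c (br a b) = \<zero>\<^bsub>A\<^esub>) \<and>
     (\<forall>a\<in>carrier A. \<forall>b\<in>carrier A. \<forall>c\<in>carrier A.
        br a (b \<otimes>\<^bsub>A\<^esub> c) = br a b \<otimes>\<^bsub>A\<^esub> c \<oplus>\<^bsub>A\<^esub> b \<otimes>\<^bsub>A\<^esub> br a c)"

definition triple_bracket ::
    "'k ring \<Rightarrow> ('k, 'a) module \<Rightarrow> ('a \<Rightarrow> 'a \<Rightarrow> 'a) \<Rightarrow>
     ('a list \<Rightarrow> 'k) set \<Rightarrow> ('a list \<Rightarrow> 'k) set \<Rightarrow> ('a list \<Rightarrow> 'k) set" where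
  "triple_bracket K A br X Y =
     (let T = tensor_space K (triple A); t = (\<lambda>x y z. pure_tensor K (triple A) [x, y, z]) in
      tensor_lift3 K T (\<lambda>x y z. tensor_lift3 K T (\<lambda>x' y' z'.
        t (br x x') (y \<otimes>\<^bsub>A\<^esub> y') (z \<otimes>\<^bsub>A\<^esub> z')
        \<ominus>\<^bsub>T\<^esub> t (x \<otimes>\<^bsub>A\<^esub> x') (br y y') (z \<otimes>\<^bsub>A\<^esub> z')
        \<oplus>\<^bsub>T\<^esub> t (x \<otimes>\<^bsub>A\<^esub> x') (y \<otimes>\<^bsub>A\<^esub> y') (br z z')) Y) X)"

definition poisson_hopf_galois_algebra ::
    "'k ring \<Rightarrow> ('k, 'a) module \<Rightarrow> ('a \<Rightarrow> 'a \<Rightarrow> 'a) \<Rightarrow> ('a \<Rightarrow> ('a list \<Rightarrow> 'k) set) \<Rightarrow> bool" where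
  "poisson_hopf_galois_algebra K A br \<mu> \<longleftrightarrow>
     poisson_algebra K A br \<and> hopf_galois_algebra K A \<mu> \<and>
     (\<forall>a\<in>carrier A. \<forall>b\<in>carrier A. \<mu> (br a b) = triple_bracket K A br (\<mu> a) (\<mu> b))"


section \<open>Poisson enveloping algebras\<close>

definition commutator :: "('k, 'a) module \<Rightarrow> 'a \<Rightarrow> 'a \<Rightarrow> 'a" where
  "commutator B x y = x \<otimes>\<^bsub>B\<^esub> y \<ominus>\<^bsub>B\<^esub> y \<otimes>\<^bsub>B\<^esub> x"

definition enveloping_pair ::
    "'k ring \<Rightarrow> ('k, 'a) module \<Rightarrow> ('a \<Rightarrow> 'a \<Rightarrow> 'a) \<Rightarrow> ('k, 'b) module \<Rightarrow> ('a \<Rightarrow> 'b) \<Rightarrow> ('a \<Rightarrow> 'b) \<Rightarrow> bool" where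
  "enveloping_pair K A br B \<gamma> \<delta> \<longleftrightarrow>
     \<gamma> \<in> alg_hom K A B \<and> \<delta> \<in> lin_hom K A B \<and>
     (\<forall>a\<in>carrier A. \<forall>b\<in>carrier A.
        \<delta> (br a b) = commutator B (\<delta> a) (\<delta> b) \<and>
        \<gamma> (br a b) = commutator B (\<delta> a) (\<gamma> b) \<and>
        \<delta> (a \<otimes>\<^bsub>A\<^esub> b) = \<gamma> a \<otimes>\<^bsub>B\<^esub> \<delta> b \<oplus>\<^bsub>B\<^esub> \<gamma> b \<otimes>\<^bsub>B\<^esub> \<delta> a)"

definition enveloping_homs ::
    "'k ring \<Rightarrow> ('k, 'a) module \<Rightarrow> ('k, 'u) module \<Rightarrow> ('a \<Rightarrow> 'u) \<Rightarrow> ('a \<Rightarrow> 'u) \<Rightarrow>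
     ('k, 'b) module \<Rightarrow> ('a \<Rightarrow> 'b) \<Rightarrow> ('a \<Rightarrow> 'b) \<Rightarrow> ('u \<Rightarrow> 'b) set" where
  "enveloping_homs K A U \<alpha> \<beta> B \<gamma> \<delta> =
     {h \<in> alg_hom K U B \<inter> extensional (carrier U). \<forall>a\<in>carrier A. h (\<alpha> a) = \<gamma> a \<and> h (\<beta> a) = \<delta> a}"

text \<open>The universal property with respect to the algebras whose carrier lies in the type \<open>'b\<close>.\<close>

definition poisson_enveloping_for ::
    "'b itself \<Rightarrow> 'k ring \<Rightarrow> ('k, 'a) module \<Rightarrow> ('a \<Rightarrow> 'a \<Rightarrow> 'a) \<Rightarrow>
     ('k, 'u) module \<Rightarrow> ('a \<Rightarrow> 'u) \<Rightarrow> ('a \<Rightarrow> 'u) \<Rightarrow> bool" where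
  "poisson_enveloping_for T K A br U \<alpha> \<beta> \<longleftrightarrow>
     k_algebra K U \<and> enveloping_pair K A br U \<alpha> \<beta> \<and>
     (\<forall>(B :: ('k, 'b) module) \<gamma> \<delta>. k_algebra K B \<and> enveloping_pair K A br B \<gamma> \<delta> \<longrightarrow>
        (\<exists>!h. h \<in> enveloping_homs K A U \<alpha> \<beta> B \<gamma> \<delta>))"

text \<open>
  HOL cannot quantify over all types in a definition. It suffices to test against algebras
  in the type of \<open>U(A)\<close> and in the type of sets of formal expressions in two copies of \<open>A\<close> and the
  scalars, where every algebra generated by the images of \<open>A\<close> can be realised: lemma
  \<open>poisson_enveloping_any_type\<close> below derives the universal property for every type \<open>'b\<close>.
\<close>

datatype ('k, 'a) expr =
    Alpha 'a | Beta 'a | Scalar 'k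
  | Plus "('k, 'a) expr" "('k, 'a) expr" | Times "('k, 'a) expr" "('k, 'a) expr"

definition poisson_enveloping_algebra ::
    "'k ring \<Rightarrow> ('k, 'a) module \<Rightarrow> ('a \<Rightarrow> 'a \<Rightarrow> 'a) \<Rightarrow>
     ('k, 'u) module \<Rightarrow> ('a \<Rightarrow> 'u) \<Rightarrow> ('a \<Rightarrow> 'u) \<Rightarrow> bool" where
  "poisson_enveloping_algebra K A br U \<alpha> \<beta> \<longleftrightarrow>
     poisson_enveloping_for TYPE('u) K A br U \<alpha> \<beta> \<and>
     poisson_enveloping_for TYPE(('k, 'a) expr set) K A br U \<alpha> \<beta>"

text \<open>
  \<open>U(\<phi>)\<close> for \<open>\<phi> : A \<rightarrow> C\<close>, where \<open>(U, \<alpha>, \<beta>)\<close> and \<open>(V, \<alpha>', \<beta>')\<close> are the enveloping algebras of \<open>A\<close>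
  and \<open>C\<close>.
\<close>

definition enveloping_map ::
    "'k ring \<Rightarrow> ('k, 'a) module \<Rightarrow> ('k, 'u) module \<Rightarrow> ('a \<Rightarrow> 'u) \<Rightarrow> ('a \<Rightarrow> 'u) \<Rightarrow>
     ('k, 'v) module \<Rightarrow> ('c \<Rightarrow> 'v) \<Rightarrow> ('c \<Rightarrow> 'v) \<Rightarrow> ('a \<Rightarrow> 'c) \<Rightarrow> 'u \<Rightarrow> 'v" where
  "enveloping_map K A U \<alpha> \<beta> V \<alpha>' \<beta>' \<phi> =
     (THE h. h \<in> enveloping_homs K A U \<alpha> \<beta> V (\<alpha>' \<circ> \<phi>) (\<beta>' \<circ> \<phi>))"

definition env_\<alpha>\<alpha>\<alpha> ::
    "'k ring \<Rightarrow> ('k, 'u) module \<Rightarrow> ('a \<Rightarrow> 'u) \<Rightarrow> ('a list \<Rightarrow> 'k) set \<Rightarrow> ('u list \<Rightarrow> 'k) set" where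
  "env_\<alpha>\<alpha>\<alpha> K U \<alpha> = tensor_map K (triple U) [\<alpha>, \<alpha>, \<alpha>]"

definition env_\<xi> ::
    "'k ring \<Rightarrow> ('k, 'u) module \<Rightarrow> ('a \<Rightarrow> 'u) \<Rightarrow> ('a \<Rightarrow> 'u) \<Rightarrow> ('a list \<Rightarrow> 'k) set \<Rightarrow> ('u list \<Rightarrow> 'k) set" where
  "env_\<xi> K U \<alpha> \<beta> X =
     tensor_map K (triple U) [\<alpha>, \<alpha>, \<beta>] X
     \<oplus>\<^bsub>tensor_space K (triple U)\<^esub> tensor_map K (triple U) [\<alpha>, \<beta>, \<alpha>] X
     \<oplus>\<^bsub>tensor_space K (triple U)\<^esub> tensor_map K (triple U) [\<beta>, \<alpha>, \<alpha>] X"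

text \<open>
  \<open>U(\<mu>)\<close>, the enveloping algebra of \<open>A \<otimes> A \<otimes> A\<close> being taken to be
  \<open>(U(A) \<otimes> U(A)\<^sup>o\<^sup>p \<otimes> U(A), \<alpha> \<otimes> \<alpha> \<otimes> \<alpha>, \<xi>)\<close>.
\<close>

definition env_\<mu> ::
    "'k ring \<Rightarrow> ('k, 'a) module \<Rightarrow> ('a \<Rightarrow> ('a list \<Rightarrow> 'k) set) \<Rightarrow>
     ('k, 'u) module \<Rightarrow> ('a \<Rightarrow> 'u) \<Rightarrow> ('a \<Rightarrow> 'u) \<Rightarrow> 'u \<Rightarrow> ('u list \<Rightarrow> 'k) set" where
  "env_\<mu> K A \<mu> U \<alpha> \<beta> = enveloping_map K A U \<alpha> \<beta>
     (tensor_algebra K (triple U)) (env_\<alpha>\<alpha>\<alpha> K U \<alpha>) (env_\<xi> K U \<alpha> \<beta>) \<mu>"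


section \<open>The universal property for arbitrary types\<close>

definition k_subalgebra :: "'k ring \<Rightarrow> ('k, 'a) module \<Rightarrow> 'a set \<Rightarrow> bool" where
  "k_subalgebra K B S \<longleftrightarrow> S \<subseteq> carrier B \<and> \<one>\<^bsub>B\<^esub> \<in> S \<and>
     (\<forall>x\<in>S. \<forall>y\<in>S. x \<oplus>\<^bsub>B\<^esub> y \<in> S \<and> x \<otimes>\<^bsub>B\<^esub> y \<in> S) \<and> (\<forall>c\<in>carrier K. \<forall>x\<in>S. c \<odot>\<^bsub>B\<^esub> x \<in> S)"

definition transport ::
    "('k, 'b) module \<Rightarrow> 'b set \<Rightarrow> ('b \<Rightarrow> 'c) \<Rightarrow> ('c \<Rightarrow> 'b) \<Rightarrow> ('k, 'c) module" where
  "transport B S code dec = \<lparr>carrier = code ` S, mult = (\<lambda>x y. code (dec x \<otimes>\<^bsub>B\<^esub> dec y)), one = code \<one>\<^bsub>B\<^esub>,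
     zero = code \<zero>\<^bsub>B\<^esub>, add = (\<lambda>x y. code (dec x \<oplus>\<^bsub>B\<^esub> dec y)), smult = (\<lambda>c x. code (c \<odot>\<^bsub>B\<^esub> dec x))\<rparr>"

lemma k_subalgebra_transport:
  fixes B :: "('k, 'b) module" and code :: "'b \<Rightarrow> 'c"
  assumes B: "k_algebra K B" and S: "k_subalgebra K B S"
    and dec: "\<And>x. x \<in> S \<Longrightarrow> dec (code x) = x"
  shows "k_algebra K (transport B S code dec)" (is ?alg)
    and "dec \<in> alg_hom K (transport B S code dec) B" (is ?hom)
    and "\<And>x y. x \<in> S \<Longrightarrow> y \<in> S \<Longrightarrow>
      commutator (transport B S code dec) (code x) (code y) = code (commutator B x y)"
proof -
  define C where "C = transport B S code dec"
  note C_def = C_def[unfolded transport_def]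
  interpret K: field K using B by (simp add: k_algebra_def)
  interpret R: ring B using B by (simp add: k_algebra_def)
  interpret M: module K B using B by (simp add: k_algebra_def)
  have sub: "x \<in> carrier B" if "x \<in> S" for x using S that by (auto simp: k_subalgebra_def)
  have cl: "\<one>\<^bsub>B\<^esub> \<in> S" "\<And>x y. x \<in> S \<Longrightarrow> y \<in> S \<Longrightarrow> x \<oplus>\<^bsub>B\<^esub> y \<in> S"
    "\<And>x y. x \<in> S \<Longrightarrow> y \<in> S \<Longrightarrow> x \<otimes>\<^bsub>B\<^esub> y \<in> S"
    "\<And>c x. c \<in> carrier K \<Longrightarrow> x \<in> S \<Longrightarrow> c \<odot>\<^bsub>B\<^esub> x \<in> S"
    using S by (auto simp: k_subalgebra_def)
  have zero: "\<zero>\<^bsub>B\<^esub> \<in> S"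
    using cl(4)[of "\<zero>\<^bsub>K\<^esub>" "\<one>\<^bsub>B\<^esub>"] cl(1) by simp
  have neg: "\<ominus>\<^bsub>B\<^esub> x \<in> S" if "x \<in> S" for x
    using cl(4)[of "\<ominus>\<^bsub>K\<^esub> \<one>\<^bsub>K\<^esub>" x] that sub[OF that] by (simp add: M.smult_l_minus)
  note sm = sub cl zero neg dec
  have 1: "ring C"
  proof (rule ringI)
    show "abelian_group C"
    proof (rule abelian_groupI)
      fix x assume "x \<in> carrier C"
      then obtain s where s: "s \<in> S" "x = code s" by (auto simp: C_def)
      show "\<exists>y\<in>carrier C. y \<oplus>\<^bsub>C\<^esub> x = \<zero>\<^bsub>C\<^esub>"
        by (rule bexI[of _ "code (\<ominus>\<^bsub>B\<^esub> s)"]) (use s in \<open>auto simp: C_def sm R.l_neg\<close>)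
    qed (auto simp: C_def sm R.a_ac)
    show "Group.monoid C"
      by (rule monoidI) (auto simp: C_def sm R.m_assoc)
  qed (auto simp: C_def sm R.l_distr R.r_distr)
  have "module K C"
    by (rule moduleI) (use 1 in \<open>auto simp: C_def sm ring.is_abelian_group K.is_cring
       ring_def M.smult_l_distr M.smult_r_distr M.smult_assoc1\<close>)
  with 1 K.field_axioms have 2: "k_algebra K C"
    using B unfolding k_algebra_def by (auto simp: C_def sm)
  then show ?alg by (simp add: C_def transport_def)
  show ?hom
    by (auto simp: transport_def alg_hom_def lin_hom_def ring_hom_def sm)
  fix x y assume xy: "x \<in> S" "y \<in> S"
  have "\<ominus>\<^bsub>C\<^esub> code s = code (\<ominus>\<^bsub>B\<^esub> s)" if "s \<in> S" for s
    by (rule abelian_group.minus_equality[OF ring.is_abelian_group[OF 1]])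
      (use that in \<open>auto simp: C_def sm R.l_neg\<close>)
  with xy have "commutator C (code x) (code y) = code (commutator B x y)"
    unfolding commutator_def a_minus_def by (auto simp: C_def sm)
  then show "commutator (transport B S code dec) (code x) (code y) = code (commutator B x y)"
    by (simp add: C_def transport_def)
qed

lemma transport_pair:
  assumes B: "k_algebra K B" and S: "k_subalgebra K B S" and dec: "\<And>x. x \<in> S \<Longrightarrow> dec (code x) = x"
    and p: "enveloping_pair K A br B \<gamma> \<delta>" and gen: "\<And>a. a \<in> carrier A \<Longrightarrow> \<gamma> a \<in> S \<and> \<delta> a \<in> S"
  shows "enveloping_pair K A br (transport B S code dec) (code \<circ> \<gamma>) (code \<circ> \<delta>)"
proof -
  have "\<forall>x\<in>S. \<forall>y\<in>S. x \<otimes>\<^bsub>B\<^esub> y \<in> S" using S by (simp add: k_subalgebra_def)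
  then show ?thesis
    using p k_subalgebra_transport(3)[where dec = dec and code = code, OF B S dec]
    unfolding enveloping_pair_def
    by (auto simp: transport_def alg_hom_def lin_hom_def ring_hom_def dec gen)
qed

lemma alg_hom_comp:
  assumes "g \<in> alg_hom K A B" "h \<in> alg_hom K B C"
  shows "h \<circ> g \<in> alg_hom K A C"
  using assms by (auto simp: alg_hom_def lin_hom_def ring_hom_def Pi_def)

lemma alg_hom_restrict:
  assumes "k_algebra K A" "h \<in> alg_hom K A B"
  shows "restrict h (carrier A) \<in> alg_hom K A B"
proof -
  interpret R: ring A using assms by (simp add: k_algebra_def)
  interpret M: module K A using assms by (simp add: k_algebra_def)
  show ?thesis
    using assms(2) by (auto simp: alg_hom_def lin_hom_def ring_hom_def Pi_def)
qed

lemma alg_hom_id: "id \<in> alg_hom K A A"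
  by (auto simp: alg_hom_def lin_hom_def ring_hom_def)


lemma enveloping_generated:
  fixes U :: "('k, 'u) module"
  assumes U: "poisson_enveloping_for TYPE('u) K A br U \<alpha> \<beta>" and S: "k_subalgebra K U S"
    and gen: "\<And>a. a \<in> carrier A \<Longrightarrow> \<alpha> a \<in> S \<and> \<beta> a \<in> S"
  shows "carrier U \<subseteq> S"
proof -
  have kU: "k_algebra K U" and pU: "enveloping_pair K A br U \<alpha> \<beta>"
    and ex: "\<And>(B :: ('k, 'u) module) \<gamma> \<delta>. k_algebra K B \<Longrightarrow> enveloping_pair K A br B \<gamma> \<delta> \<Longrightarrow>
        (\<exists>!h. h \<in> enveloping_homs K A U \<alpha> \<beta> B \<gamma> \<delta>)"
    using U by (auto simp: poisson_enveloping_for_def)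
  let ?C = "transport U S id id"
  have C: "k_algebra K ?C" "enveloping_pair K A br ?C (id \<circ> \<alpha>) (id \<circ> \<beta>)" "id \<in> alg_hom K ?C U"
    using k_subalgebra_transport(1,2)[where dec = id and code = id, OF kU S]
      transport_pair[where dec = id and code = id, OF kU S _ pU gen] by simp_all
  then obtain h where h: "h \<in> enveloping_homs K A U \<alpha> \<beta> ?C (id \<circ> \<alpha>) (id \<circ> \<beta>)"
    using ex[OF C(1,2)] by blast
  have cl: "\<alpha> a \<in> carrier U" "\<beta> a \<in> carrier U" if "a \<in> carrier A" for a
    using gen[OF that] S by (auto simp: k_subalgebra_def)
  have "h \<in> enveloping_homs K A U \<alpha> \<beta> U \<alpha> \<beta>"
    using h alg_hom_comp[OF _ C(3), of h U] by (auto simp: enveloping_homs_def comp_def)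
  moreover have "restrict id (carrier U) \<in> enveloping_homs K A U \<alpha> \<beta> U \<alpha> \<beta>"
    using alg_hom_restrict[OF kU alg_hom_id] cl by (auto simp: enveloping_homs_def)
  ultimately have "h = restrict id (carrier U)" using ex[OF kU pU] by blast
  moreover have "h u \<in> S" if "u \<in> carrier U" for u
    using h that by (auto simp: enveloping_homs_def alg_hom_def lin_hom_def transport_def Pi_def)
  ultimately show ?thesis by auto
qed

lemma equalizer_subalgebra:
  assumes "k_algebra K U" "h \<in> alg_hom K U B" "h' \<in> alg_hom K U B"
  shows "k_subalgebra K U {u \<in> carrier U. h u = h' u}"
proof -
  interpret R: ring U using assms by (simp add: k_algebra_def)
  interpret M: module K U using assms by (simp add: k_algebra_def)
  show ?thesis
    using assms(2,3) by (auto simp: k_subalgebra_def alg_hom_def lin_hom_def ring_hom_def)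
qed

primrec expr_val ::
    "('k, 'b) module \<Rightarrow> ('a \<Rightarrow> 'b) \<Rightarrow> ('a \<Rightarrow> 'b) \<Rightarrow> ('k, 'a) expr \<Rightarrow> 'b" where
  "expr_val B \<gamma> \<delta> (Alpha a) = \<gamma> a"
| "expr_val B \<gamma> \<delta> (Beta a) = \<delta> a"
| "expr_val B \<gamma> \<delta> (Scalar c) = c \<odot>\<^bsub>B\<^esub> \<one>\<^bsub>B\<^esub>"
| "expr_val B \<gamma> \<delta> (Plus d e) = expr_val B \<gamma> \<delta> d \<oplus>\<^bsub>B\<^esub> expr_val B \<gamma> \<delta> e"
| "expr_val B \<gamma> \<delta> (Times d e) = expr_val B \<gamma> \<delta> d \<otimes>\<^bsub>B\<^esub> expr_val B \<gamma> \<delta> e"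

lemma expr_subalgebra:
  assumes B: "k_algebra K B"
    and gen: "\<And>a. a \<in> carrier A \<Longrightarrow> \<gamma> a \<in> carrier B \<and> \<delta> a \<in> carrier B"
  defines "S \<equiv> expr_val B \<gamma> \<delta> ` {e. set1_expr e \<subseteq> carrier K \<and> set2_expr e \<subseteq> carrier A}"
  shows "k_subalgebra K B S"
proof -
  interpret R: ring B using B by (simp add: k_algebra_def)
  interpret M: module K B using B by (simp add: k_algebra_def)
  let ?E = "{e. set1_expr e \<subseteq> carrier K \<and> set2_expr e \<subseteq> carrier A}"
  have carr: "expr_val B \<gamma> \<delta> e \<in> carrier B" if "e \<in> ?E" for e :: "('a, 'c) expr"
    using that by (induction e) (auto simp: gen)
  have S: "x \<in> carrier B" if "x \<in> S" for x using that carr by (auto simp: S_def)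
  have one: "\<one>\<^bsub>B\<^esub> \<in> S"
    unfolding S_def by (rule image_eqI[of _ _ "Scalar \<one>\<^bsub>K\<^esub>"]) auto
  have add: "x \<oplus>\<^bsub>B\<^esub> y \<in> S" and mult: "x \<otimes>\<^bsub>B\<^esub> y \<in> S" if xy: "x \<in> S" "y \<in> S" for x y
  proof -
    obtain d e where "d \<in> ?E" "e \<in> ?E" "x = expr_val B \<gamma> \<delta> d" "y = expr_val B \<gamma> \<delta> e"
      using xy unfolding S_def by blast
    then show "x \<oplus>\<^bsub>B\<^esub> y \<in> S" "x \<otimes>\<^bsub>B\<^esub> y \<in> S"
      unfolding S_def using image_eqI[of _ "expr_val B \<gamma> \<delta>" "Plus d e" ?E]
        image_eqI[of _ "expr_val B \<gamma> \<delta>" "Times d e" ?E] by simp_all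
  qed
  have scal: "c \<odot>\<^bsub>B\<^esub> x \<in> S" if c: "c \<in> carrier K" and x: "x \<in> S" for c x
  proof -
    have "c \<odot>\<^bsub>B\<^esub> \<one>\<^bsub>B\<^esub> \<in> S"
      unfolding S_def by (rule image_eqI[of _ _ "Scalar c"]) (use c in auto)
    moreover have "(c \<odot>\<^bsub>B\<^esub> \<one>\<^bsub>B\<^esub>) \<otimes>\<^bsub>B\<^esub> x = c \<odot>\<^bsub>B\<^esub> x"
      using B c S[OF x] by (simp add: k_algebra_def)
    ultimately show ?thesis using mult[OF _ x] by metis
  qed
  show ?thesis using S one add mult scal by (auto simp: k_subalgebra_def)
qed

lemma poisson_enveloping_any_type:
  fixes U :: "('k, 'u) module"
  assumes "poisson_enveloping_algebra K A br U \<alpha> \<beta>"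
  shows "poisson_enveloping_for TYPE('b) K A br U \<alpha> \<beta>"
proof -
  have U: "poisson_enveloping_for TYPE('u) K A br U \<alpha> \<beta>"
    and kU: "k_algebra K U" and pU: "enveloping_pair K A br U \<alpha> \<beta>"
    and ex: "\<And>(B :: ('k, ('k, 'a) expr set) module) \<gamma> \<delta>. k_algebra K B \<Longrightarrow>
        enveloping_pair K A br B \<gamma> \<delta> \<Longrightarrow> (\<exists>!h. h \<in> enveloping_homs K A U \<alpha> \<beta> B \<gamma> \<delta>)"
    using assms by (auto simp: poisson_enveloping_algebra_def poisson_enveloping_for_def)
  have "\<exists>!h. h \<in> enveloping_homs K A U \<alpha> \<beta> B \<gamma> \<delta>"
    if kB: "k_algebra K B" and pB: "enveloping_pair K A br B \<gamma> \<delta>" for B :: "('k, 'b) module" and \<gamma> \<delta>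
  proof (rule ex_ex1I)
    let ?E = "{e. set1_expr e \<subseteq> carrier K \<and> set2_expr e \<subseteq> carrier A}"
    define S where "S = expr_val B \<gamma> \<delta> ` ?E"
    define code where "code = (\<lambda>x. {e \<in> ?E. expr_val B \<gamma> \<delta> e = x})"
    define dec where "dec = (\<lambda>X. expr_val B \<gamma> \<delta> (SOME e. e \<in> X))"
    have gen: "\<gamma> a \<in> carrier B \<and> \<delta> a \<in> carrier B" if "a \<in> carrier A" for a
      using pB that by (auto simp: enveloping_pair_def alg_hom_def lin_hom_def)
    have S: "k_subalgebra K B S"
      unfolding S_def by (rule expr_subalgebra[OF kB gen])
    have genS: "\<gamma> a \<in> S \<and> \<delta> a \<in> S" if "a \<in> carrier A" for a
      unfolding S_def using that
      by (auto intro: image_eqI[of _ _ "Alpha a"] image_eqI[of _ _ "Beta a"])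
    have dec: "dec (code x) = x" if "x \<in> S" for x
    proof -
      have "\<exists>e. e \<in> code x" using that by (auto simp: S_def code_def)
      then have "(SOME e. e \<in> code x) \<in> code x" by (rule someI_ex)
      then show ?thesis by (simp add: dec_def code_def)
    qed
    let ?C = "transport B S code dec"
    obtain h where h: "h \<in> enveloping_homs K A U \<alpha> \<beta> ?C (code \<circ> \<gamma>) (code \<circ> \<delta>)"
      using ex[OF k_subalgebra_transport(1)[where dec = dec and code = code, OF kB S dec]
          transport_pair[where dec = dec and code = code, OF kB S dec pB genS]] by blast
    then have "dec \<circ> h \<in> alg_hom K U B"
      using alg_hom_comp[OF _ k_subalgebra_transport(2)[where dec = dec and code = code, OF kB S dec]] by (auto simp: enveloping_homs_def)
    then have "restrict (dec \<circ> h) (carrier U) \<in> alg_hom K U B"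
      by (rule alg_hom_restrict[OF kU])
    moreover have "\<alpha> a \<in> carrier U \<and> \<beta> a \<in> carrier U" if "a \<in> carrier A" for a
      using pU that by (auto simp: enveloping_pair_def alg_hom_def lin_hom_def)
    ultimately have "restrict (dec \<circ> h) (carrier U) \<in> enveloping_homs K A U \<alpha> \<beta> B \<gamma> \<delta>"
      using h dec genS by (auto simp: enveloping_homs_def)
    then show "\<exists>h. h \<in> enveloping_homs K A U \<alpha> \<beta> B \<gamma> \<delta>" by blast
  next
    fix h h' assume h: "h \<in> enveloping_homs K A U \<alpha> \<beta> B \<gamma> \<delta>" "h' \<in> enveloping_homs K A U \<alpha> \<beta> B \<gamma> \<delta>"
    have "carrier U \<subseteq> {u \<in> carrier U. h u = h' u}"
      by (rule enveloping_generated[OF U equalizer_subalgebra[OF kU, of h B h']])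
        (use h pU in \<open>auto simp: enveloping_homs_def enveloping_pair_def alg_hom_def lin_hom_def\<close>)
    then show "h = h'"
      using h by (intro extensionalityI[of h "carrier U"]) (auto simp: enveloping_homs_def)
  qed
  with kU pU show ?thesis by (auto simp: poisson_enveloping_for_def)
qed

end

theory Submission
  imports Defs
begin

text \<open>
  The relations of an enveloping pair pass to tensor products of commuting factors, so that
  \<open>(\<alpha> \<otimes> \<alpha> \<otimes> \<alpha>, \<xi>)\<close> is an enveloping pair and \<open>U(\<mu>)\<close> exists. Coassociativity is an equality of algebra
  homomorphisms, checked on \<open>\<alpha>(A)\<close> and \<open>\<beta>(A)\<close>. The maps \<open>m \<otimes> id\<close> and \<open>id \<otimes> m\<close> are not multiplicative, but the
  elements satisfying a unit axiom still form a subalgebra, so only \<open>\<beta>(A)\<close> matters; there the first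
  axiom reads \<open>(\<beta>(a\<^sub>1)\<alpha>(a\<^sub>2) + \<alpha>(a\<^sub>1)\<beta>(a\<^sub>2)) \<otimes> \<alpha>(a\<^sub>3) = 0\<close>. Multiplying out gives the stated condition;
  conversely, substituting \<open>\<beta>(a\<^sub>1) = - \<alpha>(a\<^sub>1\<^sub>1)\<beta>(a\<^sub>1\<^sub>2)\<alpha>(a\<^sub>1\<^sub>3)\<close> and using coassociativity of \<open>A\<close> gives the axiom.
  Moreover, \<open>U(A) \<noteq> 0\<close> because it acts on \<open>A\<close> by multiplications and brackets.
\<close>

section \<open>Linear maps\<close>

text \<open>No basis of \<open>U\<close> is used: it is known only through its universal property.
  Equations in \<open>U\<close> come from the relations between \<alpha> and \<beta>, or from
  subalgebras containing the images of both; equations between tensors are reduced to pure tensors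
  by showing that both sides are linear in every argument.

  The opposite algebra in the middle slot accounts for the minus sign in the bracket of the triple
  product: reversing products negates commutators, so \<alpha> and \<beta> satisfy the relations of
  a pair in the opposite of \<open>U\<close> for the negated bracket.

  One condition gives both unit axioms because it can be substituted at either end, for \<beta>(a1)
  or for \<beta>(a3). At the left end, coassociativity then produces a31 a32 (x) a33 = 1 (x) a3,
  which collapses. Necessity comes from the first axiom for \<open>U\<close>: after the two
  remaining slots are multiplied together, the term \<beta>(a1)\<alpha>(a2)\<alpha>(a3) equals
  \<beta>(a) by the second unit axiom of \<open>A\<close>.\<close>

lemma lin_homI:
  assumes "\<And>x. x \<in> carrier M \<Longrightarrow> h x \<in> carrier N"
    and "\<And>x y. x \<in> carrier M \<Longrightarrow> y \<in> carrier M \<Longrightarrow> h (x \<oplus>\<^bsub>M\<^esub> y) = h x \<oplus>\<^bsub>N\<^esub> h y"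
    and "\<And>c x. c \<in> carrier K \<Longrightarrow> x \<in> carrier M \<Longrightarrow> h (c \<odot>\<^bsub>M\<^esub> x) = c \<odot>\<^bsub>N\<^esub> h x"
  shows "h \<in> lin_hom K M N"
  using assms by (auto simp: lin_hom_def)

lemma
  assumes "h \<in> lin_hom K M N"
  shows lin_hom_closed: "x \<in> carrier M \<Longrightarrow> h x \<in> carrier N"
    and lin_hom_add: "x \<in> carrier M \<Longrightarrow> y \<in> carrier M \<Longrightarrow> h (x \<oplus>\<^bsub>M\<^esub> y) = h x \<oplus>\<^bsub>N\<^esub> h y"
    and lin_hom_smult: "c \<in> carrier K \<Longrightarrow> x \<in> carrier M \<Longrightarrow> h (c \<odot>\<^bsub>M\<^esub> x) = c \<odot>\<^bsub>N\<^esub> h x"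
  using assms by (auto simp: lin_hom_def)

lemma lin_hom_ident: "(\<lambda>x. x) \<in> lin_hom K M M"
  by (simp add: lin_hom_def)

lemma lin_hom_compose:
  "g \<in> lin_hom K M N \<Longrightarrow> h \<in> lin_hom K N P \<Longrightarrow> (\<lambda>x. h (g x)) \<in> lin_hom K M P"
  by (auto simp: lin_hom_def Pi_def)

lemma lin_hom_plus:
  assumes "module K N" "f \<in> lin_hom K M N" "g \<in> lin_hom K M N"
  shows "(\<lambda>x. f x \<oplus>\<^bsub>N\<^esub> g x) \<in> lin_hom K M N"
proof -
  interpret N: module K N by fact
  show ?thesis
    using assms(2,3) by (auto simp: lin_hom_def Pi_def N.M.a_ac N.smult_r_distr)
qed

lemma lin_hom_scale:
  assumes "module K N" "f \<in> lin_hom K M N" "c \<in> carrier K"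
  shows "(\<lambda>x. c \<odot>\<^bsub>N\<^esub> f x) \<in> lin_hom K M N"
proof -
  interpret N: module K N by fact
  show ?thesis
    using assms(2,3) N.R.m_comm
    by (auto simp: lin_hom_def Pi_def N.smult_r_distr N.smult_assoc1[symmetric])
qed

lemma
  assumes "module K M" "module K N" "h \<in> lin_hom K M N"
  shows lin_hom_zero: "h \<zero>\<^bsub>M\<^esub> = \<zero>\<^bsub>N\<^esub>"
    and lin_hom_uminus: "x \<in> carrier M \<Longrightarrow> h (\<ominus>\<^bsub>M\<^esub> x) = \<ominus>\<^bsub>N\<^esub> h x"
proof -
  interpret M: module K M by fact
  interpret N: module K N by fact
  have "h (\<zero>\<^bsub>K\<^esub> \<odot>\<^bsub>M\<^esub> \<zero>\<^bsub>M\<^esub>) = \<zero>\<^bsub>K\<^esub> \<odot>\<^bsub>N\<^esub> h \<zero>\<^bsub>M\<^esub>"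
    using assms(3) by (intro lin_hom_smult) auto
  then show 0: "h \<zero>\<^bsub>M\<^esub> = \<zero>\<^bsub>N\<^esub>" using lin_hom_closed[OF assms(3)] by simp
  assume x: "x \<in> carrier M"
  have "h (\<ominus>\<^bsub>M\<^esub> x) \<oplus>\<^bsub>N\<^esub> h x = \<zero>\<^bsub>N\<^esub>"
    using lin_hom_add[OF assms(3), of "\<ominus>\<^bsub>M\<^esub> x" x] x 0 by (simp add: M.M.l_neg)
  then show "h (\<ominus>\<^bsub>M\<^esub> x) = \<ominus>\<^bsub>N\<^esub> h x"
    using x lin_hom_closed[OF assms(3)] by (simp add: N.M.minus_equality)
qed

lemma lin_hom_minus:
  assumes "module K M" "module K N" "h \<in> lin_hom K M N" "x \<in> carrier M" "y \<in> carrier M"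
  shows "h (x \<ominus>\<^bsub>M\<^esub> y) = h x \<ominus>\<^bsub>N\<^esub> h y"
proof -
  interpret M: module K M by fact
  show ?thesis
    using assms by (simp add: a_minus_def lin_hom_add lin_hom_uminus)
qed

lemma lin_hom_neg:
  assumes "module K N" "f \<in> lin_hom K M N"
  shows "(\<lambda>x. \<ominus>\<^bsub>N\<^esub> f x) \<in> lin_hom K M N"
proof -
  interpret N: module K N by fact
  show ?thesis
    using assms(2) by (auto simp: lin_hom_def Pi_def N.M.minus_add N.smult_r_minus)
qed

lemma lin_hom_diff:
  assumes "module K N" "f \<in> lin_hom K M N" "g \<in> lin_hom K M N"
  shows "(\<lambda>x. f x \<ominus>\<^bsub>N\<^esub> g x) \<in> lin_hom K M N"
  unfolding a_minus_def by (intro lin_hom_plus lin_hom_neg assms)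

text \<open>Used for spanning arguments: once the equalizer is a submodule, two linear maps that
  agree on a spanning set agree everywhere.\<close>

lemma submodule_equalizer:
  assumes "module K M" "module K N" "g \<in> lin_hom K M N" "h \<in> lin_hom K M N"
  shows "submodule {x \<in> carrier M. g x = h x} K M"
proof -
  interpret M: module K M by fact
  interpret N: module K N by fact
  show ?thesis
    using assms by (intro M.submoduleI) (auto simp: lin_hom_add lin_hom_smult lin_hom_zero lin_hom_uminus)
qed

text \<open>Needed for \<open>tensor_null\<close>, which is defined as an intersection of
  submodules.\<close>

lemma (in module) submodule_Inter:
  assumes "\<H> \<noteq> {}" "\<And>H. H \<in> \<H> \<Longrightarrow> submodule H R M"
  shows "submodule (\<Inter>\<H>) R M"
proof (rule submoduleI)
  obtain H where "H \<in> \<H>" using assms(1) by auto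
  then show "\<Inter>\<H> \<subseteq> carrier M" using submoduleE(1)[OF assms(2)] by auto
next
  show "\<zero>\<^bsub>M\<^esub> \<in> \<Inter>\<H>"
  proof
    fix H assume "H \<in> \<H>"
    then show "\<zero>\<^bsub>M\<^esub> \<in> H" using subgroup.one_closed[OF submodule.axioms(1)[OF assms(2)]] by simp
  qed
qed (use submoduleE(3-5)[OF assms(2)] in auto)


section \<open>Free vector spaces\<close>

lemma free_space_simps [simp]:
  "\<zero>\<^bsub>free_space K W\<^esub> = (\<lambda>w. \<zero>\<^bsub>K\<^esub>)"
  "f \<oplus>\<^bsub>free_space K W\<^esub> g = (\<lambda>w. f w \<oplus>\<^bsub>K\<^esub> g w)"
  "c \<odot>\<^bsub>free_space K W\<^esub> f = (\<lambda>w. c \<otimes>\<^bsub>K\<^esub> f w)"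
  by (simp_all add: free_space_def)

lemma carrier_free_space:
  "f \<in> carrier (free_space K W) \<longleftrightarrow>
     (\<forall>w. f w \<in> carrier K) \<and> (\<forall>w. w \<notin> W \<longrightarrow> f w = \<zero>\<^bsub>K\<^esub>) \<and> finite {w. f w \<noteq> \<zero>\<^bsub>K\<^esub>}"
  by (simp add: free_space_def)

lemma module_free_space:
  assumes "cring K"
  shows "module K (free_space K W)"
proof -
  interpret K: cring K by fact
  let ?F = "free_space K W"
  have fin: "finite {w. f w \<oplus>\<^bsub>K\<^esub> g w \<noteq> \<zero>\<^bsub>K\<^esub>}"
    if "finite {w. f w \<noteq> \<zero>\<^bsub>K\<^esub>}" "finite {w. g w \<noteq> \<zero>\<^bsub>K\<^esub>}" for f g :: "'b \<Rightarrow> 'a"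
    by (rule finite_subset[OF _ finite_UnI[OF that]]) auto
  have fin': "finite {w. c \<otimes>\<^bsub>K\<^esub> f w \<noteq> \<zero>\<^bsub>K\<^esub>}"
    if "finite {w. f w \<noteq> \<zero>\<^bsub>K\<^esub>}" "c \<in> carrier K" for c and f :: "'b \<Rightarrow> 'a"
    by (rule finite_subset[OF _ that(1)]) (use that in auto)
  have "abelian_group ?F"
  proof (rule abelian_groupI)
    fix f assume f: "f \<in> carrier ?F"
    have *: "finite {w. \<ominus>\<^bsub>K\<^esub> f w \<noteq> \<zero>\<^bsub>K\<^esub>}"
      by (rule finite_subset[of _ "{w. f w \<noteq> \<zero>\<^bsub>K\<^esub>}"]) (use f in \<open>auto simp: carrier_free_space\<close>)
    show "\<exists>g\<in>carrier ?F. g \<oplus>\<^bsub>?F\<^esub> f = \<zero>\<^bsub>?F\<^esub>"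
      by (rule bexI[of _ "\<lambda>w. \<ominus>\<^bsub>K\<^esub> f w"])
        (use f * in \<open>auto simp: carrier_free_space K.l_neg\<close>)
  qed (auto simp: carrier_free_space fin K.a_ac)
  then show ?thesis
    by (rule moduleI[OF assms])
      (auto simp: carrier_free_space fin' K.l_distr K.r_distr K.m_assoc)
qed

lemma single_in_free_space:
  assumes "cring K" "w \<in> W"
  shows "single K w \<in> carrier (free_space K W)"
proof -
  interpret K: cring K by fact
  have "finite {v. single K w v \<noteq> \<zero>\<^bsub>K\<^esub>}"
    by (rule finite_subset[of _ "{w}"]) (auto simp: single_def)
  with assms(2) show ?thesis by (auto simp: carrier_free_space single_def)
qed

text \<open>Induction on the finite support: a function is its modification to zero at one point v
  of the support plus a multiple of \<open>single K v\<close>.\<close>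

lemma free_space_spanned:
  assumes "cring K" "submodule H K (free_space K W)" "\<And>w. w \<in> W \<Longrightarrow> single K w \<in> H"
  shows "carrier (free_space K W) \<subseteq> H"
proof
  interpret K: cring K by fact
  interpret F: module K "free_space K W" by (rule module_free_space) fact
  fix f assume "f \<in> carrier (free_space K W)"
  then have "finite {w. f w \<noteq> \<zero>\<^bsub>K\<^esub>}" by (simp add: carrier_free_space)
  from this \<open>f \<in> carrier (free_space K W)\<close> show "f \<in> H"
  proof (induction "{w. f w \<noteq> \<zero>\<^bsub>K\<^esub>}" arbitrary: f rule: finite_induct)
    case empty
    then have "f = \<zero>\<^bsub>free_space K W\<^esub>" by auto
    then show ?case
      using subgroup.one_closed[OF submodule.axioms(1)[OF assms(2)]] by simp
  next
    case (insert v S)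
    let ?g = "f(v := \<zero>\<^bsub>K\<^esub>)"
    have fv: "f v \<noteq> \<zero>\<^bsub>K\<^esub>" using insert.hyps(4) by auto
    have S: "S = {w. ?g w \<noteq> \<zero>\<^bsub>K\<^esub>}" using insert.hyps(2,4) by (auto split: if_splits)
    moreover have "?g \<in> carrier (free_space K W)"
      using insert.prems insert.hyps(1) S by (auto simp: carrier_free_space)
    ultimately have "?g \<in> H" by (rule insert.hyps(3))
    moreover have "v \<in> W" using insert.prems fv by (auto simp: carrier_free_space)
    then have "f v \<odot>\<^bsub>free_space K W\<^esub> single K v \<in> H"
      using F.submoduleE(4)[OF assms(2)] assms(3) insert.prems
      by (auto simp: carrier_free_space)
    ultimately have "?g \<oplus>\<^bsub>free_space K W\<^esub> (f v \<odot>\<^bsub>free_space K W\<^esub> single K v) \<in> H"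
      by (rule F.submoduleE(5)[OF assms(2)])
    also have "?g \<oplus>\<^bsub>free_space K W\<^esub> (f v \<odot>\<^bsub>free_space K W\<^esub> single K v) = f"
      using insert.prems by (auto simp: single_def carrier_free_space)
    finally show ?case .
  qed
qed

text \<open>The defining sum of \<open>lin_extend\<close> runs over the support, which varies with
  f. Padding with zero terms moves several such sums to one index set, where linearity can be
  checked term by term.\<close>

lemma lin_extend_superset:
  assumes "module K N" "\<phi> \<in> W \<rightarrow> carrier N" "f \<in> carrier (free_space K W)"
    and "finite S" "{w. f w \<noteq> \<zero>\<^bsub>K\<^esub>} \<subseteq> S" "S \<subseteq> W"
  shows "lin_extend K N \<phi> f = (\<Oplus>\<^bsub>N\<^esub>w\<in>S. f w \<odot>\<^bsub>N\<^esub> \<phi> w)"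
proof -
  interpret N: module K N by fact
  show ?thesis
    unfolding lin_extend_def
    by (rule N.M.add.finprod_mono_neutral_cong_left)
      (use assms(2-6) in \<open>auto simp: carrier_free_space Pi_def subset_iff\<close>)
qed

lemma lin_extend_lin:
  assumes "module K N" "\<phi> \<in> W \<rightarrow> carrier N"
  shows "lin_extend K N \<phi> \<in> lin_hom K (free_space K W) N"
proof -
  interpret N: module K N by fact
  interpret F: module K "free_space K W" by (rule module_free_space) (rule N.R.cring_axioms)
  show ?thesis
  proof (rule lin_homI)
    fix f assume f: "f \<in> carrier (free_space K W)"
    let ?S = "{w. f w \<noteq> \<zero>\<^bsub>K\<^esub>}"
    have S: "finite ?S" "?S \<subseteq> W" using f by (auto simp: carrier_free_space)
    have cl: "(\<lambda>w. f w \<odot>\<^bsub>N\<^esub> \<phi> w) \<in> ?S \<rightarrow> carrier N"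
      using S f assms(2) by (auto simp: carrier_free_space Pi_def)
    then show "lin_extend K N \<phi> f \<in> carrier N"
      unfolding lin_extend_def by (rule N.M.finsum_closed)
    fix c assume c: "c \<in> carrier K"
    have cf: "c \<odot>\<^bsub>free_space K W\<^esub> f \<in> carrier (free_space K W)" using c f by (rule F.smult_closed)
    have "{w. (c \<odot>\<^bsub>free_space K W\<^esub> f) w \<noteq> \<zero>\<^bsub>K\<^esub>} \<subseteq> ?S" using c by auto
    then have "lin_extend K N \<phi> (c \<odot>\<^bsub>free_space K W\<^esub> f) =
        (\<Oplus>\<^bsub>N\<^esub>w\<in>?S. (c \<odot>\<^bsub>free_space K W\<^esub> f) w \<odot>\<^bsub>N\<^esub> \<phi> w)"
      by (rule lin_extend_superset[OF assms cf S(1) _ S(2)])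
    also have "\<dots> = (\<Oplus>\<^bsub>N\<^esub>w\<in>?S. c \<odot>\<^bsub>N\<^esub> (f w \<odot>\<^bsub>N\<^esub> \<phi> w))"
      by (rule N.M.finsum_cong') (use c f S assms(2) in \<open>auto simp: carrier_free_space Pi_def N.smult_assoc1\<close>)
    also have "\<dots> = c \<odot>\<^bsub>N\<^esub> lin_extend K N \<phi> f"
      unfolding lin_extend_def using S(1) c cl by (rule N.finsum_smult_ldistr[symmetric])
    finally show "lin_extend K N \<phi> (c \<odot>\<^bsub>free_space K W\<^esub> f) = c \<odot>\<^bsub>N\<^esub> lin_extend K N \<phi> f" .
  next
    fix f g assume f: "f \<in> carrier (free_space K W)" and g: "g \<in> carrier (free_space K W)"
    \<comment> \<open>Cancellation can make the support of the sum smaller than this union, so all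
      three sums are taken over the union instead.\<close>
    let ?S = "{w. f w \<noteq> \<zero>\<^bsub>K\<^esub>} \<union> {w. g w \<noteq> \<zero>\<^bsub>K\<^esub>}"
    have fg: "f \<oplus>\<^bsub>free_space K W\<^esub> g \<in> carrier (free_space K W)" using f g by (rule F.M.a_closed)
    have S: "finite ?S" "?S \<subseteq> W" using f g by (auto simp: carrier_free_space)
    have ext: "lin_extend K N \<phi> h = (\<Oplus>\<^bsub>N\<^esub>w\<in>?S. h w \<odot>\<^bsub>N\<^esub> \<phi> w)"
      if "h \<in> carrier (free_space K W)" "{w. h w \<noteq> \<zero>\<^bsub>K\<^esub>} \<subseteq> ?S" for h
      using that(1) S(1) that(2) S(2) by (rule lin_extend_superset[OF assms])
    have "lin_extend K N \<phi> (f \<oplus>\<^bsub>free_space K W\<^esub> g) =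
        (\<Oplus>\<^bsub>N\<^esub>w\<in>?S. (f \<oplus>\<^bsub>free_space K W\<^esub> g) w \<odot>\<^bsub>N\<^esub> \<phi> w)"
      by (rule ext[OF fg]) auto
    also have "\<dots> = (\<Oplus>\<^bsub>N\<^esub>w\<in>?S. f w \<odot>\<^bsub>N\<^esub> \<phi> w \<oplus>\<^bsub>N\<^esub> g w \<odot>\<^bsub>N\<^esub> \<phi> w)"
      by (rule N.M.finsum_cong')
        (use f g S assms(2) in \<open>auto simp: carrier_free_space Pi_def N.smult_l_distr\<close>)
    also have "\<dots> = (\<Oplus>\<^bsub>N\<^esub>w\<in>?S. f w \<odot>\<^bsub>N\<^esub> \<phi> w) \<oplus>\<^bsub>N\<^esub> (\<Oplus>\<^bsub>N\<^esub>w\<in>?S. g w \<odot>\<^bsub>N\<^esub> \<phi> w)"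
      by (rule N.M.finsum_addf) (use f g S assms(2) in \<open>auto simp: carrier_free_space Pi_def\<close>)
    finally show "lin_extend K N \<phi> (f \<oplus>\<^bsub>free_space K W\<^esub> g) = lin_extend K N \<phi> f \<oplus>\<^bsub>N\<^esub> lin_extend K N \<phi> g"
      using f g by (simp add: ext)
  qed
qed

lemma lin_extend_single:
  assumes "module K N" "\<phi> \<in> W \<rightarrow> carrier N" "w \<in> W"
  shows "lin_extend K N \<phi> (single K w) = \<phi> w"
proof -
  interpret N: module K N by fact
  have "lin_extend K N \<phi> (single K w) = (\<Oplus>\<^bsub>N\<^esub>v\<in>{w}. single K w v \<odot>\<^bsub>N\<^esub> \<phi> v)"
    by (rule lin_extend_superset[OF assms(1,2) single_in_free_space])
      (use assms(3) N.R.cring_axioms in \<open>auto simp: single_def\<close>)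
  also have "\<dots> = \<phi> w" using assms(2,3) by (simp add: single_def Pi_def)
  finally show ?thesis .
qed

section \<open>Tensor products\<close>

lemma in_words_iff:
  "xs \<in> words Ms \<longleftrightarrow> length xs = length Ms \<and> (\<forall>i<length Ms. xs ! i \<in> carrier (Ms ! i))"
proof -
  have "xs \<in> listset As \<longleftrightarrow> length xs = length As \<and> (\<forall>i<length As. xs ! i \<in> As ! i)" for As
    by (induction As arbitrary: xs) (auto simp: set_Cons_def nth_Cons less_Suc_eq_0_disj length_Suc_conv split: nat.splits)
  then show ?thesis by (auto simp: words_def)
qed

lemma length_words: "xs \<in> words Ms \<Longrightarrow> length xs = length Ms"
  by (simp add: in_words_iff)

lemma words_Nil [simp]: "[] \<in> words Ms \<longleftrightarrow> Ms = []"
  by (auto simp: in_words_iff)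

lemma words_Cons [simp]: "x # xs \<in> words (M # Ms) \<longleftrightarrow> x \<in> carrier M \<and> xs \<in> words Ms"
  by (auto simp: words_def set_Cons_def)

lemma words_update: "xs \<in> words Ms \<Longrightarrow> x \<in> carrier (Ms ! i) \<Longrightarrow> xs[i := x] \<in> words Ms"
  by (cases "i < length xs") (auto simp: in_words_iff nth_list_update)

lemma words_append: "xs \<in> words Ms \<Longrightarrow> ys \<in> words Ns \<Longrightarrow> xs @ ys \<in> words (Ms @ Ns)"
  by (auto simp: in_words_iff nth_append)

text \<open>Phrased through list update to match the shape of \<open>multilinear_relations\<close>:
  each relation is then killed by exactly one of the two linearity clauses in one slot.\<close>

definition multilinear ::
    "'k ring \<Rightarrow> ('k, 'a) module list \<Rightarrow> ('k, 'b) module \<Rightarrow> ('a list \<Rightarrow> 'b) \<Rightarrow> bool" where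
  "multilinear K Ms N \<phi> \<longleftrightarrow> \<phi> \<in> words Ms \<rightarrow> carrier N \<and>
     (\<forall>xs\<in>words Ms. \<forall>i<length Ms. (\<lambda>x. \<phi> (xs[i := x])) \<in> lin_hom K (Ms ! i) N)"

locale tensor_factors = field K for K :: "'k ring" and Ms :: "('k, 'a) module list" +
  assumes factor_module: "i < length Ms \<Longrightarrow> module K (Ms ! i)"
begin

abbreviation "F \<equiv> free_space K (words Ms)"
abbreviation "N\<^sub>0 \<equiv> tensor_null K Ms"
abbreviation "T \<equiv> tensor_space K Ms"

sublocale F: module K F
  by (rule module_free_space) (rule cring_axioms)

lemma single_closed: "xs \<in> words Ms \<Longrightarrow> single K xs \<in> carrier F"
  by (rule single_in_free_space[OF cring_axioms])

lemma multilinear_relations_subset: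
  "multilinear_relations K Ms \<subseteq> carrier F"
proof -
  have "single K (xs[i := x]) \<in> carrier F" if "xs \<in> words Ms" "x \<in> carrier (Ms ! i)" for xs i x
    using that by (intro single_closed words_update)
  moreover have "x \<oplus>\<^bsub>Ms ! i\<^esub> y \<in> carrier (Ms ! i)"
    if "i < length Ms" "x \<in> carrier (Ms ! i)" "y \<in> carrier (Ms ! i)" for i x y
    using that factor_module by (meson abelian_groupE(1) module_def)
  moreover have "c \<odot>\<^bsub>Ms ! i\<^esub> x \<in> carrier (Ms ! i)"
    if "i < length Ms" "c \<in> carrier K" "x \<in> carrier (Ms ! i)" for i c x
    using that module.smult_closed[OF factor_module] by blast
  ultimately show ?thesis
    by (auto simp only: multilinear_relations_def Let_def Un_iff mem_Collect_eq
        intro!: F.M.minus_closed F.M.a_closed F.smult_closed)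
qed

lemma null_submodule: "submodule N\<^sub>0 K F"
  unfolding tensor_null_def
  \<comment> \<open>The whole free space is a member of the intersected family, which is therefore
    not empty.\<close>
  using F.carrier_is_submodule multilinear_relations_subset
  by (intro F.submodule_Inter) auto

lemma relations_null: "multilinear_relations K Ms \<subseteq> N\<^sub>0"
  by (auto simp: tensor_null_def)

sublocale N: abelian_subgroup N\<^sub>0 F
  by (rule abelian_subgroupI3)
    (auto intro: additive_subgroup.intro submodule.axioms(1)[OF null_submodule] F.M.abelian_group_axioms)

lemma tensor_space_simps:
  "carrier T = a_rcosets\<^bsub>F\<^esub> N\<^sub>0" "\<zero>\<^bsub>T\<^esub> = N\<^sub>0" "X \<oplus>\<^bsub>T\<^esub> Y = X <+>\<^bsub>F\<^esub> Y"
  by (simp_all add: tensor_space_def Let_def)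

lemma carrier_tensor_space: "X \<in> carrier T \<longleftrightarrow> (\<exists>f\<in>carrier F. X = N\<^sub>0 +>\<^bsub>F\<^esub> f)"
  by (auto simp: tensor_space_simps A_RCOSETS_def')

lemma coset_add:
  assumes "f \<in> carrier F" "g \<in> carrier F"
  shows "(N\<^sub>0 +>\<^bsub>F\<^esub> f) \<oplus>\<^bsub>T\<^esub> (N\<^sub>0 +>\<^bsub>F\<^esub> g) = N\<^sub>0 +>\<^bsub>F\<^esub> (f \<oplus>\<^bsub>F\<^esub> g)"
  using N.a_rcos_sum[OF assms] by (simp add: tensor_space_simps)

lemma coset_eq_iff:
  assumes "f \<in> carrier F" "g \<in> carrier F"
  shows "N\<^sub>0 +>\<^bsub>F\<^esub> f = N\<^sub>0 +>\<^bsub>F\<^esub> g \<longleftrightarrow> f \<ominus>\<^bsub>F\<^esub> g \<in> N\<^sub>0"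
proof -
  have "f \<in> N\<^sub>0 +>\<^bsub>F\<^esub> g \<longleftrightarrow> f \<ominus>\<^bsub>F\<^esub> g \<in> N\<^sub>0"
    using N.a_rcos_module[OF assms(2,1)] by (simp add: a_minus_def)
  moreover have "N\<^sub>0 +>\<^bsub>F\<^esub> f = N\<^sub>0 +>\<^bsub>F\<^esub> g" if "f \<in> N\<^sub>0 +>\<^bsub>F\<^esub> g"
    using N.a_repr_independence'[OF that assms(2)] by (rule sym)
  moreover have "f \<in> N\<^sub>0 +>\<^bsub>F\<^esub> f" using assms(1) by (rule N.a_rcos_self)
  ultimately show ?thesis by blast
qed

text \<open>Scaling of a coset is defined as a union over all its representatives. Since
  \<open>N\<^sub>0\<close> is stable under scalars, every representative contributes the same coset
  and the union collapses.\<close>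

lemma coset_smult:
  assumes c: "c \<in> carrier K" and f: "f \<in> carrier F"
  shows "c \<odot>\<^bsub>T\<^esub> (N\<^sub>0 +>\<^bsub>F\<^esub> f) = N\<^sub>0 +>\<^bsub>F\<^esub> (c \<odot>\<^bsub>F\<^esub> f)"
proof -
  have "N\<^sub>0 +>\<^bsub>F\<^esub> (c \<odot>\<^bsub>F\<^esub> g) = N\<^sub>0 +>\<^bsub>F\<^esub> (c \<odot>\<^bsub>F\<^esub> f)" if g: "g \<in> N\<^sub>0 +>\<^bsub>F\<^esub> f" for g
  proof -
    obtain n where n: "n \<in> N\<^sub>0" "g = n \<oplus>\<^bsub>F\<^esub> f"
      using g by (auto simp: a_r_coset_def' simp del: free_space_simps)
    have cn: "c \<odot>\<^bsub>F\<^esub> n \<in> N\<^sub>0" and nF: "n \<in> carrier F"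
      using F.submoduleE(4)[OF null_submodule c n(1)] F.submoduleE(1)[OF null_submodule] n(1) by auto
    have "c \<odot>\<^bsub>F\<^esub> g = c \<odot>\<^bsub>F\<^esub> n \<oplus>\<^bsub>F\<^esub> c \<odot>\<^bsub>F\<^esub> f"
      unfolding n(2) using c nF f by (rule F.smult_r_distr)
    then have "c \<odot>\<^bsub>F\<^esub> g \<in> N\<^sub>0 +>\<^bsub>F\<^esub> (c \<odot>\<^bsub>F\<^esub> f)"
      using cn by (auto simp: a_r_coset_def' simp del: free_space_simps)
    then show ?thesis
      using N.a_repr_independence'[of "c \<odot>\<^bsub>F\<^esub> g" "c \<odot>\<^bsub>F\<^esub> f"] c f by (simp del: free_space_simps)
  qed
  then have "(\<Union>g\<in>N\<^sub>0 +>\<^bsub>F\<^esub> f. N\<^sub>0 +>\<^bsub>F\<^esub> (c \<odot>\<^bsub>F\<^esub> g)) = N\<^sub>0 +>\<^bsub>F\<^esub> (c \<odot>\<^bsub>F\<^esub> f)"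
    by (intro UN_constant_eq[OF N.a_rcos_self[OF f]] ballI)
  then show ?thesis by (simp add: tensor_space_def Let_def del: free_space_simps)
qed

sublocale T: module K T
proof (rule moduleI)
  have zero: "\<zero>\<^bsub>T\<^esub> = N\<^sub>0 +>\<^bsub>F\<^esub> \<zero>\<^bsub>F\<^esub>"
    using F.M.a_coset_add_zero[OF N.a_subset] by (simp add: tensor_space_simps)
  show "abelian_group T"
  proof (rule abelian_groupI)
    fix X assume "X \<in> carrier T"
    then obtain f where f: "f \<in> carrier F" "X = N\<^sub>0 +>\<^bsub>F\<^esub> f" by (auto simp: carrier_tensor_space)
    show "\<exists>Y\<in>carrier T. Y \<oplus>\<^bsub>T\<^esub> X = \<zero>\<^bsub>T\<^esub>"
      by (rule bexI[of _ "N\<^sub>0 +>\<^bsub>F\<^esub> (\<ominus>\<^bsub>F\<^esub> f)"])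
        (use f in \<open>auto simp: carrier_tensor_space coset_add zero F.M.l_neg simp del: free_space_simps\<close>)
  qed (auto simp: carrier_tensor_space coset_add zero F.M.a_ac simp del: free_space_simps)
qed (use F.smult_l_distr F.smult_r_distr F.smult_assoc1 F.smult_one cring_axioms in
  \<open>auto simp: carrier_tensor_space coset_smult coset_add simp del: free_space_simps\<close>)

lemma coset_lin: "(\<lambda>f. N\<^sub>0 +>\<^bsub>F\<^esub> f) \<in> lin_hom K F T"
  by (rule lin_homI) (auto simp: carrier_tensor_space coset_smult coset_add simp del: free_space_simps)

lemma pure_closed: "xs \<in> words Ms \<Longrightarrow> pure_tensor K Ms xs \<in> carrier T"
  by (auto simp: pure_tensor_def carrier_tensor_space intro: single_closed)

lemma multilinear_pure: "multilinear K Ms T (pure_tensor K Ms)"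
  unfolding multilinear_def
proof (intro conjI ballI allI impI lin_homI)
  fix xs i assume xs: "xs \<in> words Ms" and i: "i < length Ms"
  interpret M: module K "Ms ! i" using i by (rule factor_module)
  have s: "single K (xs[i := x]) \<in> carrier F" if "x \<in> carrier (Ms ! i)" for x
    using xs that by (intro single_closed words_update)
  show "pure_tensor K Ms (xs[i := x]) \<in> carrier T" if "x \<in> carrier (Ms ! i)" for x
    using xs that by (intro pure_closed words_update)
  show "pure_tensor K Ms (xs[i := x \<oplus>\<^bsub>Ms ! i\<^esub> y]) =
      pure_tensor K Ms (xs[i := x]) \<oplus>\<^bsub>T\<^esub> pure_tensor K Ms (xs[i := y])"
    if x: "x \<in> carrier (Ms ! i)" and y: "y \<in> carrier (Ms ! i)" for x y
  proof -
    have "single K (xs[i := x \<oplus>\<^bsub>Ms ! i\<^esub> y]) \<ominus>\<^bsub>F\<^esub> (single K (xs[i := x]) \<oplus>\<^bsub>F\<^esub> single K (xs[i := y]))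
        \<in> multilinear_relations K Ms"
      unfolding multilinear_relations_def Let_def using xs i x y by blast
    with relations_null show ?thesis
      unfolding pure_tensor_def
      by (subst coset_add) (auto simp: coset_eq_iff s x y simp del: free_space_simps)
  qed
  show "pure_tensor K Ms (xs[i := c \<odot>\<^bsub>Ms ! i\<^esub> x]) = c \<odot>\<^bsub>T\<^esub> pure_tensor K Ms (xs[i := x])"
    if c: "c \<in> carrier K" and x: "x \<in> carrier (Ms ! i)" for c x
  proof -
    have "single K (xs[i := c \<odot>\<^bsub>Ms ! i\<^esub> x]) \<ominus>\<^bsub>F\<^esub> c \<odot>\<^bsub>F\<^esub> single K (xs[i := x])
        \<in> multilinear_relations K Ms"
      unfolding multilinear_relations_def Let_def using xs i x c by blast
    with relations_null show ?thesis
      unfolding pure_tensor_def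
      by (subst coset_smult) (auto simp: coset_eq_iff s x c simp del: free_space_simps)
  qed
qed (use pure_closed in auto)

text \<open>Pulled back along the quotient map, g and h agree on every \<open>single\<close>, and
  these span the free space. This is the principle by which almost all identities between tensors
  below are proved: linearity of both sides, then comparison on pure tensors.\<close>

lemma tensor_eqI:
  assumes "module K P" "g \<in> lin_hom K T P" "h \<in> lin_hom K T P"
    and "\<And>xs. xs \<in> words Ms \<Longrightarrow> g (pure_tensor K Ms xs) = h (pure_tensor K Ms xs)"
    and "X \<in> carrier T"
  shows "g X = h X"
proof -
  let ?E = "{f \<in> carrier F. g (N\<^sub>0 +>\<^bsub>F\<^esub> f) = h (N\<^sub>0 +>\<^bsub>F\<^esub> f)}"
  have "submodule ?E K F"
    using F.module_axioms assms(1)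
    by (rule submodule_equalizer) (rule lin_hom_compose[OF coset_lin] assms)+
  then have "carrier F \<subseteq> ?E"
    by (rule free_space_spanned[OF cring_axioms])
      (use assms(4) single_closed in \<open>auto simp: pure_tensor_def\<close>)
  then show ?thesis using assms(5) by (auto simp: carrier_tensor_space)
qed

text \<open>The kernel of the linear extension is a submodule that contains the multilinearity
  relations, hence it contains \<open>N\<^sub>0\<close>, the smallest such submodule. This makes the
  lift well defined on cosets.\<close>

lemma lin_extend_null:
  assumes P: "module K P" and \<phi>: "multilinear K Ms P \<phi>" and f: "f \<in> N\<^sub>0"
  shows "lin_extend K P \<phi> f = \<zero>\<^bsub>P\<^esub>"
proof -
  interpret P: module K P by fact
  have \<phi>': "\<phi> \<in> words Ms \<rightarrow> carrier P" using \<phi> by (simp add: multilinear_def)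
  note ext = lin_extend_lin[OF P \<phi>'] lin_extend_single[OF P \<phi>']
  let ?H = "{f \<in> carrier F. lin_extend K P \<phi> f = \<zero>\<^bsub>P\<^esub>}"
  have "(\<lambda>_. \<zero>\<^bsub>P\<^esub>) \<in> lin_hom K F P" by (rule lin_homI) auto
  then have "submodule ?H K F"
    using F.module_axioms P ext(1) by (intro submodule_equalizer)
  moreover have "multilinear_relations K Ms \<subseteq> ?H"
  proof
    fix r assume r: "r \<in> multilinear_relations K Ms"
    then consider
      (add) xs i x y where "r = single K (xs[i := x \<oplus>\<^bsub>Ms ! i\<^esub> y]) \<ominus>\<^bsub>F\<^esub> (single K (xs[i := x]) \<oplus>\<^bsub>F\<^esub> single K (xs[i := y]))"
        "xs \<in> words Ms" "i < length Ms" "x \<in> carrier (Ms ! i)" "y \<in> carrier (Ms ! i)"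
      | (smult) xs i c x where "r = single K (xs[i := c \<odot>\<^bsub>Ms ! i\<^esub> x]) \<ominus>\<^bsub>F\<^esub> c \<odot>\<^bsub>F\<^esub> single K (xs[i := x])"
        "xs \<in> words Ms" "i < length Ms" "c \<in> carrier K" "x \<in> carrier (Ms ! i)"
      unfolding multilinear_relations_def Let_def by blast
    then have "lin_extend K P \<phi> r = \<zero>\<^bsub>P\<^esub>"
    proof cases
      case add
      interpret M: module K "Ms ! i" using add(3) by (rule factor_module)
      have l: "(\<lambda>x. \<phi> (xs[i := x])) \<in> lin_hom K (Ms ! i) P"
        using \<phi> add(2,3) by (simp add: multilinear_def)
      have w: "xs[i := z] \<in> words Ms" if "z \<in> carrier (Ms ! i)" for z
        using add(2) that by (rule words_update)
      note s = single_closed[OF w]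
      have "lin_extend K P \<phi> r = \<phi> (xs[i := x \<oplus>\<^bsub>Ms ! i\<^esub> y]) \<ominus>\<^bsub>P\<^esub> (\<phi> (xs[i := x]) \<oplus>\<^bsub>P\<^esub> \<phi> (xs[i := y]))"
        unfolding add(1) using add(4,5)
        by (simp add: lin_hom_minus[OF F.module_axioms P ext(1)] lin_hom_add[OF ext(1)] ext(2) s w
            del: free_space_simps)
      then show ?thesis
        using lin_hom_add[OF l add(4,5)] lin_hom_closed[OF l] add(4,5) by (simp add: P.M.r_neg a_minus_def)
    next
      case smult
      interpret M: module K "Ms ! i" using smult(3) by (rule factor_module)
      have l: "(\<lambda>x. \<phi> (xs[i := x])) \<in> lin_hom K (Ms ! i) P"
        using \<phi> smult(2,3) by (simp add: multilinear_def)
      have w: "xs[i := z] \<in> words Ms" if "z \<in> carrier (Ms ! i)" for z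
        using smult(2) that by (rule words_update)
      note s = single_closed[OF w]
      have "lin_extend K P \<phi> r = \<phi> (xs[i := c \<odot>\<^bsub>Ms ! i\<^esub> x]) \<ominus>\<^bsub>P\<^esub> c \<odot>\<^bsub>P\<^esub> \<phi> (xs[i := x])"
        unfolding smult(1) using smult(4,5)
        by (simp add: lin_hom_minus[OF F.module_axioms P ext(1)] lin_hom_smult[OF ext(1)] ext(2) s w
            del: free_space_simps)
      then show ?thesis
        using lin_hom_smult[OF l smult(4,5)] lin_hom_closed[OF l] smult(4,5) by (simp add: P.M.r_neg a_minus_def)
    qed
    then show "r \<in> ?H" using r multilinear_relations_subset by auto
  qed
  ultimately show ?thesis using f by (auto simp: tensor_null_def)
qed

lemma lift_coset:
  assumes P: "module K P" and \<phi>: "multilinear K Ms P \<phi>" and f: "f \<in> carrier F"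
  shows "tensor_lift K P \<phi> (N\<^sub>0 +>\<^bsub>F\<^esub> f) = lin_extend K P \<phi> f"
proof -
  interpret P: module K P by fact
  have ext: "lin_extend K P \<phi> \<in> lin_hom K F P"
    using lin_extend_lin[OF P, of \<phi> "words Ms"] \<phi> by (simp add: multilinear_def)
  have "lin_extend K P \<phi> g = lin_extend K P \<phi> f" if g: "g \<in> N\<^sub>0 +>\<^bsub>F\<^esub> f" for g
  proof -
    obtain n where n: "n \<in> N\<^sub>0" "g = n \<oplus>\<^bsub>F\<^esub> f" using g by (auto simp: a_r_coset_def' simp del: free_space_simps)
    then show ?thesis
      using lin_hom_add[OF ext, of n f] lin_extend_null[OF P \<phi> n(1)] lin_hom_closed[OF ext f]
        N.a_Hcarr f by (simp del: free_space_simps)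
  qed
  then have "lin_extend K P \<phi> ` (N\<^sub>0 +>\<^bsub>F\<^esub> f) = (\<lambda>_. lin_extend K P \<phi> f) ` (N\<^sub>0 +>\<^bsub>F\<^esub> f)"
    by (rule image_cong[OF refl])
  also have "\<dots> = {lin_extend K P \<phi> f}"
    by (rule image_constant[OF N.a_rcos_self[OF f]])
  finally show ?thesis by (simp add: tensor_lift_def)
qed

lemma lift_lin:
  assumes P: "module K P" and \<phi>: "multilinear K Ms P \<phi>"
  shows "tensor_lift K P \<phi> \<in> lin_hom K T P"
proof -
  have ext: "lin_extend K P \<phi> \<in> lin_hom K F P"
    using lin_extend_lin[OF P, of \<phi> "words Ms"] \<phi> by (simp add: multilinear_def)
  show ?thesis
    by (rule lin_homI)
      (auto simp: carrier_tensor_space coset_add coset_smult lift_coset[OF assms]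
        lin_hom_add[OF ext] lin_hom_smult[OF ext] lin_hom_closed[OF ext] simp del: free_space_simps)
qed

lemma lift_pure:
  assumes P: "module K P" and \<phi>: "multilinear K Ms P \<phi>" and xs: "xs \<in> words Ms"
  shows "tensor_lift K P \<phi> (pure_tensor K Ms xs) = \<phi> xs"
  using lift_coset[OF P \<phi> single_closed[OF xs]] lin_extend_single[OF P _ xs] \<phi>
  by (simp add: pure_tensor_def multilinear_def)

end

lemma multilinear_lin:
  "multilinear K Ms N \<phi> \<Longrightarrow> xs \<in> words Ms \<Longrightarrow> i < length Ms \<Longrightarrow>
    (\<lambda>x. \<phi> (xs[i := x])) \<in> lin_hom K (Ms ! i) N"
  by (simp add: multilinear_def)

definition bilinear ::
    "'k ring \<Rightarrow> ('k, 'a) module \<Rightarrow> ('k, 'b) module \<Rightarrow> ('k, 'c) module \<Rightarrow> ('a \<Rightarrow> 'b \<Rightarrow> 'c) \<Rightarrow> bool" where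
  "bilinear K M N P B \<longleftrightarrow> (\<forall>x\<in>carrier M. B x \<in> lin_hom K N P) \<and>
     (\<forall>y\<in>carrier N. (\<lambda>x. B x y) \<in> lin_hom K M P)"

section \<open>Bilinear maps obtained by nested lifting, tensor products of maps,
  concatenation\<close>

lemma
  assumes "tensor_factors K Ms" "tensor_factors K Ns" "module K P"
    and l: "\<And>ys. ys \<in> words Ns \<Longrightarrow> multilinear K Ms P (\<lambda>xs. \<Phi> xs ys)"
    and r: "\<And>xs. xs \<in> words Ms \<Longrightarrow> multilinear K Ns P (\<Phi> xs)"
  defines "B \<equiv> (\<lambda>X Y. tensor_lift K P (\<lambda>xs. tensor_lift K P (\<Phi> xs) Y) X)"
  shows bilift_bilinear: "bilinear K (tensor_space K Ms) (tensor_space K Ns) P B"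
    and bilift_pure: "\<And>xs ys. xs \<in> words Ms \<Longrightarrow> ys \<in> words Ns \<Longrightarrow>
      B (pure_tensor K Ms xs) (pure_tensor K Ns ys) = \<Phi> xs ys"
proof -
  interpret Ms: tensor_factors K Ms by fact
  interpret Ns: tensor_factors K Ns by fact
  interpret P: module K P by fact
  note P = P.module_axioms
  have lr: "tensor_lift K P (\<Phi> xs) \<in> lin_hom K Ns.T P" if "xs \<in> words Ms" for xs
    by (rule Ns.lift_lin[OF P r[OF that]])
  \<comment> \<open>The outer lift can be evaluated only if the inner one is multilinear in xs for
    every tensor Y, not just for pure ones. For fixed xs the inner lift is linear in Y, so each
    linearity clause is an equality of linear maps in Y and is tested on pure tensors.\<close>
  have m: "multilinear K Ms P (\<lambda>xs. tensor_lift K P (\<Phi> xs) Y)" if Y: "Y \<in> carrier Ns.T" for Y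
    unfolding multilinear_def
  proof (intro conjI ballI allI impI lin_homI)
    fix xs i assume xs: "xs \<in> words Ms" and i: "i < length Ms"
    interpret M: module K "Ms ! i" using i by (rule Ms.factor_module)
    have w: "xs[i := x] \<in> words Ms" if "x \<in> carrier (Ms ! i)" for x
      using xs that by (rule words_update)
    note lw = lr[OF w]
    have ll: "(\<lambda>x. \<Phi> (xs[i := x]) ys) \<in> lin_hom K (Ms ! i) P" if "ys \<in> words Ns" for ys
      using multilinear_lin[OF l[OF that] xs i] .
    show "tensor_lift K P (\<Phi> (xs[i := x])) Y \<in> carrier P" if "x \<in> carrier (Ms ! i)" for x
      using lin_hom_closed[OF lw[OF that] Y] .
    show "tensor_lift K P (\<Phi> (xs[i := x \<oplus>\<^bsub>Ms ! i\<^esub> y])) Y =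
        tensor_lift K P (\<Phi> (xs[i := x])) Y \<oplus>\<^bsub>P\<^esub> tensor_lift K P (\<Phi> (xs[i := y])) Y"
      if x: "x \<in> carrier (Ms ! i)" and y: "y \<in> carrier (Ms ! i)" for x y
      using P lw[OF M.M.a_closed[OF x y]] lin_hom_plus[OF P lw[OF x] lw[OF y]] _ Y
      by (rule Ns.tensor_eqI)
        (simp add: Ns.lift_pure[OF P] r w x y lin_hom_add[OF ll])
    show "tensor_lift K P (\<Phi> (xs[i := c \<odot>\<^bsub>Ms ! i\<^esub> x])) Y = c \<odot>\<^bsub>P\<^esub> tensor_lift K P (\<Phi> (xs[i := x])) Y"
      if c: "c \<in> carrier K" and x: "x \<in> carrier (Ms ! i)" for c x
      using P lw[OF M.smult_closed[OF c x]] lin_hom_scale[OF P lw[OF x] c] _ Y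
      by (rule Ns.tensor_eqI)
        (simp add: Ns.lift_pure[OF P] r w x c lin_hom_smult[OF ll])
  qed (use lin_hom_closed[OF lr Y] in auto)
  have Bl: "(\<lambda>X. B X Y) \<in> lin_hom K Ms.T P" if "Y \<in> carrier Ns.T" for Y
    unfolding B_def by (rule Ms.lift_lin[OF P m[OF that]])
  have Bp: "B (pure_tensor K Ms xs) Y = tensor_lift K P (\<Phi> xs) Y"
    if "xs \<in> words Ms" "Y \<in> carrier Ns.T" for xs Y
    unfolding B_def by (rule Ms.lift_pure[OF P m[OF that(2)] that(1)])
  show "B (pure_tensor K Ms xs) (pure_tensor K Ns ys) = \<Phi> xs ys"
    if "xs \<in> words Ms" "ys \<in> words Ns" for xs ys
    using that by (simp add: Bp Ns.pure_closed Ns.lift_pure[OF P r])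
  \<comment> \<open>Linearity in Y is shown with the roles exchanged: for fixed Y both sides are
    linear in X, and on a pure X the map reduces to the inner lift.\<close>
  have "B X \<in> lin_hom K Ns.T P" if X: "X \<in> carrier Ms.T" for X
  proof (rule lin_homI)
    show "B X Y \<in> carrier P" if "Y \<in> carrier Ns.T" for Y
      using lin_hom_closed[OF Bl[OF that] X] .
    show "B X (Y \<oplus>\<^bsub>Ns.T\<^esub> Z) = B X Y \<oplus>\<^bsub>P\<^esub> B X Z" if Y: "Y \<in> carrier Ns.T" and Z: "Z \<in> carrier Ns.T" for Y Z
      using P Bl[OF Ns.T.M.a_closed[OF Y Z]] lin_hom_plus[OF P Bl[OF Y] Bl[OF Z]] _ X
      by (rule Ms.tensor_eqI) (simp add: Bp Y Z lin_hom_add[OF lr])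
    show "B X (c \<odot>\<^bsub>Ns.T\<^esub> Y) = c \<odot>\<^bsub>P\<^esub> B X Y" if c: "c \<in> carrier K" and Y: "Y \<in> carrier Ns.T" for c Y
      using P Bl[OF Ns.T.smult_closed[OF c Y]] lin_hom_scale[OF P Bl[OF Y] c] _ X
      by (rule Ms.tensor_eqI) (simp add: Bp Y c lin_hom_smult[OF lr])
  qed
  with Bl show "bilinear K Ms.T Ns.T P B" by (simp add: bilinear_def)
qed

lemma
  assumes "bilinear K M N P B"
  shows bilinear_left: "y \<in> carrier N \<Longrightarrow> (\<lambda>x. B x y) \<in> lin_hom K M P"
    and bilinear_right: "x \<in> carrier M \<Longrightarrow> B x \<in> lin_hom K N P"
  using assms by (auto simp: bilinear_def)

lemma bilinear_closed:
  "bilinear K M N P B \<Longrightarrow> x \<in> carrier M \<Longrightarrow> y \<in> carrier N \<Longrightarrow> B x y \<in> carrier P"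
  using lin_hom_closed[OF bilinear_right] .

text \<open>The module axioms see only carrier, addition, zero and scalar action. This carries the
  module structure of \<open>tensor_space\<close> over to \<open>tensor_algebra\<close>, and that of
  an algebra over to its opposite.\<close>

lemma module_update [simp]: "module K (M\<lparr>mult := m, one := e\<rparr>) \<longleftrightarrow> module K M"
  "module K (M\<lparr>mult := m\<rparr>) \<longleftrightarrow> module K M"
  by (simp_all add: module_def abelian_group_def abelian_monoid_def abelian_group_axioms_def module_axioms_def)

lemma
  assumes Ms: "tensor_factors K Ms" and Ns: "tensor_factors K Ns"
    and len: "length fs = length Ms" "length Ns = length Ms"
    and fs: "\<And>i. i < length Ms \<Longrightarrow> fs ! i \<in> lin_hom K (Ms ! i) (Ns ! i)"
  shows tensor_map_lin: "tensor_map K Ns fs \<in> lin_hom K (tensor_space K Ms) (tensor_space K Ns)"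
    and tensor_map_pure: "\<And>xs. xs \<in> words Ms \<Longrightarrow> tensor_map K Ns fs (pure_tensor K Ms xs) =
      pure_tensor K Ns (map2 (\<lambda>f x. f x) fs xs)"
proof -
  interpret Ms: tensor_factors K Ms by fact
  interpret Ns: tensor_factors K Ns by fact
  have w: "map2 (\<lambda>f x. f x) fs xs \<in> words Ns" if "xs \<in> words Ms" for xs
    using that len lin_hom_closed[OF fs] by (auto simp: in_words_iff)
  have m: "multilinear K Ms Ns.T (\<lambda>xs. pure_tensor K Ns (map2 (\<lambda>f x. f x) fs xs))"
    unfolding multilinear_def
  proof (intro conjI ballI allI impI)
    fix xs i assume xs: "xs \<in> words Ms" and i: "i < length Ms"
    have "map2 (\<lambda>f x. f x) fs (xs[i := x]) = (map2 (\<lambda>f x. f x) fs xs)[i := (fs ! i) x]" for x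
      using len i length_words[OF xs] by (intro nth_equalityI) (auto simp: nth_list_update)
    then show "(\<lambda>x. pure_tensor K Ns (map2 (\<lambda>f x. f x) fs (xs[i := x]))) \<in> lin_hom K (Ms ! i) Ns.T"
      using lin_hom_compose[OF fs[OF i] multilinear_lin[OF Ns.multilinear_pure w[OF xs], of i]] i len
      by simp
  qed (use w Ns.pure_closed in auto)
  show "tensor_map K Ns fs \<in> lin_hom K Ms.T Ns.T"
    unfolding tensor_map_def by (rule Ms.lift_lin[OF Ns.T.module_axioms m])
  show "tensor_map K Ns fs (pure_tensor K Ms xs) = pure_tensor K Ns (map2 (\<lambda>f x. f x) fs xs)"
    if "xs \<in> words Ms" for xs
    unfolding tensor_map_def by (rule Ms.lift_pure[OF Ns.T.module_axioms m that])
qed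

lemma tensor_factors_append:
  assumes "tensor_factors K Ms" "tensor_factors K Ns"
  shows "tensor_factors K (Ms @ Ns)"
  using assms by (auto simp: tensor_factors_def tensor_factors_axioms_def nth_append)

lemma
  assumes Ms: "tensor_factors K Ms" and Ns: "tensor_factors K Ns"
  shows tensor_append_bilinear: "bilinear K (tensor_space K Ms) (tensor_space K Ns)
      (tensor_space K (Ms @ Ns)) (tensor_append K (Ms @ Ns))"
    and tensor_append_pure: "\<And>xs ys. xs \<in> words Ms \<Longrightarrow> ys \<in> words Ns \<Longrightarrow>
      tensor_append K (Ms @ Ns) (pure_tensor K Ms xs) (pure_tensor K Ns ys) =
      pure_tensor K (Ms @ Ns) (xs @ ys)"
proof -
  interpret A: tensor_factors K "Ms @ Ns" by (rule tensor_factors_append[OF assms])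
  have l: "multilinear K Ms A.T (\<lambda>xs. pure_tensor K (Ms @ Ns) (xs @ ys))" if ys: "ys \<in> words Ns" for ys
    unfolding multilinear_def
  proof (intro conjI ballI allI impI)
    fix xs i assume xs: "xs \<in> words Ms" and i: "i < length Ms"
    show "(\<lambda>x. pure_tensor K (Ms @ Ns) (xs[i := x] @ ys)) \<in> lin_hom K (Ms ! i) A.T"
      using multilinear_lin[OF A.multilinear_pure words_append[OF xs ys], of i] i length_words[OF xs]
      by (simp add: list_update_append1 nth_append)
  qed (use words_append ys A.pure_closed in blast)
  have r: "multilinear K Ns A.T (\<lambda>ys. pure_tensor K (Ms @ Ns) (xs @ ys))" if xs: "xs \<in> words Ms" for xs
    unfolding multilinear_def
  proof (intro conjI ballI allI impI)
    fix ys i assume ys: "ys \<in> words Ns" and i: "i < length Ns"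
    show "(\<lambda>x. pure_tensor K (Ms @ Ns) (xs @ ys[i := x])) \<in> lin_hom K (Ns ! i) A.T"
      using multilinear_lin[OF A.multilinear_pure words_append[OF xs ys], of "length xs + i"] i
        length_words[OF xs]
      by (simp add: list_update_append nth_append)
  qed (use words_append xs A.pure_closed in blast)
  show "bilinear K (tensor_space K Ms) (tensor_space K Ns) A.T (tensor_append K (Ms @ Ns))"
    using bilift_bilinear[OF assms A.T.module_axioms l r] by (simp add: tensor_append_def[abs_def])
  show "tensor_append K (Ms @ Ns) (pure_tensor K Ms xs) (pure_tensor K Ns ys) =
      pure_tensor K (Ms @ Ns) (xs @ ys)" if "xs \<in> words Ms" "ys \<in> words Ns" for xs ys
    using bilift_pure[OF assms A.T.module_axioms l r that] by (simp add: tensor_append_def)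
qed

text \<open>Naturality of concatenation, checked on pure tensors in each argument. It later lets
  five maps applied slotwise be split into a triple and a pair.\<close>

lemma tensor_map_append:
  assumes Ms: "tensor_factors K Ms" "tensor_factors K Ms'"
    and Ns: "tensor_factors K Ns" "tensor_factors K Ns'"
    and len: "length fs = length Ms" "length Ns = length Ms" "length gs = length Ms'" "length Ns' = length Ms'"
    and fs: "\<And>i. i < length Ms \<Longrightarrow> fs ! i \<in> lin_hom K (Ms ! i) (Ns ! i)"
    and gs: "\<And>i. i < length Ms' \<Longrightarrow> gs ! i \<in> lin_hom K (Ms' ! i) (Ns' ! i)"
    and X: "X \<in> carrier (tensor_space K Ms)" and Y: "Y \<in> carrier (tensor_space K Ms')"
  shows "tensor_map K (Ns @ Ns') (fs @ gs) (tensor_append K (Ms @ Ms') X Y) =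
    tensor_append K (Ns @ Ns') (tensor_map K Ns fs X) (tensor_map K Ns' gs Y)"
proof -
  interpret Ms: tensor_factors K Ms by fact
  interpret Ms': tensor_factors K Ms' by fact
  have N: "tensor_factors K (Ns @ Ns')" by (rule tensor_factors_append[OF Ns])
  interpret N: tensor_factors K "Ns @ Ns'" by (rule N)
  have M: "tensor_factors K (Ms @ Ms')" by (rule tensor_factors_append[OF Ms])
  have fg: "(fs @ gs) ! i \<in> lin_hom K ((Ms @ Ms') ! i) ((Ns @ Ns') ! i)" if "i < length (Ms @ Ms')" for i
    using that fs gs len by (auto simp: nth_append)
  have len': "length (fs @ gs) = length (Ms @ Ms')" "length (Ns @ Ns') = length (Ms @ Ms')"
    using len by auto
  note lf = tensor_map_lin[OF Ms(1) Ns(1) len(1,2) fs] and pf = tensor_map_pure[OF Ms(1) Ns(1) len(1,2) fs]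
  note lg = tensor_map_lin[OF Ms(2) Ns(2) len(3,4) gs] and pg = tensor_map_pure[OF Ms(2) Ns(2) len(3,4) gs]
  note lfg = tensor_map_lin[OF M N len' fg] and pfg = tensor_map_pure[OF M N len' fg]
  have wf: "map2 (\<lambda>f x. f x) fs xs \<in> words Ns" if "xs \<in> words Ms" for xs
    using that len lin_hom_closed[OF fs] by (auto simp: in_words_iff)
  have wg: "map2 (\<lambda>f x. f x) gs xs \<in> words Ns'" if "xs \<in> words Ms'" for xs
    using that len lin_hom_closed[OF gs] by (auto simp: in_words_iff)
  note bM = tensor_append_bilinear[OF Ms] and bN = tensor_append_bilinear[OF Ns]
  show ?thesis
    using N.T.module_axioms
      lin_hom_compose[OF bilinear_left[OF bM Y] lfg]
      lin_hom_compose[OF lf bilinear_left[OF bN lin_hom_closed[OF lg Y]]] _ X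
  proof (rule Ms.tensor_eqI)
    fix xs assume xs: "xs \<in> words Ms"
    note X = Ms.pure_closed[OF xs]
    show "tensor_map K (Ns @ Ns') (fs @ gs) (tensor_append K (Ms @ Ms') (pure_tensor K Ms xs) Y) =
      tensor_append K (Ns @ Ns') (tensor_map K Ns fs (pure_tensor K Ms xs)) (tensor_map K Ns' gs Y)"
      using N.T.module_axioms
        lin_hom_compose[OF bilinear_right[OF bM X] lfg]
        lin_hom_compose[OF lg bilinear_right[OF bN lin_hom_closed[OF lf X]]] _ Y
    proof (rule Ms'.tensor_eqI)
      fix ys assume ys: "ys \<in> words Ms'"
      have "map2 (\<lambda>f x. f x) (fs @ gs) (xs @ ys) = map2 (\<lambda>f x. f x) fs xs @ map2 (\<lambda>f x. f x) gs ys"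
        using len length_words[OF xs] by simp
      then show "tensor_map K (Ns @ Ns') (fs @ gs) (tensor_append K (Ms @ Ms') (pure_tensor K Ms xs) (pure_tensor K Ms' ys)) =
        tensor_append K (Ns @ Ns') (tensor_map K Ns fs (pure_tensor K Ms xs)) (tensor_map K Ns' gs (pure_tensor K Ms' ys))"
        using tensor_append_pure[OF Ms xs ys] tensor_append_pure[OF Ns wf[OF xs] wg[OF ys]]
          pf[OF _ xs] pg[OF _ ys] pfg[OF _ words_append[OF xs ys]] by simp
    qed
  qed
qed


section \<open>Tensor products of algebras\<close>

lemma op_alg_simps [simp]:
  "carrier (op_alg B) = carrier B" "\<one>\<^bsub>op_alg B\<^esub> = \<one>\<^bsub>B\<^esub>" "\<zero>\<^bsub>op_alg B\<^esub> = \<zero>\<^bsub>B\<^esub>"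
  "x \<oplus>\<^bsub>op_alg B\<^esub> y = x \<oplus>\<^bsub>B\<^esub> y" "c \<odot>\<^bsub>op_alg B\<^esub> x = c \<odot>\<^bsub>B\<^esub> x"
  "mult (op_alg B) = (\<lambda>x y. y \<otimes>\<^bsub>B\<^esub> x)"
  by (simp_all add: op_alg_def)

lemma lin_hom_op [simp]:
  "lin_hom K (op_alg B) N = lin_hom K B N" "lin_hom K M (op_alg B) = lin_hom K M B"
  by (simp_all add: lin_hom_def)

lemma tensor_algebra_simps [simp]:
  "carrier (tensor_algebra K Bs) = carrier (tensor_space K Bs)"
  "\<zero>\<^bsub>tensor_algebra K Bs\<^esub> = \<zero>\<^bsub>tensor_space K Bs\<^esub>"
  "X \<oplus>\<^bsub>tensor_algebra K Bs\<^esub> Y = X \<oplus>\<^bsub>tensor_space K Bs\<^esub> Y"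
  "c \<odot>\<^bsub>tensor_algebra K Bs\<^esub> X = c \<odot>\<^bsub>tensor_space K Bs\<^esub> X"
  "\<one>\<^bsub>tensor_algebra K Bs\<^esub> = pure_tensor K Bs (map one Bs)"
  "lin_hom K (tensor_algebra K Bs) N = lin_hom K (tensor_space K Bs) N"
  "lin_hom K M (tensor_algebra K Bs) = lin_hom K M (tensor_space K Bs)"
  by (simp_all add: tensor_algebra_def lin_hom_def)

text \<open>Distributivity and compatibility with scalars are bundled as bilinearity of the product,
  which is the form in which the nested lift provides them.\<close>

lemma k_algebraI:
  assumes "field K" "module K B" "\<one>\<^bsub>B\<^esub> \<in> carrier B" "bilinear K B B B (mult B)"
    and "\<And>x. x \<in> carrier B \<Longrightarrow> \<one>\<^bsub>B\<^esub> \<otimes>\<^bsub>B\<^esub> x = x" "\<And>x. x \<in> carrier B \<Longrightarrow> x \<otimes>\<^bsub>B\<^esub> \<one>\<^bsub>B\<^esub> = x"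
    and "\<And>x y z. x \<in> carrier B \<Longrightarrow> y \<in> carrier B \<Longrightarrow> z \<in> carrier B \<Longrightarrow>
      (x \<otimes>\<^bsub>B\<^esub> y) \<otimes>\<^bsub>B\<^esub> z = x \<otimes>\<^bsub>B\<^esub> (y \<otimes>\<^bsub>B\<^esub> z)"
  shows "k_algebra K B"
proof -
  interpret B: module K B by fact
  have "ring B"
    by (rule ringI)
      (auto intro!: monoidI B.M.abelian_group_axioms assms bilinear_closed[OF assms(4)]
        lin_hom_add[OF bilinear_left[OF assms(4)]] lin_hom_add[OF bilinear_right[OF assms(4)]])
  then show ?thesis
    using assms(1,2) lin_hom_smult[OF bilinear_left[OF assms(4)]] lin_hom_smult[OF bilinear_right[OF assms(4)]]
    by (simp add: k_algebra_def)
qed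

lemma
  assumes "k_algebra K B"
  shows k_algebra_field: "field K" and k_algebra_ring: "ring B" and k_algebra_module: "module K B"
  using assms by (simp_all add: k_algebra_def)

lemma k_algebra_mult_bilinear:
  assumes "k_algebra K B"
  shows "bilinear K B B B (mult B)"
proof -
  interpret B: ring B using assms by (rule k_algebra_ring)
  show ?thesis using assms
    by (auto simp: bilinear_def k_algebra_def B.l_distr B.r_distr intro!: lin_homI)
qed

lemma k_algebra_op:
  assumes "k_algebra K B"
  shows "k_algebra K (op_alg B)"
proof -
  interpret B: ring B using assms by (rule k_algebra_ring)
  have "bilinear K (op_alg B) (op_alg B) (op_alg B) (mult (op_alg B))"
    using k_algebra_mult_bilinear[OF assms] by (simp add: bilinear_def)
  moreover have "module K (op_alg B)"
    using k_algebra_module[OF assms] by (simp add: op_alg_def)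
  ultimately show ?thesis
    using k_algebra_field[OF assms] by (intro k_algebraI) (auto simp: B.m_assoc)
qed

text \<open>The slotwise product hidden inside \<open>tensor_mult\<close>, named so that
  associativity and unit laws can be settled on words first.\<close>

definition word_mult :: "('k, 'a) module list \<Rightarrow> 'a list \<Rightarrow> 'a list \<Rightarrow> 'a list" where
  "word_mult Bs xs ys = map2 (\<lambda>B (x, y). x \<otimes>\<^bsub>B\<^esub> y) Bs (zip xs ys)"

locale algebra_factors = field K for K :: "'k ring" and Bs :: "('k, 'a) module list" +
  assumes factor_algebra: "i < length Bs \<Longrightarrow> k_algebra K (Bs ! i)"
begin

sublocale tensor_factors K Bs
  by (intro tensor_factors.intro tensor_factors_axioms.intro field_axioms k_algebra_module factor_algebra)

abbreviation "TA \<equiv> tensor_algebra K Bs"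

lemma word_mult_nth:
  assumes "xs \<in> words Bs" "ys \<in> words Bs" "i < length Bs"
  shows "word_mult Bs xs ys ! i = xs ! i \<otimes>\<^bsub>Bs ! i\<^esub> ys ! i"
  using assms by (simp add: word_mult_def in_words_iff)

lemma word_mult_closed:
  assumes "xs \<in> words Bs" "ys \<in> words Bs"
  shows "word_mult Bs xs ys \<in> words Bs"
  using assms bilinear_closed[OF k_algebra_mult_bilinear[OF factor_algebra]]
  by (simp add: word_mult_nth in_words_iff[of "word_mult Bs xs ys"]) (simp add: word_mult_def in_words_iff)

lemma word_mult_assoc:
  assumes xs: "xs \<in> words Bs" "ys \<in> words Bs" "zs \<in> words Bs"
  shows "word_mult Bs (word_mult Bs xs ys) zs = word_mult Bs xs (word_mult Bs ys zs)"
proof (rule nth_equalityI)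
  fix i assume "i < length (word_mult Bs (word_mult Bs xs ys) zs)"
  then have i: "i < length Bs" using length_words[OF word_mult_closed] word_mult_closed assms by metis
  interpret B: ring "Bs ! i" by (rule k_algebra_ring[OF factor_algebra[OF i]])
  show "word_mult Bs (word_mult Bs xs ys) zs ! i = word_mult Bs xs (word_mult Bs ys zs) ! i"
    using assms i by (simp add: word_mult_nth word_mult_closed) (simp add: in_words_iff B.m_assoc)
qed (use assms word_mult_closed length_words in metis)

lemma ones_closed: "map one Bs \<in> words Bs"
  using k_algebra_ring[OF factor_algebra] ring.ring_simprules(6) by (auto simp: in_words_iff)

lemma word_mult_ones:
  assumes xs: "xs \<in> words Bs"
  shows "word_mult Bs (map one Bs) xs = xs" "word_mult Bs xs (map one Bs) = xs"
proof -
  have "word_mult Bs (map one Bs) xs ! i = xs ! i \<and> word_mult Bs xs (map one Bs) ! i = xs ! i"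
    if i: "i < length Bs" for i
  proof -
    interpret B: ring "Bs ! i" by (rule k_algebra_ring[OF factor_algebra[OF i]])
    have "xs ! i \<in> carrier (Bs ! i)" using xs i by (simp add: in_words_iff)
    then show ?thesis using xs i ones_closed by (simp add: word_mult_nth)
  qed
  then show "word_mult Bs (map one Bs) xs = xs" "word_mult Bs xs (map one Bs) = xs"
    using length_words[OF word_mult_closed] xs ones_closed length_words[OF xs]
    by (auto intro!: nth_equalityI)
qed

lemma
  shows tensor_mult_bilinear: "bilinear K T T T (tensor_mult K Bs)"
    and tensor_mult_pure: "\<And>xs ys. xs \<in> words Bs \<Longrightarrow> ys \<in> words Bs \<Longrightarrow>
      tensor_mult K Bs (pure_tensor K Bs xs) (pure_tensor K Bs ys) = pure_tensor K Bs (word_mult Bs xs ys)"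
proof -
  have l: "multilinear K Bs T (\<lambda>xs. pure_tensor K Bs (word_mult Bs xs ys))" if ys: "ys \<in> words Bs" for ys
    unfolding multilinear_def
  proof (intro conjI ballI allI impI)
    fix xs i assume xs: "xs \<in> words Bs" and i: "i < length Bs"
    have "word_mult Bs (xs[i := x]) ys = (word_mult Bs xs ys)[i := x \<otimes>\<^bsub>Bs ! i\<^esub> ys ! i]" for x
      unfolding word_mult_def
      using length_words[OF xs] length_words[OF ys] i by (intro nth_equalityI) (auto simp: nth_list_update)
    moreover have "(\<lambda>x. x \<otimes>\<^bsub>Bs ! i\<^esub> ys ! i) \<in> lin_hom K (Bs ! i) (Bs ! i)"
      using bilinear_left[OF k_algebra_mult_bilinear[OF factor_algebra[OF i]]] ys i
      by (simp add: in_words_iff)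
    ultimately show "(\<lambda>x. pure_tensor K Bs (word_mult Bs (xs[i := x]) ys)) \<in> lin_hom K (Bs ! i) T"
      using lin_hom_compose[OF _ multilinear_lin[OF multilinear_pure word_mult_closed[OF xs ys] i]] by simp
  qed (use word_mult_closed ys pure_closed in blast)
  have r: "multilinear K Bs T (\<lambda>ys. pure_tensor K Bs (word_mult Bs xs ys))" if xs: "xs \<in> words Bs" for xs
    unfolding multilinear_def
  proof (intro conjI ballI allI impI)
    fix ys i assume ys: "ys \<in> words Bs" and i: "i < length Bs"
    have "word_mult Bs xs (ys[i := y]) = (word_mult Bs xs ys)[i := xs ! i \<otimes>\<^bsub>Bs ! i\<^esub> y]" for y
      unfolding word_mult_def
      using length_words[OF xs] length_words[OF ys] i by (intro nth_equalityI) (auto simp: nth_list_update)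
    moreover have "(\<lambda>y. xs ! i \<otimes>\<^bsub>Bs ! i\<^esub> y) \<in> lin_hom K (Bs ! i) (Bs ! i)"
      using bilinear_right[OF k_algebra_mult_bilinear[OF factor_algebra[OF i]]] xs i
      by (simp add: in_words_iff)
    ultimately show "(\<lambda>y. pure_tensor K Bs (word_mult Bs xs (ys[i := y]))) \<in> lin_hom K (Bs ! i) T"
      using lin_hom_compose[OF _ multilinear_lin[OF multilinear_pure word_mult_closed[OF xs ys] i]] by simp
  qed (use word_mult_closed xs pure_closed in blast)
  note tf = tensor_factors_axioms
  show "bilinear K T T T (tensor_mult K Bs)"
    using bilift_bilinear[OF tf tf T.module_axioms l r] by (simp add: tensor_mult_def[abs_def] word_mult_def)
  show "tensor_mult K Bs (pure_tensor K Bs xs) (pure_tensor K Bs ys) = pure_tensor K Bs (word_mult Bs xs ys)"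
    if "xs \<in> words Bs" "ys \<in> words Bs" for xs ys
    using bilift_pure[OF tf tf T.module_axioms l r that] by (simp add: tensor_mult_def word_mult_def)
qed

lemma tensor_algebra_mult: "mult TA = tensor_mult K Bs"
  by (simp add: tensor_algebra_def)

lemma mult_pure:
  "xs \<in> words Bs \<Longrightarrow> ys \<in> words Bs \<Longrightarrow>
    pure_tensor K Bs xs \<otimes>\<^bsub>TA\<^esub> pure_tensor K Bs ys = pure_tensor K Bs (word_mult Bs xs ys)"
  by (simp add: tensor_algebra_mult tensor_mult_pure)

lemma mult_bilinear: "bilinear K T T T (mult TA)"
  using tensor_mult_bilinear by (simp add: tensor_algebra_mult)

lemma tensor_algebra: "k_algebra K TA"
proof (rule k_algebraI)
  note b = mult_bilinear
  note bl = bilinear_left[OF b] and br = bilinear_right[OF b] and bc = bilinear_closed[OF b]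
  show "field K" by (rule field_axioms)
  show "module K TA" by (simp add: tensor_algebra_def T.module_axioms)
  show "bilinear K TA TA TA (mult TA)" using b by (simp add: bilinear_def)
  show "\<one>\<^bsub>TA\<^esub> \<in> carrier TA" by (simp add: pure_closed ones_closed)
  fix X assume "X \<in> carrier TA"
  then have X: "X \<in> carrier T" by simp
  show "\<one>\<^bsub>TA\<^esub> \<otimes>\<^bsub>TA\<^esub> X = X"
    using T.module_axioms br[OF pure_closed[OF ones_closed]] lin_hom_ident _ X
    unfolding tensor_algebra_simps by (rule tensor_eqI) (simp add: mult_pure ones_closed word_mult_ones)
  show "X \<otimes>\<^bsub>TA\<^esub> \<one>\<^bsub>TA\<^esub> = X"
    using T.module_axioms bl[OF pure_closed[OF ones_closed]] lin_hom_ident _ X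
    unfolding tensor_algebra_simps by (rule tensor_eqI) (simp add: mult_pure ones_closed word_mult_ones)
  fix Y Z assume "Y \<in> carrier TA" "Z \<in> carrier TA"
  then have Y: "Y \<in> carrier T" and Z: "Z \<in> carrier T" by simp_all
  \<comment> \<open>Both sides are trilinear; X, Y and Z are replaced by pure tensors one after the
    other, until \<open>word_mult_assoc\<close> applies.\<close>
  show "X \<otimes>\<^bsub>TA\<^esub> Y \<otimes>\<^bsub>TA\<^esub> Z = X \<otimes>\<^bsub>TA\<^esub> (Y \<otimes>\<^bsub>TA\<^esub> Z)"
    using T.module_axioms lin_hom_compose[OF bl[OF Y] bl[OF Z]] bl[OF bc[OF Y Z]] _ X
  proof (rule tensor_eqI)
    fix xs assume xs: "xs \<in> words Bs"
    note px = pure_closed[OF xs]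
    show "pure_tensor K Bs xs \<otimes>\<^bsub>TA\<^esub> Y \<otimes>\<^bsub>TA\<^esub> Z = pure_tensor K Bs xs \<otimes>\<^bsub>TA\<^esub> (Y \<otimes>\<^bsub>TA\<^esub> Z)"
      using T.module_axioms lin_hom_compose[OF br[OF px] bl[OF Z]] lin_hom_compose[OF bl[OF Z] br[OF px]] _ Y
    proof (rule tensor_eqI)
      fix ys assume ys: "ys \<in> words Bs"
      note py = pure_closed[OF ys]
      show "pure_tensor K Bs xs \<otimes>\<^bsub>TA\<^esub> pure_tensor K Bs ys \<otimes>\<^bsub>TA\<^esub> Z =
          pure_tensor K Bs xs \<otimes>\<^bsub>TA\<^esub> (pure_tensor K Bs ys \<otimes>\<^bsub>TA\<^esub> Z)"
        using T.module_axioms br[OF bc[OF px py]] lin_hom_compose[OF br[OF py] br[OF px]] _ Z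
        by (rule tensor_eqI) (simp add: mult_pure word_mult_closed word_mult_assoc xs ys)
    qed
  qed
qed

end

lemma alg_homI:
  assumes "h \<in> lin_hom K B C" "h \<one>\<^bsub>B\<^esub> = \<one>\<^bsub>C\<^esub>"
    and "\<And>x y. x \<in> carrier B \<Longrightarrow> y \<in> carrier B \<Longrightarrow> h (x \<otimes>\<^bsub>B\<^esub> y) = h x \<otimes>\<^bsub>C\<^esub> h y"
  shows "h \<in> alg_hom K B C"
  using assms by (auto simp: alg_hom_def ring_hom_def lin_hom_def)

lemma
  assumes "h \<in> alg_hom K B C"
  shows alg_hom_lin: "h \<in> lin_hom K B C" and alg_hom_one: "h \<one>\<^bsub>B\<^esub> = \<one>\<^bsub>C\<^esub>"
    and alg_hom_mult: "x \<in> carrier B \<Longrightarrow> y \<in> carrier B \<Longrightarrow> h (x \<otimes>\<^bsub>B\<^esub> y) = h x \<otimes>\<^bsub>C\<^esub> h y"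
  using assms by (auto simp: alg_hom_def ring_hom_def)

text \<open>Both h(XY) and h(X)h(Y) are bilinear in X and Y, so multiplicativity may be tested on
  words.\<close>

lemma tensor_alg_homI:
  assumes "algebra_factors K Bs" "k_algebra K C" "h \<in> lin_hom K (tensor_space K Bs) C"
    and one: "h (pure_tensor K Bs (map one Bs)) = \<one>\<^bsub>C\<^esub>"
    and mult: "\<And>xs ys. xs \<in> words Bs \<Longrightarrow> ys \<in> words Bs \<Longrightarrow>
      h (pure_tensor K Bs (word_mult Bs xs ys)) = h (pure_tensor K Bs xs) \<otimes>\<^bsub>C\<^esub> h (pure_tensor K Bs ys)"
  shows "h \<in> alg_hom K (tensor_algebra K Bs) C"
proof (rule alg_homI)
  interpret Bs: algebra_factors K Bs by fact
  note C = k_algebra_module[OF assms(2)] and bC = k_algebra_mult_bilinear[OF assms(2)] and h = assms(3)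
  fix X Y assume "X \<in> carrier (tensor_algebra K Bs)" "Y \<in> carrier (tensor_algebra K Bs)"
  then have X: "X \<in> carrier Bs.T" and Y: "Y \<in> carrier Bs.T" by simp_all
  show "h (X \<otimes>\<^bsub>Bs.TA\<^esub> Y) = h X \<otimes>\<^bsub>C\<^esub> h Y"
    using C lin_hom_compose[OF bilinear_left[OF Bs.mult_bilinear Y] h]
      lin_hom_compose[OF h bilinear_left[OF bC lin_hom_closed[OF h Y]]] _ X
  proof (rule Bs.tensor_eqI)
    fix xs assume xs: "xs \<in> words Bs"
    note px = Bs.pure_closed[OF xs]
    show "h (pure_tensor K Bs xs \<otimes>\<^bsub>Bs.TA\<^esub> Y) = h (pure_tensor K Bs xs) \<otimes>\<^bsub>C\<^esub> h Y"
      using C lin_hom_compose[OF bilinear_right[OF Bs.mult_bilinear px] h]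
        lin_hom_compose[OF h bilinear_right[OF bC lin_hom_closed[OF h px]]] _ Y
      by (rule Bs.tensor_eqI) (simp add: Bs.mult_pure xs mult)
  qed
qed (use assms in simp_all)

lemma tensor_map_alg_hom:
  assumes "algebra_factors K As" "algebra_factors K Bs"
    and len: "length fs = length As" "length Bs = length As"
    and fs: "\<And>i. i < length As \<Longrightarrow> fs ! i \<in> alg_hom K (As ! i) (Bs ! i)"
  shows "tensor_map K Bs fs \<in> alg_hom K (tensor_algebra K As) (tensor_algebra K Bs)"
proof -
  interpret As: algebra_factors K As by fact
  interpret Bs: algebra_factors K Bs by fact
  note tf = As.tensor_factors_axioms Bs.tensor_factors_axioms
  note lin = tensor_map_lin[OF tf len alg_hom_lin[OF fs]]
  note pure = tensor_map_pure[OF tf len alg_hom_lin[OF fs]]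
  have w: "map2 (\<lambda>f x. f x) fs xs \<in> words Bs" if "xs \<in> words As" for xs
    using that len lin_hom_closed[OF alg_hom_lin[OF fs]] by (auto simp: in_words_iff)
  show ?thesis
  proof (rule tensor_alg_homI[OF assms(1) Bs.tensor_algebra])
    show "tensor_map K Bs fs \<in> lin_hom K As.T Bs.TA" using lin by simp
    have "map2 (\<lambda>f x. f x) fs (map one As) = map one Bs"
      using len alg_hom_one[OF fs] by (intro nth_equalityI) auto
    then show "tensor_map K Bs fs (pure_tensor K As (map one As)) = \<one>\<^bsub>Bs.TA\<^esub>"
      by (simp add: pure As.ones_closed)
    fix xs ys assume xs: "xs \<in> words As" and ys: "ys \<in> words As"
    have "map2 (\<lambda>f x. f x) fs (word_mult As xs ys) =
        word_mult Bs (map2 (\<lambda>f x. f x) fs xs) (map2 (\<lambda>f x. f x) fs ys)"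
      using len xs ys alg_hom_mult[OF fs]
      by (intro nth_equalityI) (auto simp: word_mult_def in_words_iff)
    then show "tensor_map K Bs fs (pure_tensor K As (word_mult As xs ys)) =
        tensor_map K Bs fs (pure_tensor K As xs) \<otimes>\<^bsub>Bs.TA\<^esub> tensor_map K Bs fs (pure_tensor K As ys)"
      by (simp add: pure xs ys As.word_mult_closed Bs.mult_pure w)
  qed
qed

lemma algebra_factors_append:
  assumes "algebra_factors K As" "algebra_factors K Bs"
  shows "algebra_factors K (As @ Bs)"
  using assms by (auto simp: algebra_factors_def algebra_factors_axioms_def nth_append)

text \<open>A quadrilinear identity, reduced to pure tensors in one argument at a time; on words it
  says that slotwise multiplication respects concatenation. It is what makes the maps that apply a
  homomorphism to one slot of a tensor multiplicative.\<close>

lemma tensor_append_mult: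
  assumes "algebra_factors K As" "algebra_factors K Bs"
    and X: "X \<in> carrier (tensor_space K As)" "X' \<in> carrier (tensor_space K As)"
    and Y: "Y \<in> carrier (tensor_space K Bs)" "Y' \<in> carrier (tensor_space K Bs)"
  shows "tensor_append K (As @ Bs) (X \<otimes>\<^bsub>tensor_algebra K As\<^esub> X') (Y \<otimes>\<^bsub>tensor_algebra K Bs\<^esub> Y') =
    tensor_append K (As @ Bs) X Y \<otimes>\<^bsub>tensor_algebra K (As @ Bs)\<^esub> tensor_append K (As @ Bs) X' Y'"
proof -
  interpret As: algebra_factors K As by fact
  interpret Bs: algebra_factors K Bs by fact
  interpret AB: algebra_factors K "As @ Bs" by (rule algebra_factors_append[OF assms(1,2)])
  let ?a = "tensor_append K (As @ Bs)"
  note tf = As.tensor_factors_axioms Bs.tensor_factors_axioms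
  note b = tensor_append_bilinear[OF tf]
  note L = bilinear_left[OF b] and R = bilinear_right[OF b] and C = bilinear_closed[OF b]
  note AL = bilinear_left[OF As.mult_bilinear] and AR = bilinear_right[OF As.mult_bilinear]
    and AC = bilinear_closed[OF As.mult_bilinear]
  note BL = bilinear_left[OF Bs.mult_bilinear] and BR = bilinear_right[OF Bs.mult_bilinear]
    and BC = bilinear_closed[OF Bs.mult_bilinear]
  note TL = bilinear_left[OF AB.mult_bilinear] and TR = bilinear_right[OF AB.mult_bilinear]
  note m = AB.T.module_axioms and o = lin_hom_compose
  have wm: "word_mult (As @ Bs) (xs @ ys) (xs' @ ys') = word_mult As xs xs' @ word_mult Bs ys ys'"
    if "xs \<in> words As" "xs' \<in> words As" for xs xs' ys ys'
    using that by (simp add: word_mult_def length_words)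
  show ?thesis
    using m o[OF AL[OF X(2)] L[OF BC[OF Y]]] o[OF L[OF Y(1)] TL[OF C[OF X(2) Y(2)]]] _ X(1)
  proof (rule As.tensor_eqI)
    fix xs assume xs: "xs \<in> words As"
    note px = As.pure_closed[OF xs]
    show "?a (pure_tensor K As xs \<otimes>\<^bsub>As.TA\<^esub> X') (Y \<otimes>\<^bsub>Bs.TA\<^esub> Y') = ?a (pure_tensor K As xs) Y \<otimes>\<^bsub>AB.TA\<^esub> ?a X' Y'"
      using m o[OF AR[OF px] L[OF BC[OF Y]]] o[OF L[OF Y(2)] TR[OF C[OF px Y(1)]]] _ X(2)
    proof (rule As.tensor_eqI)
      fix xs' assume xs': "xs' \<in> words As"
      note px' = As.pure_closed[OF xs']
      show "?a (pure_tensor K As xs \<otimes>\<^bsub>As.TA\<^esub> pure_tensor K As xs') (Y \<otimes>\<^bsub>Bs.TA\<^esub> Y') =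
          ?a (pure_tensor K As xs) Y \<otimes>\<^bsub>AB.TA\<^esub> ?a (pure_tensor K As xs') Y'"
        using m o[OF BL[OF Y(2)] R[OF AC[OF px px']]] o[OF R[OF px] TL[OF C[OF px' Y(2)]]] _ Y(1)
      proof (rule Bs.tensor_eqI)
        fix ys assume ys: "ys \<in> words Bs"
        note py = Bs.pure_closed[OF ys]
        show "?a (pure_tensor K As xs \<otimes>\<^bsub>As.TA\<^esub> pure_tensor K As xs') (pure_tensor K Bs ys \<otimes>\<^bsub>Bs.TA\<^esub> Y') =
            ?a (pure_tensor K As xs) (pure_tensor K Bs ys) \<otimes>\<^bsub>AB.TA\<^esub> ?a (pure_tensor K As xs') Y'"
          using m o[OF BR[OF py] R[OF AC[OF px px']]] o[OF R[OF px'] TR[OF C[OF px py]]] _ Y(2)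
          by (rule Bs.tensor_eqI)
            (simp add: As.mult_pure Bs.mult_pure AB.mult_pure tensor_append_pure[OF tf] xs xs' ys
              words_append As.word_mult_closed Bs.word_mult_closed wm)
      qed
    qed
  qed
qed

section \<open>Closure rules for bilinear maps, and linearity of pure tensors with two or three
  slots\<close>

lemma bilinear_compose:
  "bilinear K M N P B \<Longrightarrow> h \<in> lin_hom K P Q \<Longrightarrow> bilinear K M N Q (\<lambda>x y. h (B x y))"
  by (auto simp: bilinear_def intro: lin_hom_compose)

lemma bilinear_args:
  assumes "bilinear K M' N' P B" "f \<in> lin_hom K M M'" "g \<in> lin_hom K N N'"
  shows "bilinear K M N P (\<lambda>x y. B (f x) (g y))"
  using assms lin_hom_compose[OF assms(2) bilinear_left[OF assms(1)]]
    lin_hom_compose[OF assms(3) bilinear_right[OF assms(1)]]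
    lin_hom_closed[OF assms(2)] lin_hom_closed[OF assms(3)]
  by (auto simp: bilinear_def)

lemma bilinear_flip: "bilinear K M N P B \<Longrightarrow> bilinear K N M P (\<lambda>x y. B y x)"
  by (auto simp: bilinear_def)

lemma bilinear_plus:
  "module K P \<Longrightarrow> bilinear K M N P B \<Longrightarrow> bilinear K M N P B' \<Longrightarrow> bilinear K M N P (\<lambda>x y. B x y \<oplus>\<^bsub>P\<^esub> B' x y)"
  by (auto simp: bilinear_def intro: lin_hom_plus)

lemma bilinear_diff:
  "module K P \<Longrightarrow> bilinear K M N P B \<Longrightarrow> bilinear K M N P B' \<Longrightarrow> bilinear K M N P (\<lambda>x y. B x y \<ominus>\<^bsub>P\<^esub> B' x y)"
  by (auto simp: bilinear_def intro: lin_hom_diff)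

lemma commutator_bilinear:
  assumes "k_algebra K B"
  shows "bilinear K B B B (commutator B)"
  using bilinear_diff[OF k_algebra_module k_algebra_mult_bilinear bilinear_flip[OF k_algebra_mult_bilinear]] assms
  by (simp add: commutator_def[abs_def])

lemma bilinear_tensor_eqI:
  assumes Ms: "tensor_factors K Ms" and Ns: "tensor_factors K Ns" and P: "module K P"
    and B: "bilinear K (tensor_space K Ms) (tensor_space K Ns) P B"
    and B': "bilinear K (tensor_space K Ms) (tensor_space K Ns) P B'"
    and eq: "\<And>xs ys. xs \<in> words Ms \<Longrightarrow> ys \<in> words Ns \<Longrightarrow>
      B (pure_tensor K Ms xs) (pure_tensor K Ns ys) = B' (pure_tensor K Ms xs) (pure_tensor K Ns ys)"
    and X: "X \<in> carrier (tensor_space K Ms)" and Y: "Y \<in> carrier (tensor_space K Ns)"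
  shows "B X Y = B' X Y"
proof -
  interpret Ms: tensor_factors K Ms by fact
  interpret Ns: tensor_factors K Ns by fact
  show ?thesis
    using P bilinear_left[OF B Y] bilinear_left[OF B' Y] _ X
  proof (rule Ms.tensor_eqI)
    fix xs assume xs: "xs \<in> words Ms"
    note p = Ms.pure_closed[OF xs]
    show "B (pure_tensor K Ms xs) Y = B' (pure_tensor K Ms xs) Y"
      using P bilinear_right[OF B p] bilinear_right[OF B' p] eq[OF xs] Y by (rule Ns.tensor_eqI)
  qed
qed

lemma words3: "xs \<in> words [A, B, C] \<longleftrightarrow>
    (\<exists>x\<in>carrier A. \<exists>y\<in>carrier B. \<exists>z\<in>carrier C. xs = [x, y, z])"
  by (auto simp: words_def set_Cons_def)

lemma words2: "xs \<in> words [A, B] \<longleftrightarrow> (\<exists>x\<in>carrier A. \<exists>y\<in>carrier B. xs = [x, y])"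
  by (auto simp: words_def set_Cons_def)

lemma multilinear3I:
  assumes "\<And>y z. y \<in> carrier B \<Longrightarrow> z \<in> carrier C \<Longrightarrow> (\<lambda>x. f x y z) \<in> lin_hom K A N"
    and "\<And>x z. x \<in> carrier A \<Longrightarrow> z \<in> carrier C \<Longrightarrow> (\<lambda>y. f x y z) \<in> lin_hom K B N"
    and "\<And>x y. x \<in> carrier A \<Longrightarrow> y \<in> carrier B \<Longrightarrow> (\<lambda>z. f x y z) \<in> lin_hom K C N"
  shows "multilinear K [A, B, C] N (\<lambda>xs. f (xs ! 0) (xs ! 1) (xs ! 2))"
proof -
  have "f x y z \<in> carrier N" if "x \<in> carrier A" "y \<in> carrier B" "z \<in> carrier C" for x y z
    using lin_hom_closed[OF assms(1)[OF that(2,3)] that(1)] .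
  with assms show ?thesis
    by (auto simp: multilinear_def words3 less_Suc_eq numeral_3_eq_3 numeral_2_eq_2)
qed

lemma multilinear2I:
  assumes "\<And>y. y \<in> carrier B \<Longrightarrow> (\<lambda>x. f x y) \<in> lin_hom K A N"
    and "\<And>x. x \<in> carrier A \<Longrightarrow> (\<lambda>y. f x y) \<in> lin_hom K B N"
  shows "multilinear K [A, B] N (\<lambda>xs. f (xs ! 0) (xs ! 1))"
proof -
  have "f x y \<in> carrier N" if "x \<in> carrier A" "y \<in> carrier B" for x y
    using lin_hom_closed[OF assms(1)[OF that(2)] that(1)] .
  with assms show ?thesis
    by (auto simp: multilinear_def words2 less_Suc_eq)
qed

text \<open>The inner map g is part of the statement so that backward resolution can peel nested
  linear expressions slot by slot.\<close>

lemma
  assumes T: "tensor_factors K [A, B, C]"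
  shows pure3_lin1: "g \<in> lin_hom K M A \<Longrightarrow> y \<in> carrier B \<Longrightarrow> z \<in> carrier C \<Longrightarrow>
      (\<lambda>x. pure_tensor K [A, B, C] [g x, y, z]) \<in> lin_hom K M (tensor_space K [A, B, C])"
    and pure3_lin2: "x \<in> carrier A \<Longrightarrow> g \<in> lin_hom K M B \<Longrightarrow> z \<in> carrier C \<Longrightarrow>
      (\<lambda>y. pure_tensor K [A, B, C] [x, g y, z]) \<in> lin_hom K M (tensor_space K [A, B, C])"
    and pure3_lin3: "x \<in> carrier A \<Longrightarrow> y \<in> carrier B \<Longrightarrow> g \<in> lin_hom K M C \<Longrightarrow>
      (\<lambda>z. pure_tensor K [A, B, C] [x, y, g z]) \<in> lin_hom K M (tensor_space K [A, B, C])"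
proof -
  interpret T: tensor_factors K "[A, B, C]" by fact
  have m: "module K A" "module K B" "module K C"
    using T.factor_module[of 0] T.factor_module[of 1] T.factor_module[of 2] by auto
  interpret A: module K A by (rule m)
  interpret B: module K B by (rule m)
  interpret C: module K C by (rule m)
  note l = multilinear_lin[OF T.multilinear_pure]
  show "(\<lambda>x. pure_tensor K [A, B, C] [g x, y, z]) \<in> lin_hom K M T.T"
    if "g \<in> lin_hom K M A" "y \<in> carrier B" "z \<in> carrier C"
    \<comment> \<open>Multilinearity is stated for the update of a given word; the zero in the
      varied slot is a placeholder that the update overwrites.\<close>
    using lin_hom_compose[OF that(1), of "\<lambda>x. pure_tensor K [A, B, C] [x, y, z]"]
      l[of "[\<zero>\<^bsub>A\<^esub>, y, z]" 0] that by simp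
  show "(\<lambda>y. pure_tensor K [A, B, C] [x, g y, z]) \<in> lin_hom K M T.T"
    if "x \<in> carrier A" "g \<in> lin_hom K M B" "z \<in> carrier C"
    using lin_hom_compose[OF that(2), of "\<lambda>y. pure_tensor K [A, B, C] [x, y, z]"]
      l[of "[x, \<zero>\<^bsub>B\<^esub>, z]" 1] that by simp
  show "(\<lambda>z. pure_tensor K [A, B, C] [x, y, g z]) \<in> lin_hom K M T.T"
    if "x \<in> carrier A" "y \<in> carrier B" "g \<in> lin_hom K M C"
    using lin_hom_compose[OF that(3), of "\<lambda>z. pure_tensor K [A, B, C] [x, y, z]"]
      l[of "[x, y, \<zero>\<^bsub>C\<^esub>]" 2] that by simp
qed

lemma
  assumes T: "tensor_factors K [A, B]"
  shows pure2_lin1: "g \<in> lin_hom K M A \<Longrightarrow> y \<in> carrier B \<Longrightarrow>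
      (\<lambda>x. pure_tensor K [A, B] [g x, y]) \<in> lin_hom K M (tensor_space K [A, B])"
    and pure2_lin2: "x \<in> carrier A \<Longrightarrow> g \<in> lin_hom K M B \<Longrightarrow>
      (\<lambda>y. pure_tensor K [A, B] [x, g y]) \<in> lin_hom K M (tensor_space K [A, B])"
proof -
  interpret T: tensor_factors K "[A, B]" by fact
  have m: "module K A" "module K B"
    using T.factor_module[of 0] T.factor_module[of 1] by auto
  interpret A: module K A by (rule m)
  interpret B: module K B by (rule m)
  note l = multilinear_lin[OF T.multilinear_pure]
  show "(\<lambda>x. pure_tensor K [A, B] [g x, y]) \<in> lin_hom K M T.T"
    if "g \<in> lin_hom K M A" "y \<in> carrier B"
    using lin_hom_compose[OF that(1), of "\<lambda>x. pure_tensor K [A, B] [x, y]"]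
      l[of "[\<zero>\<^bsub>A\<^esub>, y]" 0] that by simp
  show "(\<lambda>y. pure_tensor K [A, B] [x, g y]) \<in> lin_hom K M T.T"
    if "x \<in> carrier A" "g \<in> lin_hom K M B"
    using lin_hom_compose[OF that(2), of "\<lambda>y. pure_tensor K [A, B] [x, y]"]
      l[of "[x, \<zero>\<^bsub>B\<^esub>]" 1] that by simp
qed

lemma mult_lin_left:
  assumes "k_algebra K B" "f \<in> lin_hom K M B" "b \<in> carrier B"
  shows "(\<lambda>x. f x \<otimes>\<^bsub>B\<^esub> b) \<in> lin_hom K M B"
  by (rule lin_hom_compose[OF assms(2) bilinear_left[OF k_algebra_mult_bilinear[OF assms(1)] assms(3)]])

lemma mult_lin_right:
  assumes "k_algebra K B" "b \<in> carrier B" "f \<in> lin_hom K M B"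
  shows "(\<lambda>x. b \<otimes>\<^bsub>B\<^esub> f x) \<in> lin_hom K M B"
  by (rule lin_hom_compose[OF assms(3) bilinear_right[OF k_algebra_mult_bilinear[OF assms(1)] assms(2)]])

lemma algebra_factorsI:
  assumes "field K" "\<And>B. B \<in> set Bs \<Longrightarrow> k_algebra K B"
  shows "algebra_factors K Bs"
  using assms by (auto simp: algebra_factors_def algebra_factors_axioms_def)

lemma (in algebra_factors) tensor_factors: "tensor_factors K Bs"
  by (rule tensor_factors_axioms)

lemma algebra_factors_triple:
  assumes "k_algebra K B"
  shows "algebra_factors K (triple B)"
  by (rule algebra_factorsI[OF k_algebra_field[OF assms]]) (use assms k_algebra_op in auto)

section \<open>The enveloping pair of a triple tensor product\<close>

text \<open>For elements a and b, the pairs (g, d), (g', d'), (m, e), (c, f) stand for the images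
  under (\<gamma>, \<delta>) of a, b, the product ab and the bracket of a and b. Stating the
  relations for elements rather than for maps allows them to be moved along homomorphisms and
  multiplied. Commutators are written without subtraction so that the equations can serve as rewrite
  rules; the rule for g d' reflects the antisymmetry of the bracket.\<close>

definition pair_relations ::
    "('b, 'm) ring_scheme \<Rightarrow> 'b \<Rightarrow> 'b \<Rightarrow> 'b \<Rightarrow> 'b \<Rightarrow> 'b \<Rightarrow> 'b \<Rightarrow> 'b \<Rightarrow> 'b \<Rightarrow> bool" where
  "pair_relations R g d g' d' m e c f \<longleftrightarrow>
     {g, d, g', d', m, e, c, f} \<subseteq> carrier R \<and>
     g \<otimes>\<^bsub>R\<^esub> g' = m \<and> g' \<otimes>\<^bsub>R\<^esub> g = m \<and> e = g \<otimes>\<^bsub>R\<^esub> d' \<oplus>\<^bsub>R\<^esub> g' \<otimes>\<^bsub>R\<^esub> d \<and>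
     d \<otimes>\<^bsub>R\<^esub> g' = g' \<otimes>\<^bsub>R\<^esub> d \<oplus>\<^bsub>R\<^esub> c \<and> g \<otimes>\<^bsub>R\<^esub> d' = d' \<otimes>\<^bsub>R\<^esub> g \<oplus>\<^bsub>R\<^esub> c \<and>
     d \<otimes>\<^bsub>R\<^esub> d' = d' \<otimes>\<^bsub>R\<^esub> d \<oplus>\<^bsub>R\<^esub> f"

text \<open>The formulas come from the tensor product of two Poisson algebras: a (x) b is sent to
  \<gamma>\<gamma> and to \<gamma>\<delta> + \<delta>\<gamma>, and the bracket of a (x) b with a'
  (x) b' is aa' (x) {b, b'} + {a, a'} (x) bb'. Expanding \<delta> of this bracket gives the four
  terms of the last argument.\<close>

lemma (in ring) pair_relations_prod:
  assumes 1: "pair_relations R g d g' d' m e c f"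
    and 2: "pair_relations R h k h' k' n p b q"
    and comm: "\<forall>u\<in>{h, k, h', k', n, p, b, q}. \<forall>v\<in>{g, d, g', d', m, e, c, f}. u \<otimes> v = v \<otimes> u"
  shows "pair_relations R (g \<otimes> h) (g \<otimes> k \<oplus> d \<otimes> h) (g' \<otimes> h') (g' \<otimes> k' \<oplus> d' \<otimes> h')
    (m \<otimes> n) (m \<otimes> p \<oplus> e \<otimes> n) (m \<otimes> b \<oplus> c \<otimes> n) (m \<otimes> q \<oplus> e \<otimes> b \<oplus> c \<otimes> p \<oplus> f \<otimes> n)"
proof -
  have cl: "g \<in> carrier R" "d \<in> carrier R" "g' \<in> carrier R" "d' \<in> carrier R" "c \<in> carrier R" "f \<in> carrier R"
      "h \<in> carrier R" "k \<in> carrier R" "h' \<in> carrier R" "k' \<in> carrier R" "b \<in> carrier R" "q \<in> carrier R"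
    using 1 2 by (auto simp: pair_relations_def)
  \<comment> \<open>Everything is brought to a normal form: factors from the first family stand left
    of those from the second, and within a family primed factors stand left of unprimed ones. The
    products \<open>m\<close>, \<open>n\<close> and the elements \<open>e\<close>, \<open>p\<close>
    are eliminated beforehand.\<close>
  have sw: "u \<otimes> v = v \<otimes> u" if "u \<in> {h, k, h', k', b, q}" "v \<in> {g, d, g', d', c, f}" for u v
    using comm that by auto
  have sw': "u \<otimes> (v \<otimes> w) = v \<otimes> (u \<otimes> w)"
    if "u \<in> {h, k, h', k', b, q}" "v \<in> {g, d, g', d', c, f}" "w \<in> carrier R" for u v w
    using that cl sw[OF that(1,2)] by (auto simp: m_assoc[symmetric])
  have r1: "g \<otimes> g' = g' \<otimes> g" "d \<otimes> g' = g' \<otimes> d \<oplus> c" "g \<otimes> d' = d' \<otimes> g \<oplus> c" "d \<otimes> d' = d' \<otimes> d \<oplus> f"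
    and r2: "h \<otimes> h' = h' \<otimes> h" "k \<otimes> h' = h' \<otimes> k \<oplus> b" "h \<otimes> k' = k' \<otimes> h \<oplus> b" "k \<otimes> k' = k' \<otimes> k \<oplus> q"
    and m: "m = g' \<otimes> g" "n = h' \<otimes> h" and e: "e = d' \<otimes> g \<oplus> c \<oplus> g' \<otimes> d" "p = k' \<otimes> h \<oplus> b \<oplus> h' \<otimes> k"
    using 1 2 by (auto simp: pair_relations_def)
  \<comment> \<open>Products are associated to the right, so relations of the first family are also
    needed in front of a tail w. The two factors from the second family end each word, where the
    plain relations apply.\<close>
  have r1': "g \<otimes> (g' \<otimes> w) = g' \<otimes> (g \<otimes> w)" "d \<otimes> (g' \<otimes> w) = g' \<otimes> (d \<otimes> w) \<oplus> c \<otimes> w"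
      "g \<otimes> (d' \<otimes> w) = d' \<otimes> (g \<otimes> w) \<oplus> c \<otimes> w" "d \<otimes> (d' \<otimes> w) = d' \<otimes> (d \<otimes> w) \<oplus> f \<otimes> w"
    if "w \<in> carrier R" for w
    using that cl by (simp_all add: m_assoc[symmetric] r1 l_distr)
  show ?thesis
    unfolding pair_relations_def m e
    by (simp add: cl l_distr r_distr m_assoc r1 r2 r1' sw sw' a_ac)
qed

lemma enveloping_pair_compose:
  assumes "enveloping_pair K C br' B \<gamma> \<delta>" "\<phi> \<in> alg_hom K A C"
    and "\<And>a b. a \<in> carrier A \<Longrightarrow> b \<in> carrier A \<Longrightarrow> \<phi> (br a b) = br' (\<phi> a) (\<phi> b)"
  shows "enveloping_pair K A br B (\<gamma> \<circ> \<phi>) (\<delta> \<circ> \<phi>)"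
  using assms alg_hom_comp[OF assms(2), of \<gamma> B] lin_hom_compose[OF alg_hom_lin[OF assms(2)], of \<delta> B]
    lin_hom_closed[OF alg_hom_lin[OF assms(2)]] alg_hom_mult[OF assms(2)]
  by (auto simp: enveloping_pair_def comp_def)

lemma (in abelian_group) plus_minus_cancel:
  assumes "x \<in> carrier G" "y \<in> carrier G"
  shows "y \<oplus> (x \<ominus> y) = x"
  using assms by (simp add: a_minus_def a_lcomm[of y x "\<ominus> y"] r_neg)

lemma (in abelian_group) plus_minus_cancel':
  assumes "x \<in> carrier G" "y \<in> carrier G"
  shows "(y \<oplus> x) \<ominus> y = x"
  using assms by (simp add: a_minus_def a_ac r_neg)

lemma pair_relations_hom:
  assumes "k_algebra K B" "k_algebra K C" "h \<in> alg_hom K B C" "pair_relations B g d g' d' m e c f"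
  shows "pair_relations C (h g) (h d) (h g') (h d') (h m) (h e) (h c) (h f)"
proof -
  interpret B: ring B by (rule k_algebra_ring) fact
  interpret C: ring C by (rule k_algebra_ring) fact
  note l = alg_hom_lin[OF assms(3)]
  have "g \<otimes>\<^bsub>B\<^esub> g' = m" "g' \<otimes>\<^bsub>B\<^esub> g = m" "e = g \<otimes>\<^bsub>B\<^esub> d' \<oplus>\<^bsub>B\<^esub> g' \<otimes>\<^bsub>B\<^esub> d"
     "d \<otimes>\<^bsub>B\<^esub> g' = g' \<otimes>\<^bsub>B\<^esub> d \<oplus>\<^bsub>B\<^esub> c" "g \<otimes>\<^bsub>B\<^esub> d' = d' \<otimes>\<^bsub>B\<^esub> g \<oplus>\<^bsub>B\<^esub> c" "d \<otimes>\<^bsub>B\<^esub> d' = d' \<otimes>\<^bsub>B\<^esub> d \<oplus>\<^bsub>B\<^esub> f"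
    and cl: "g \<in> carrier B" "d \<in> carrier B" "g' \<in> carrier B" "d' \<in> carrier B" "m \<in> carrier B"
      "e \<in> carrier B" "c \<in> carrier B" "f \<in> carrier B"
    using assms(4) by (auto simp: pair_relations_def)
  from this(1-6)[THEN arg_cong[of _ _ h]] show ?thesis
    using lin_hom_closed[OF l] by (simp add: pair_relations_def cl lin_hom_add[OF l] alg_hom_mult[OF assms(3)])
qed

locale enveloping_setup =
  fixes K :: "'k ring" and A :: "('k, 'a) module" and br :: "'a \<Rightarrow> 'a \<Rightarrow> 'a"
    and U :: "('k, 'u) module" and \<alpha> \<beta> :: "'a \<Rightarrow> 'u"
  assumes poisson: "poisson_algebra K A br"
    and U_algebra: "k_algebra K U"
    and pair: "enveloping_pair K A br U \<alpha> \<beta>"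
begin

lemma A_algebra: "k_algebra K A" and A_cring: "cring A"
  and br_self: "a \<in> carrier A \<Longrightarrow> br a a = \<zero>\<^bsub>A\<^esub>"
  using poisson by (simp_all add: poisson_algebra_def)

lemma br_bilinear: "bilinear K A A A br"
  using poisson by (simp add: poisson_algebra_def bilinear_def)

sublocale A: cring A by (rule A_cring)
sublocale U: ring U by (rule k_algebra_ring[OF U_algebra])
sublocale AT: algebra_factors K "triple A"
  by (rule algebra_factors_triple[OF A_algebra])
sublocale UT: algebra_factors K "triple U"
  by (rule algebra_factors_triple[OF U_algebra])
sublocale TU: ring "tensor_algebra K (triple U)"
  by (rule k_algebra_ring[OF UT.tensor_algebra])

lemma \<alpha>_hom: "\<alpha> \<in> alg_hom K A U" and \<beta>_lin: "\<beta> \<in> lin_hom K A U"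
  using pair by (simp_all add: enveloping_pair_def)

lemmas \<alpha>_lin = alg_hom_lin[OF \<alpha>_hom]
lemmas \<alpha>_closed [simp] = lin_hom_closed[OF \<alpha>_lin]
lemmas \<beta>_closed [simp] = lin_hom_closed[OF \<beta>_lin]
lemmas br_closed [simp] = bilinear_closed[OF br_bilinear]
lemmas A_module = k_algebra_module[OF A_algebra]
lemmas U_module = k_algebra_module[OF U_algebra]

lemma br_commute:
  assumes "a \<in> carrier A" "b \<in> carrier A"
  shows "br b a = \<ominus>\<^bsub>A\<^esub> br a b"
proof -
  note l = lin_hom_add[OF bilinear_left[OF br_bilinear]] and r = lin_hom_add[OF bilinear_right[OF br_bilinear]]
  have "br (a \<oplus>\<^bsub>A\<^esub> b) (a \<oplus>\<^bsub>A\<^esub> b) = br a b \<oplus>\<^bsub>A\<^esub> br b a"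
    using assms by (simp add: l r) (simp add: br_self A.a_comm)
  then have "br a b \<oplus>\<^bsub>A\<^esub> br b a = \<zero>\<^bsub>A\<^esub>" using assms br_self[of "a \<oplus>\<^bsub>A\<^esub> b"] by simp
  then have "br b a \<oplus>\<^bsub>A\<^esub> br a b = \<zero>\<^bsub>A\<^esub>" using assms by (subst A.a_comm) auto
  then show ?thesis using assms by (intro A.minus_equality[symmetric]) auto
qed

lemma
  assumes "a \<in> carrier A" "b \<in> carrier A"
  shows \<alpha>_mult: "\<alpha> (a \<otimes>\<^bsub>A\<^esub> b) = \<alpha> a \<otimes>\<^bsub>U\<^esub> \<alpha> b"
    and \<alpha>_commute: "\<alpha> a \<otimes>\<^bsub>U\<^esub> \<alpha> b = \<alpha> b \<otimes>\<^bsub>U\<^esub> \<alpha> a"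
    and \<beta>_mult: "\<beta> (a \<otimes>\<^bsub>A\<^esub> b) = \<alpha> a \<otimes>\<^bsub>U\<^esub> \<beta> b \<oplus>\<^bsub>U\<^esub> \<alpha> b \<otimes>\<^bsub>U\<^esub> \<beta> a"
    and \<beta>_\<alpha>: "\<beta> a \<otimes>\<^bsub>U\<^esub> \<alpha> b = \<alpha> b \<otimes>\<^bsub>U\<^esub> \<beta> a \<oplus>\<^bsub>U\<^esub> \<alpha> (br a b)"
    and \<beta>_\<beta>: "\<beta> a \<otimes>\<^bsub>U\<^esub> \<beta> b = \<beta> b \<otimes>\<^bsub>U\<^esub> \<beta> a \<oplus>\<^bsub>U\<^esub> \<beta> (br a b)"
proof -
  show m: "\<alpha> (a \<otimes>\<^bsub>A\<^esub> b) = \<alpha> a \<otimes>\<^bsub>U\<^esub> \<alpha> b" using assms by (rule alg_hom_mult[OF \<alpha>_hom])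
  show "\<alpha> a \<otimes>\<^bsub>U\<^esub> \<alpha> b = \<alpha> b \<otimes>\<^bsub>U\<^esub> \<alpha> a"
    using assms m alg_hom_mult[OF \<alpha>_hom, of b a] by (simp add: A.m_comm)
  show "\<beta> (a \<otimes>\<^bsub>A\<^esub> b) = \<alpha> a \<otimes>\<^bsub>U\<^esub> \<beta> b \<oplus>\<^bsub>U\<^esub> \<alpha> b \<otimes>\<^bsub>U\<^esub> \<beta> a"
    using assms pair by (simp add: enveloping_pair_def)
  have "\<alpha> (br a b) = \<beta> a \<otimes>\<^bsub>U\<^esub> \<alpha> b \<ominus>\<^bsub>U\<^esub> \<alpha> b \<otimes>\<^bsub>U\<^esub> \<beta> a" "\<beta> (br a b) = \<beta> a \<otimes>\<^bsub>U\<^esub> \<beta> b \<ominus>\<^bsub>U\<^esub> \<beta> b \<otimes>\<^bsub>U\<^esub> \<beta> a"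
    using assms pair by (simp_all add: enveloping_pair_def commutator_def)
  then show "\<beta> a \<otimes>\<^bsub>U\<^esub> \<alpha> b = \<alpha> b \<otimes>\<^bsub>U\<^esub> \<beta> a \<oplus>\<^bsub>U\<^esub> \<alpha> (br a b)" "\<beta> a \<otimes>\<^bsub>U\<^esub> \<beta> b = \<beta> b \<otimes>\<^bsub>U\<^esub> \<beta> a \<oplus>\<^bsub>U\<^esub> \<beta> (br a b)"
    using assms by (simp_all add: U.plus_minus_cancel)
qed

lemma \<alpha>_uminus: "a \<in> carrier A \<Longrightarrow> \<alpha> (\<ominus>\<^bsub>A\<^esub> a) = \<ominus>\<^bsub>U\<^esub> \<alpha> a"
  using lin_hom_uminus[OF A_module U_module] \<alpha>_lin by auto

lemma \<alpha>_\<beta>: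
  assumes "a \<in> carrier A" "b \<in> carrier A"
  shows "\<alpha> a \<otimes>\<^bsub>U\<^esub> \<beta> b = \<beta> b \<otimes>\<^bsub>U\<^esub> \<alpha> a \<oplus>\<^bsub>U\<^esub> \<alpha> (br a b)"
  using assms \<beta>_\<alpha>[of b a] by (simp add: br_commute[of a b] \<alpha>_uminus U.l_neg U.a_assoc)

lemma pair_relations_U:
  assumes "a \<in> carrier A" "b \<in> carrier A"
  shows "pair_relations U (\<alpha> a) (\<beta> a) (\<alpha> b) (\<beta> b) (\<alpha> (a \<otimes>\<^bsub>A\<^esub> b)) (\<beta> (a \<otimes>\<^bsub>A\<^esub> b)) (\<alpha> (br a b)) (\<beta> (br a b))"
  using assms \<beta>_\<alpha>[OF assms] \<alpha>_\<beta>[OF assms] \<beta>_\<beta>[OF assms] \<alpha>_commute[OF assms]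
  by (simp add: pair_relations_def \<beta>_mult \<alpha>_mult)

text \<open>Reversing products negates commutators, which is why the two bracket entries carry a
  minus sign. The rule for \<beta> of a product survives the reversal: it changes by the commutators
  of \<beta>(b) with \<alpha>(a) and of \<beta>(a) with \<alpha>(b), which are \<alpha>({b, a}) and
  \<alpha>({a, b}) and cancel.\<close>

lemma pair_relations_op:
  assumes "a \<in> carrier A" "b \<in> carrier A"
  shows "pair_relations (op_alg U) (\<alpha> a) (\<beta> a) (\<alpha> b) (\<beta> b) (\<alpha> (a \<otimes>\<^bsub>A\<^esub> b)) (\<beta> (a \<otimes>\<^bsub>A\<^esub> b))
    (\<ominus>\<^bsub>U\<^esub> \<alpha> (br a b)) (\<ominus>\<^bsub>U\<^esub> \<beta> (br a b))"
proof -
  note r = \<beta>_\<alpha>[OF assms] \<alpha>_\<beta>[OF assms] \<beta>_\<beta>[OF assms]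
  have "\<beta> (a \<otimes>\<^bsub>A\<^esub> b) = \<beta> b \<otimes>\<^bsub>U\<^esub> \<alpha> a \<oplus>\<^bsub>U\<^esub> \<beta> a \<otimes>\<^bsub>U\<^esub> \<alpha> b"
    using assms by (simp add: \<beta>_mult r U.a_assoc) (simp add: U.a_comm)
  moreover have "\<alpha> b \<otimes>\<^bsub>U\<^esub> \<beta> a = \<beta> a \<otimes>\<^bsub>U\<^esub> \<alpha> b \<oplus>\<^bsub>U\<^esub> \<ominus>\<^bsub>U\<^esub> \<alpha> (br a b)"
    "\<beta> b \<otimes>\<^bsub>U\<^esub> \<alpha> a = \<alpha> a \<otimes>\<^bsub>U\<^esub> \<beta> b \<oplus>\<^bsub>U\<^esub> \<ominus>\<^bsub>U\<^esub> \<alpha> (br a b)"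
    "\<beta> b \<otimes>\<^bsub>U\<^esub> \<beta> a = \<beta> a \<otimes>\<^bsub>U\<^esub> \<beta> b \<oplus>\<^bsub>U\<^esub> \<ominus>\<^bsub>U\<^esub> \<beta> (br a b)"
    using assms by (simp_all add: r U.a_assoc U.r_neg)
  ultimately show ?thesis
    using assms \<alpha>_commute[OF assms] by (simp add: pair_relations_def \<alpha>_mult)
qed

abbreviation t :: "'u \<Rightarrow> 'u \<Rightarrow> 'u \<Rightarrow> ('u list \<Rightarrow> 'k) set" where
  "t x y z \<equiv> pure_tensor K (triple U) [x, y, z]"

abbreviation s :: "'a \<Rightarrow> 'a \<Rightarrow> 'a \<Rightarrow> ('a list \<Rightarrow> 'k) set" where
  "s x y z \<equiv> pure_tensor K (triple A) [x, y, z]"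

lemma t_closed [simp]: "x \<in> carrier U \<Longrightarrow> y \<in> carrier U \<Longrightarrow> z \<in> carrier U \<Longrightarrow> t x y z \<in> carrier UT.T"
  by (rule UT.pure_closed) simp

lemma s_closed [simp]: "x \<in> carrier A \<Longrightarrow> y \<in> carrier A \<Longrightarrow> z \<in> carrier A \<Longrightarrow> s x y z \<in> carrier AT.T"
  by (rule AT.pure_closed) simp

lemma t_mult:
  assumes "x \<in> carrier U" "y \<in> carrier U" "z \<in> carrier U" "x' \<in> carrier U" "y' \<in> carrier U" "z' \<in> carrier U"
  shows "t x y z \<otimes>\<^bsub>UT.TA\<^esub> t x' y' z' = t (x \<otimes>\<^bsub>U\<^esub> x') (y' \<otimes>\<^bsub>U\<^esub> y) (z \<otimes>\<^bsub>U\<^esub> z')"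
  using UT.mult_pure[of "[x, y, z]" "[x', y', z']"] assms by (simp add: word_mult_def)

lemma s_mult:
  assumes "x \<in> carrier A" "y \<in> carrier A" "z \<in> carrier A" "x' \<in> carrier A" "y' \<in> carrier A" "z' \<in> carrier A"
  shows "s x y z \<otimes>\<^bsub>AT.TA\<^esub> s x' y' z' = s (x \<otimes>\<^bsub>A\<^esub> x') (y \<otimes>\<^bsub>A\<^esub> y') (z \<otimes>\<^bsub>A\<^esub> z')"
  using AT.mult_pure[of "[x, y, z]" "[x', y', z']"] assms by (simp add: word_mult_def A.m_comm)

lemmas U_pure_lin = pure3_lin1[OF UT.tensor_factors] pure3_lin2[OF UT.tensor_factors, unfolded lin_hom_op op_alg_simps]
  pure3_lin3[OF UT.tensor_factors]

lemma t_neg2: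
  assumes "x \<in> carrier U" "y \<in> carrier U" "z \<in> carrier U"
  shows "t x (\<ominus>\<^bsub>U\<^esub> y) z = \<ominus>\<^bsub>UT.T\<^esub> t x y z"
  by (rule lin_hom_uminus[OF U_module UT.T.module_axioms, where h = "\<lambda>y. t x y z"])
    (use assms in \<open>auto intro!: U_pure_lin lin_hom_ident\<close>)

text \<open>These inclusions transport the relations of a pair into the triple tensor algebra; the
  middle one starts from \<open>op_alg U\<close>, which is where \<open>pair_relations_op\<close>
  enters.\<close>

lemma slot_homs:
  "(\<lambda>x. t x \<one>\<^bsub>U\<^esub> \<one>\<^bsub>U\<^esub>) \<in> alg_hom K U UT.TA"
  "(\<lambda>y. t \<one>\<^bsub>U\<^esub> y \<one>\<^bsub>U\<^esub>) \<in> alg_hom K (op_alg U) UT.TA"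
  "(\<lambda>z. t \<one>\<^bsub>U\<^esub> \<one>\<^bsub>U\<^esub> z) \<in> alg_hom K U UT.TA"
  by (auto intro!: alg_homI U_pure_lin lin_hom_ident simp: t_mult)

lemma
  assumes "f \<in> lin_hom K A U" "g \<in> lin_hom K A U" "h \<in> lin_hom K A U"
  shows map3_lin: "tensor_map K (triple U) [f, g, h] \<in> lin_hom K AT.T UT.T"
    and map3_pure: "x \<in> carrier A \<Longrightarrow> y \<in> carrier A \<Longrightarrow> z \<in> carrier A \<Longrightarrow>
      tensor_map K (triple U) [f, g, h] (s x y z) = t (f x) (g y) (h z)"
proof -
  have l: "[f, g, h] ! i \<in> lin_hom K (triple A ! i) (triple U ! i)" if "i < length (triple A)" for i
    using that assms by (auto simp: less_Suc_eq)
  note tf = AT.tensor_factors UT.tensor_factors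
  show "tensor_map K (triple U) [f, g, h] \<in> lin_hom K AT.T UT.T"
    by (rule tensor_map_lin[OF tf _ _ l]) simp_all
  show "tensor_map K (triple U) [f, g, h] (s x y z) = t (f x) (g y) (h z)"
    if "x \<in> carrier A" "y \<in> carrier A" "z \<in> carrier A"
    using tensor_map_pure[OF tf _ _ l, of "[x, y, z]"] that by simp
qed

abbreviation "\<gamma> \<equiv> env_\<alpha>\<alpha>\<alpha> K U \<alpha>"
abbreviation "\<xi> \<equiv> env_\<xi> K U \<alpha> \<beta>"
abbreviation "tb \<equiv> triple_bracket K A br"

lemma \<gamma>_hom: "\<gamma> \<in> alg_hom K AT.TA UT.TA"
  unfolding env_\<alpha>\<alpha>\<alpha>_def
proof (rule tensor_map_alg_hom[OF AT.algebra_factors_axioms UT.algebra_factors_axioms])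
  have "\<alpha> \<in> alg_hom K (op_alg A) (op_alg U)"
    using \<alpha>_lin alg_hom_one[OF \<alpha>_hom] \<alpha>_mult \<alpha>_commute A.m_comm by (intro alg_homI) auto
  then show "[\<alpha>, \<alpha>, \<alpha>] ! i \<in> alg_hom K (triple A ! i) (triple U ! i)" if "i < length (triple A)" for i
    using that \<alpha>_hom by (auto simp: less_Suc_eq)
qed simp_all

lemma \<gamma>_pure: "x \<in> carrier A \<Longrightarrow> y \<in> carrier A \<Longrightarrow> z \<in> carrier A \<Longrightarrow> \<gamma> (s x y z) = t (\<alpha> x) (\<alpha> y) (\<alpha> z)"
  unfolding env_\<alpha>\<alpha>\<alpha>_def by (rule map3_pure[OF \<alpha>_lin \<alpha>_lin \<alpha>_lin])

lemma \<xi>_lin: "\<xi> \<in> lin_hom K AT.T UT.T"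
  unfolding env_\<xi>_def[abs_def] by (intro lin_hom_plus UT.T.module_axioms map3_lin \<alpha>_lin \<beta>_lin)

lemma \<xi>_pure: "x \<in> carrier A \<Longrightarrow> y \<in> carrier A \<Longrightarrow> z \<in> carrier A \<Longrightarrow>
    \<xi> (s x y z) = t (\<alpha> x) (\<alpha> y) (\<beta> z) \<oplus>\<^bsub>UT.T\<^esub> t (\<alpha> x) (\<beta> y) (\<alpha> z) \<oplus>\<^bsub>UT.T\<^esub> t (\<beta> x) (\<alpha> y) (\<alpha> z)"
  unfolding env_\<xi>_def by (simp add: map3_pure \<alpha>_lin \<beta>_lin)

text \<open>The bracket is a nested lift like the product, so it remains to see that its formula on
  words is multilinear in each of the two words.\<close>

lemma
  shows tb_bilinear: "bilinear K AT.T AT.T AT.T tb"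
    and tb_pure: "\<And>x y z x' y' z'. x \<in> carrier A \<Longrightarrow> y \<in> carrier A \<Longrightarrow> z \<in> carrier A \<Longrightarrow>
      x' \<in> carrier A \<Longrightarrow> y' \<in> carrier A \<Longrightarrow> z' \<in> carrier A \<Longrightarrow> tb (s x y z) (s x' y' z') =
        s (br x x') (y \<otimes>\<^bsub>A\<^esub> y') (z \<otimes>\<^bsub>A\<^esub> z') \<ominus>\<^bsub>AT.T\<^esub> s (x \<otimes>\<^bsub>A\<^esub> x') (br y y') (z \<otimes>\<^bsub>A\<^esub> z')
        \<oplus>\<^bsub>AT.T\<^esub> s (x \<otimes>\<^bsub>A\<^esub> x') (y \<otimes>\<^bsub>A\<^esub> y') (br z z')"
proof -
  define \<Phi> where "\<Phi> = (\<lambda>x y z x' y' z'.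
    s (br x x') (y \<otimes>\<^bsub>A\<^esub> y') (z \<otimes>\<^bsub>A\<^esub> z') \<ominus>\<^bsub>AT.T\<^esub> s (x \<otimes>\<^bsub>A\<^esub> x') (br y y') (z \<otimes>\<^bsub>A\<^esub> z')
    \<oplus>\<^bsub>AT.T\<^esub> s (x \<otimes>\<^bsub>A\<^esub> x') (y \<otimes>\<^bsub>A\<^esub> y') (br z z'))"
  let ?\<Psi> = "\<lambda>xs ys. \<Phi> (xs ! 0) (xs ! 1) (xs ! 2) (ys ! 0) (ys ! 1) (ys ! 2)"
  note lin = lin_hom_plus lin_hom_diff AT.T.module_axioms pure3_lin1[OF AT.tensor_factors]
    pure3_lin2[OF AT.tensor_factors, unfolded lin_hom_op op_alg_simps] pure3_lin3[OF AT.tensor_factors]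
    bilinear_left[OF br_bilinear] bilinear_right[OF br_bilinear]
    bilinear_left[OF k_algebra_mult_bilinear[OF A_algebra]] bilinear_right[OF k_algebra_mult_bilinear[OF A_algebra]]
    A.m_closed br_closed
  have l: "multilinear K (triple A) AT.T (\<lambda>xs. ?\<Psi> xs ys)" if ys': "ys \<in> words (triple A)" for ys
  proof -
    obtain x' y' z' where ys: "ys = [x', y', z']" "x' \<in> carrier A" "y' \<in> carrier A" "z' \<in> carrier A"
      using ys' by (auto simp: words3)
    show ?thesis
      unfolding \<Phi>_def ys(1) by (rule multilinear3I; simp only: lin_hom_op op_alg_simps; (intro lin; (simp add: ys)?))
  qed
  have r: "multilinear K (triple A) AT.T (?\<Psi> xs)" if xs': "xs \<in> words (triple A)" for xs
  proof -
    obtain x y z where xs: "xs = [x, y, z]" "x \<in> carrier A" "y \<in> carrier A" "z \<in> carrier A"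
      using xs' by (auto simp: words3)
    show ?thesis
      unfolding \<Phi>_def xs(1) by (rule multilinear3I; simp only: lin_hom_op op_alg_simps; (intro lin; (simp add: xs)?))
  qed
  note tf = AT.tensor_factors
  have tb: "tb = (\<lambda>X Y. tensor_lift K AT.T (\<lambda>xs. tensor_lift K AT.T (?\<Psi> xs) Y) X)"
    by (simp add: triple_bracket_def[abs_def] tensor_lift3_def Let_def \<Phi>_def)
  show "bilinear K AT.T AT.T AT.T tb"
    unfolding tb by (rule bilift_bilinear[OF tf tf AT.T.module_axioms l r])
  show "tb (s x y z) (s x' y' z') = s (br x x') (y \<otimes>\<^bsub>A\<^esub> y') (z \<otimes>\<^bsub>A\<^esub> z') \<ominus>\<^bsub>AT.T\<^esub> s (x \<otimes>\<^bsub>A\<^esub> x') (br y y') (z \<otimes>\<^bsub>A\<^esub> z')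
        \<oplus>\<^bsub>AT.T\<^esub> s (x \<otimes>\<^bsub>A\<^esub> x') (y \<otimes>\<^bsub>A\<^esub> y') (br z z')"
    if "x \<in> carrier A" "y \<in> carrier A" "z \<in> carrier A" "x' \<in> carrier A" "y' \<in> carrier A" "z' \<in> carrier A"
    for x y z x' y' z'
    unfolding tb using bilift_pure[OF tf tf AT.T.module_axioms l r, of "[x, y, z]" "[x', y', z']"] that
    by (simp add: \<Phi>_def)
qed

lemmas TU_distrib = TU.l_distr[unfolded tensor_algebra_simps] TU.r_distr[unfolded tensor_algebra_simps]

text \<open>
  Each slot of \<open>U \<otimes> U\<^sup>o\<^sup>p \<otimes> U\<close> carries the relations of an enveloping pair, with the bracket of the
  middle slot negated; the relations of the triple tensor product follow because different slots
  commute.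
\<close>

lemma pair_relations_triple:
  assumes x: "x \<in> carrier A" "x' \<in> carrier A" and y: "y \<in> carrier A" "y' \<in> carrier A"
    and z: "z \<in> carrier A" "z' \<in> carrier A"
  defines "X \<equiv> s x y z" and "Y \<equiv> s x' y' z'"
  shows "pair_relations UT.TA (\<gamma> X) (\<xi> X) (\<gamma> Y) (\<xi> Y) (\<gamma> (X \<otimes>\<^bsub>AT.TA\<^esub> Y)) (\<xi> (X \<otimes>\<^bsub>AT.TA\<^esub> Y)) (\<gamma> (tb X Y)) (\<xi> (tb X Y))"
proof -
  note c = x y z
  note p1 = pair_relations_hom[OF U_algebra UT.tensor_algebra slot_homs(1) pair_relations_U[OF x]]
  note p2 = pair_relations_hom[OF k_algebra_op[OF U_algebra] UT.tensor_algebra slot_homs(2) pair_relations_op[OF y]]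
  note p3 = pair_relations_hom[OF U_algebra UT.tensor_algebra slot_homs(3) pair_relations_U[OF z]]
  \<comment> \<open>The first two slots are combined, with the unit still in the third. The outcome
    is written as sums of single tensors so that it can be multiplied with the third slot in the
    same way.\<close>
  have p12: "pair_relations UT.TA (t (\<alpha> x) (\<alpha> y) \<one>\<^bsub>U\<^esub>) (t (\<alpha> x) (\<beta> y) \<one>\<^bsub>U\<^esub> \<oplus>\<^bsub>UT.T\<^esub> t (\<beta> x) (\<alpha> y) \<one>\<^bsub>U\<^esub>)
     (t (\<alpha> x') (\<alpha> y') \<one>\<^bsub>U\<^esub>) (t (\<alpha> x') (\<beta> y') \<one>\<^bsub>U\<^esub> \<oplus>\<^bsub>UT.T\<^esub> t (\<beta> x') (\<alpha> y') \<one>\<^bsub>U\<^esub>)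
     (t (\<alpha> (x \<otimes>\<^bsub>A\<^esub> x')) (\<alpha> (y \<otimes>\<^bsub>A\<^esub> y')) \<one>\<^bsub>U\<^esub>)
     (t (\<alpha> (x \<otimes>\<^bsub>A\<^esub> x')) (\<beta> (y \<otimes>\<^bsub>A\<^esub> y')) \<one>\<^bsub>U\<^esub> \<oplus>\<^bsub>UT.T\<^esub> t (\<beta> (x \<otimes>\<^bsub>A\<^esub> x')) (\<alpha> (y \<otimes>\<^bsub>A\<^esub> y')) \<one>\<^bsub>U\<^esub>)
     (t (\<alpha> (x \<otimes>\<^bsub>A\<^esub> x')) (\<ominus>\<^bsub>U\<^esub> \<alpha> (br y y')) \<one>\<^bsub>U\<^esub> \<oplus>\<^bsub>UT.T\<^esub> t (\<alpha> (br x x')) (\<alpha> (y \<otimes>\<^bsub>A\<^esub> y')) \<one>\<^bsub>U\<^esub>)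
     (t (\<alpha> (x \<otimes>\<^bsub>A\<^esub> x')) (\<ominus>\<^bsub>U\<^esub> \<beta> (br y y')) \<one>\<^bsub>U\<^esub> \<oplus>\<^bsub>UT.T\<^esub> t (\<beta> (x \<otimes>\<^bsub>A\<^esub> x')) (\<ominus>\<^bsub>U\<^esub> \<alpha> (br y y')) \<one>\<^bsub>U\<^esub>
       \<oplus>\<^bsub>UT.T\<^esub> t (\<alpha> (br x x')) (\<beta> (y \<otimes>\<^bsub>A\<^esub> y')) \<one>\<^bsub>U\<^esub> \<oplus>\<^bsub>UT.T\<^esub> t (\<beta> (br x x')) (\<alpha> (y \<otimes>\<^bsub>A\<^esub> y')) \<one>\<^bsub>U\<^esub>)"
    using TU.pair_relations_prod[OF p1 p2] c by (simp add: t_mult)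
  \<comment> \<open>The negations inherited from the opposite algebra are still inside the middle
    slot; \<open>t_neg2\<close> pulls them out to meet the subtracted term of
    \<open>tb_pure\<close>.\<close>
  show ?thesis
    using TU.pair_relations_prod[OF p12 p3] c
    by (simp add: t_mult X_def Y_def \<gamma>_pure \<xi>_pure TU_distrib s_mult tb_pure
      lin_hom_add[OF alg_hom_lin[OF \<gamma>_hom], unfolded tensor_algebra_simps]
      lin_hom_minus[OF AT.T.module_axioms UT.T.module_axioms alg_hom_lin[OF \<gamma>_hom, unfolded tensor_algebra_simps]]
      lin_hom_add[OF \<xi>_lin] lin_hom_minus[OF AT.T.module_axioms UT.T.module_axioms \<xi>_lin])
      (simp add: t_neg2 a_minus_def UT.T.M.minus_add UT.T.M.a_ac)
qed

text \<open>Each defining equation of a pair is bilinear in X and Y, so the case of pure tensors,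
  \<open>pair_relations_triple\<close>, is enough. Composed with \<mu>, this is the pair to which
  the universal property of \<open>U\<close> is applied.\<close>

lemma triple_pair: "enveloping_pair K AT.TA tb UT.TA \<gamma> \<xi>"
proof -
  have eq: "\<xi> (tb X Y) = commutator UT.TA (\<xi> X) (\<xi> Y) \<and> \<gamma> (tb X Y) = commutator UT.TA (\<xi> X) (\<gamma> Y) \<and>
      \<xi> (X \<otimes>\<^bsub>AT.TA\<^esub> Y) = \<gamma> X \<otimes>\<^bsub>UT.TA\<^esub> \<xi> Y \<oplus>\<^bsub>UT.TA\<^esub> \<gamma> Y \<otimes>\<^bsub>UT.TA\<^esub> \<xi> X"
    if X: "X \<in> carrier AT.T" and Y: "Y \<in> carrier AT.T" for X Y
  proof (intro conjI)
    have \<gamma>: "\<gamma> \<in> lin_hom K AT.T UT.TA" and \<xi>: "\<xi> \<in> lin_hom K AT.T UT.TA"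
      using alg_hom_lin[OF \<gamma>_hom] \<xi>_lin by simp_all
    note m = k_algebra_module[OF UT.tensor_algebra]
    note tf = AT.tensor_factors AT.tensor_factors m
    note cb = commutator_bilinear[OF UT.tensor_algebra] and mb = k_algebra_mult_bilinear[OF UT.tensor_algebra]
    have *: "\<exists>x\<in>carrier A. \<exists>y\<in>carrier A. \<exists>z\<in>carrier A. xs = [x, y, z]" if "xs \<in> words (triple A)" for xs
      using that by (simp add: words3)
    have p: "\<xi> (tb X Y) = commutator UT.TA (\<xi> X) (\<xi> Y)" "\<gamma> (tb X Y) = commutator UT.TA (\<xi> X) (\<gamma> Y)"
      "\<xi> (X \<otimes>\<^bsub>AT.TA\<^esub> Y) = \<gamma> X \<otimes>\<^bsub>UT.TA\<^esub> \<xi> Y \<oplus>\<^bsub>UT.TA\<^esub> \<gamma> Y \<otimes>\<^bsub>UT.TA\<^esub> \<xi> X"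
      if xs: "xs \<in> words (triple A)" "X = pure_tensor K (triple A) xs"
        and ys: "ys \<in> words (triple A)" "Y = pure_tensor K (triple A) ys" for xs ys X Y
    proof -
      have "pair_relations UT.TA (\<gamma> X) (\<xi> X) (\<gamma> Y) (\<xi> Y) (\<gamma> (X \<otimes>\<^bsub>AT.TA\<^esub> Y)) (\<xi> (X \<otimes>\<^bsub>AT.TA\<^esub> Y)) (\<gamma> (tb X Y)) (\<xi> (tb X Y))"
        using *[OF xs(1)] *[OF ys(1)] pair_relations_triple unfolding xs(2) ys(2) by blast
      then show "\<xi> (tb X Y) = commutator UT.TA (\<xi> X) (\<xi> Y)" "\<gamma> (tb X Y) = commutator UT.TA (\<xi> X) (\<gamma> Y)"
        "\<xi> (X \<otimes>\<^bsub>AT.TA\<^esub> Y) = \<gamma> X \<otimes>\<^bsub>UT.TA\<^esub> \<xi> Y \<oplus>\<^bsub>UT.TA\<^esub> \<gamma> Y \<otimes>\<^bsub>UT.TA\<^esub> \<xi> X"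
        unfolding pair_relations_def commutator_def
        by (auto simp only: insert_subset TU.plus_minus_cancel' TU.m_closed)
    qed
    show "\<xi> (tb X Y) = commutator UT.TA (\<xi> X) (\<xi> Y)"
      using bilinear_compose[OF tb_bilinear \<xi>] bilinear_args[OF cb \<xi> \<xi>] p(1) X Y
      by (rule bilinear_tensor_eqI[OF tf]) auto
    show "\<gamma> (tb X Y) = commutator UT.TA (\<xi> X) (\<gamma> Y)"
      using bilinear_compose[OF tb_bilinear \<gamma>] bilinear_args[OF cb \<xi> \<gamma>] p(2) X Y
      by (rule bilinear_tensor_eqI[OF tf]) auto
    show "\<xi> (X \<otimes>\<^bsub>AT.TA\<^esub> Y) = \<gamma> X \<otimes>\<^bsub>UT.TA\<^esub> \<xi> Y \<oplus>\<^bsub>UT.TA\<^esub> \<gamma> Y \<otimes>\<^bsub>UT.TA\<^esub> \<xi> X"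
      using bilinear_compose[OF AT.mult_bilinear \<xi>]
        bilinear_plus[OF m bilinear_args[OF mb \<gamma> \<xi>] bilinear_flip[OF bilinear_args[OF mb \<gamma> \<xi>]]] p(3) X Y
      by (rule bilinear_tensor_eqI[OF tf]) auto
  qed
  then show ?thesis
    unfolding enveloping_pair_def using \<gamma>_hom \<xi>_lin by simp
qed

end

section \<open>The Hopf-Galois axioms\<close>

abbreviation quintuple :: "('k, 'a) module \<Rightarrow> ('k, 'a) module list" where
  "quintuple R \<equiv> [R, op_alg R, R, op_alg R, R]"

text \<open>This definition and the next three name the maps that are local to the definition of a
  Hopf-Galois algebra, so that lemmas can speak about them.\<close>

definition \<mu>_id_id where
  "\<mu>_id_id K R \<mu> = tensor_lift3 K (tensor_space K (quintuple R))
     (\<lambda>x y z. tensor_append K (quintuple R) (\<mu> x) (pure_tensor K [op_alg R, R] [y, z]))"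

definition id_id_\<mu> where
  "id_id_\<mu> K R \<mu> = tensor_lift3 K (tensor_space K (quintuple R))
     (\<lambda>x y z. tensor_append K (quintuple R) (pure_tensor K [R, op_alg R] [x, y]) (\<mu> z))"

definition m_id where
  "m_id K R = tensor_lift3 K (tensor_space K [R, R]) (\<lambda>x y z. pure_tensor K [R, R] [x \<otimes>\<^bsub>R\<^esub> y, z])"

definition id_m where
  "id_m K R = tensor_lift3 K (tensor_space K [R, R]) (\<lambda>x y z. pure_tensor K [R, R] [x, y \<otimes>\<^bsub>R\<^esub> z])"

lemma hopf_galois_algebra_iff:
  "hopf_galois_algebra K R \<mu> \<longleftrightarrow> k_algebra K R \<and> carrier R \<noteq> {\<zero>\<^bsub>R\<^esub>} \<and>
     \<mu> \<in> alg_hom K R (tensor_algebra K (triple R)) \<and>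
     (\<forall>r\<in>carrier R. \<mu>_id_id K R \<mu> (\<mu> r) = id_id_\<mu> K R \<mu> (\<mu> r)) \<and>
     (\<forall>r\<in>carrier R. m_id K R (\<mu> r) = pure_tensor K [R, R] [\<one>\<^bsub>R\<^esub>, r]) \<and>
     (\<forall>r\<in>carrier R. id_m K R (\<mu> r) = pure_tensor K [R, R] [r, \<one>\<^bsub>R\<^esub>])"
  unfolding hopf_galois_algebra_def \<mu>_id_id_def id_id_\<mu>_def m_id_def id_m_def Let_def by blast

context
  fixes K :: "'k ring" and R :: "('k, 'a) module"
  assumes R: "k_algebra K R"
begin

interpretation R: ring R by (rule k_algebra_ring[OF R])
interpretation R3: algebra_factors K "triple R" by (rule algebra_factors_triple[OF R])
interpretation R2: algebra_factors K "[R, R]"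
  by (rule algebra_factorsI[OF k_algebra_field[OF R]]) (use R in auto)
interpretation RO: algebra_factors K "[R, op_alg R]"
  by (rule algebra_factorsI[OF k_algebra_field[OF R]]) (use R k_algebra_op in auto)
interpretation OR: algebra_factors K "[op_alg R, R]"
  by (rule algebra_factorsI[OF k_algebra_field[OF R]]) (use R k_algebra_op in auto)
interpretation R5: algebra_factors K "quintuple R"
  by (rule algebra_factorsI[OF k_algebra_field[OF R]]) (use R k_algebra_op in auto)

lemma append_32_bilinear: "bilinear K R3.T OR.T R5.T (tensor_append K (quintuple R))"
  using tensor_append_bilinear[OF R3.tensor_factors OR.tensor_factors] by simp

lemma append_23_bilinear: "bilinear K RO.T R3.T R5.T (tensor_append K (quintuple R))"
  using tensor_append_bilinear[OF RO.tensor_factors R3.tensor_factors] by simp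

lemma
  shows m_id_lin: "m_id K R \<in> lin_hom K R3.T R2.T"
    and m_id_pure: "\<And>x y z. x \<in> carrier R \<Longrightarrow> y \<in> carrier R \<Longrightarrow> z \<in> carrier R \<Longrightarrow>
      m_id K R (pure_tensor K (triple R) [x, y, z]) = pure_tensor K [R, R] [x \<otimes>\<^bsub>R\<^esub> y, z]"
    and id_m_lin: "id_m K R \<in> lin_hom K R3.T R2.T"
    and id_m_pure: "\<And>x y z. x \<in> carrier R \<Longrightarrow> y \<in> carrier R \<Longrightarrow> z \<in> carrier R \<Longrightarrow>
      id_m K R (pure_tensor K (triple R) [x, y, z]) = pure_tensor K [R, R] [x, y \<otimes>\<^bsub>R\<^esub> z]"
proof -
  note lin = pure2_lin1[OF R2.tensor_factors] pure2_lin2[OF R2.tensor_factors] lin_hom_ident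
    mult_lin_left[OF R] mult_lin_right[OF R] R.m_closed
  have 1: "multilinear K (triple R) R2.T (\<lambda>xs. pure_tensor K [R, R] [xs ! 0 \<otimes>\<^bsub>R\<^esub> xs ! 1, xs ! 2])"
    by (rule multilinear3I; simp only: lin_hom_op op_alg_simps; intro lin)
  have 2: "multilinear K (triple R) R2.T (\<lambda>xs. pure_tensor K [R, R] [xs ! 0, xs ! 1 \<otimes>\<^bsub>R\<^esub> xs ! 2])"
    by (rule multilinear3I; simp only: lin_hom_op op_alg_simps; intro lin)
  note m = R2.T.module_axioms
  show "m_id K R \<in> lin_hom K R3.T R2.T" "id_m K R \<in> lin_hom K R3.T R2.T"
    unfolding m_id_def id_m_def tensor_lift3_def by (rule R3.lift_lin[OF m 1] R3.lift_lin[OF m 2])+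
  fix x y z assume "x \<in> carrier R" "y \<in> carrier R" "z \<in> carrier R"
  then show "m_id K R (pure_tensor K (triple R) [x, y, z]) = pure_tensor K [R, R] [x \<otimes>\<^bsub>R\<^esub> y, z]"
    "id_m K R (pure_tensor K (triple R) [x, y, z]) = pure_tensor K [R, R] [x, y \<otimes>\<^bsub>R\<^esub> z]"
    unfolding m_id_def id_m_def tensor_lift3_def
    using R3.lift_pure[OF m 1, of "[x, y, z]"] R3.lift_pure[OF m 2, of "[x, y, z]"] by simp_all
qed

lemma
  assumes \<mu>: "\<mu> \<in> lin_hom K R R3.T"
  shows \<mu>_id_id_lin: "\<mu>_id_id K R \<mu> \<in> lin_hom K R3.T R5.T"
    and \<mu>_id_id_pure: "\<And>x y z. x \<in> carrier R \<Longrightarrow> y \<in> carrier R \<Longrightarrow> z \<in> carrier R \<Longrightarrow>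
      \<mu>_id_id K R \<mu> (pure_tensor K (triple R) [x, y, z]) =
      tensor_append K (quintuple R) (\<mu> x) (pure_tensor K [op_alg R, R] [y, z])"
    and id_id_\<mu>_lin: "id_id_\<mu> K R \<mu> \<in> lin_hom K R3.T R5.T"
    and id_id_\<mu>_pure: "\<And>x y z. x \<in> carrier R \<Longrightarrow> y \<in> carrier R \<Longrightarrow> z \<in> carrier R \<Longrightarrow>
      id_id_\<mu> K R \<mu> (pure_tensor K (triple R) [x, y, z]) =
      tensor_append K (quintuple R) (pure_tensor K [R, op_alg R] [x, y]) (\<mu> z)"
proof -
  note c32 = lin_hom_compose[OF _ bilinear_left[OF append_32_bilinear]]
    lin_hom_compose[OF _ bilinear_right[OF append_32_bilinear]]
  note c23 = lin_hom_compose[OF _ bilinear_left[OF append_23_bilinear]]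
    lin_hom_compose[OF _ bilinear_right[OF append_23_bilinear]]
  note OR_lin = pure2_lin1[OF OR.tensor_factors, OF lin_hom_ident] pure2_lin2[OF OR.tensor_factors, OF _ lin_hom_ident]
  note RO_lin = pure2_lin1[OF RO.tensor_factors, OF lin_hom_ident] pure2_lin2[OF RO.tensor_factors, OF _ lin_hom_ident]
  note cl = lin_hom_closed[OF \<mu>]
  have w: "[y, z] \<in> words [op_alg R, R]" "[y, z] \<in> words [R, op_alg R]"
    if "y \<in> carrier R" "z \<in> carrier R" for y z
    using that by simp_all
  have 1: "multilinear K (triple R) R5.T (\<lambda>xs. tensor_append K (quintuple R) (\<mu> (xs ! 0)) (pure_tensor K [op_alg R, R] [xs ! 1, xs ! 2]))"
    by (rule multilinear3I)
      (use c32(1)[OF \<mu> OR.pure_closed[OF w(1)]] c32(2)[OF OR_lin(1) cl] c32(2)[OF OR_lin(2) cl] in auto)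
  have 2: "multilinear K (triple R) R5.T (\<lambda>xs. tensor_append K (quintuple R) (pure_tensor K [R, op_alg R] [xs ! 0, xs ! 1]) (\<mu> (xs ! 2)))"
    by (rule multilinear3I)
      (use c23(2)[OF \<mu> RO.pure_closed[OF w(2)]] c23(1)[OF RO_lin(1) cl] c23(1)[OF RO_lin(2) cl] in auto)
  note m = R5.T.module_axioms
  show "\<mu>_id_id K R \<mu> \<in> lin_hom K R3.T R5.T" "id_id_\<mu> K R \<mu> \<in> lin_hom K R3.T R5.T"
    unfolding \<mu>_id_id_def id_id_\<mu>_def tensor_lift3_def by (rule R3.lift_lin[OF m 1] R3.lift_lin[OF m 2])+
  fix x y z assume "x \<in> carrier R" "y \<in> carrier R" "z \<in> carrier R"
  then show "\<mu>_id_id K R \<mu> (pure_tensor K (triple R) [x, y, z]) =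
      tensor_append K (quintuple R) (\<mu> x) (pure_tensor K [op_alg R, R] [y, z])"
    "id_id_\<mu> K R \<mu> (pure_tensor K (triple R) [x, y, z]) =
      tensor_append K (quintuple R) (pure_tensor K [R, op_alg R] [x, y]) (\<mu> z)"
    unfolding \<mu>_id_id_def id_id_\<mu>_def tensor_lift3_def
    using R3.lift_pure[OF m 1, of "[x, y, z]"] R3.lift_pure[OF m 2, of "[x, y, z]"] by simp_all
qed

text \<open>The alternating opposites let \<open>quintuple R\<close> be read both as
  \<open>triple R @ [op_alg R, R]\<close> and as \<open>[R, op_alg R] @ triple R\<close>. Hence both
  maps land in the same algebra, and they are multiplicative because \<mu> and concatenation
  are.\<close>

lemma
  assumes \<mu>: "\<mu> \<in> alg_hom K R R3.TA"
  shows \<mu>_id_id_hom: "\<mu>_id_id K R \<mu> \<in> alg_hom K R3.TA R5.TA"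
    and id_id_\<mu>_hom: "id_id_\<mu> K R \<mu> \<in> alg_hom K R3.TA R5.TA"
proof -
  have l: "\<mu> \<in> lin_hom K R R3.T" using alg_hom_lin[OF \<mu>] by simp
  note p = \<mu>_id_id_pure[OF l] id_id_\<mu>_pure[OF l] and cl = lin_hom_closed[OF l]
  have one: "\<mu> \<one>\<^bsub>R\<^esub> = pure_tensor K (triple R) [\<one>\<^bsub>R\<^esub>, \<one>\<^bsub>R\<^esub>, \<one>\<^bsub>R\<^esub>]"
    using alg_hom_one[OF \<mu>] by simp
  have OR: "pure_tensor K [op_alg R, R] [y' \<otimes>\<^bsub>R\<^esub> y, z \<otimes>\<^bsub>R\<^esub> z'] =
      pure_tensor K [op_alg R, R] [y, z] \<otimes>\<^bsub>OR.TA\<^esub> pure_tensor K [op_alg R, R] [y', z']"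
    if "y \<in> carrier R" "y' \<in> carrier R" "z \<in> carrier R" "z' \<in> carrier R" for y y' z z'
    using OR.mult_pure[of "[y, z]" "[y', z']"] that by (simp add: word_mult_def)
  have RO: "pure_tensor K [R, op_alg R] [z \<otimes>\<^bsub>R\<^esub> z', y' \<otimes>\<^bsub>R\<^esub> y] =
      pure_tensor K [R, op_alg R] [z, y] \<otimes>\<^bsub>RO.TA\<^esub> pure_tensor K [R, op_alg R] [z', y']"
    if "y \<in> carrier R" "y' \<in> carrier R" "z \<in> carrier R" "z' \<in> carrier R" for y y' z z'
    using RO.mult_pure[of "[z, y]" "[z', y']"] that by (simp add: word_mult_def)
  have w: "pure_tensor K [op_alg R, R] [y, z] \<in> carrier OR.T" "pure_tensor K [R, op_alg R] [y, z] \<in> carrier RO.T"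
    if "y \<in> carrier R" "z \<in> carrier R" for y z
    using that OR.pure_closed[of "[y, z]"] RO.pure_closed[of "[y, z]"] by simp_all
  note af = R3.algebra_factors_axioms
  note am = tensor_append_mult[OF R3.algebra_factors_axioms OR.algebra_factors_axioms]
    tensor_append_mult[OF RO.algebra_factors_axioms R3.algebra_factors_axioms]
  show "\<mu>_id_id K R \<mu> \<in> alg_hom K R3.TA R5.TA"
  proof (rule tensor_alg_homI[OF af R5.tensor_algebra])
    show "\<mu>_id_id K R \<mu> \<in> lin_hom K R3.T R5.TA" using \<mu>_id_id_lin[OF l] by simp
    show "\<mu>_id_id K R \<mu> (pure_tensor K (triple R) (map one (triple R))) = \<one>\<^bsub>R5.TA\<^esub>"
      using tensor_append_pure[OF R3.tensor_factors OR.tensor_factors, of "[\<one>\<^bsub>R\<^esub>, \<one>\<^bsub>R\<^esub>, \<one>\<^bsub>R\<^esub>]" "[\<one>\<^bsub>R\<^esub>, \<one>\<^bsub>R\<^esub>]"]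
      by (simp add: p one)
    fix xs ys assume "xs \<in> words (triple R)" "ys \<in> words (triple R)"
    then show "\<mu>_id_id K R \<mu> (pure_tensor K (triple R) (word_mult (triple R) xs ys)) =
        \<mu>_id_id K R \<mu> (pure_tensor K (triple R) xs) \<otimes>\<^bsub>R5.TA\<^esub> \<mu>_id_id K R \<mu> (pure_tensor K (triple R) ys)"
      using am(1)[OF cl cl w(1) w(1)] by (auto simp: words3 word_mult_def p OR alg_hom_mult[OF \<mu>])
  qed
  show "id_id_\<mu> K R \<mu> \<in> alg_hom K R3.TA R5.TA"
  proof (rule tensor_alg_homI[OF af R5.tensor_algebra])
    show "id_id_\<mu> K R \<mu> \<in> lin_hom K R3.T R5.TA" using id_id_\<mu>_lin[OF l] by simp
    show "id_id_\<mu> K R \<mu> (pure_tensor K (triple R) (map one (triple R))) = \<one>\<^bsub>R5.TA\<^esub>"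
      using tensor_append_pure[OF RO.tensor_factors R3.tensor_factors, of "[\<one>\<^bsub>R\<^esub>, \<one>\<^bsub>R\<^esub>]" "[\<one>\<^bsub>R\<^esub>, \<one>\<^bsub>R\<^esub>, \<one>\<^bsub>R\<^esub>]"]
      by (simp add: p one)
    fix xs ys assume "xs \<in> words (triple R)" "ys \<in> words (triple R)"
    then show "id_id_\<mu> K R \<mu> (pure_tensor K (triple R) (word_mult (triple R) xs ys)) =
        id_id_\<mu> K R \<mu> (pure_tensor K (triple R) xs) \<otimes>\<^bsub>R5.TA\<^esub> id_id_\<mu> K R \<mu> (pure_tensor K (triple R) ys)"
      using am(2)[OF w(2) w(2) cl cl] by (auto simp: words3 word_mult_def p RO alg_hom_mult[OF \<mu>])
  qed
qed

end

lemma
  assumes M: "k_algebra K M" and N: "k_algebra K N" and f: "f \<in> lin_hom K M N" and g: "g \<in> lin_hom K M N"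
  shows map2_lin: "tensor_map K [N, N] [f, g] \<in> lin_hom K (tensor_space K [M, M]) (tensor_space K [N, N])"
    and map2_pure: "\<And>x y. x \<in> carrier M \<Longrightarrow> y \<in> carrier M \<Longrightarrow>
      tensor_map K [N, N] [f, g] (pure_tensor K [M, M] [x, y]) = pure_tensor K [N, N] [f x, g y]"
proof -
  interpret M2: algebra_factors K "[M, M]"
    by (rule algebra_factorsI[OF k_algebra_field[OF M]]) (use M in auto)
  interpret N2: algebra_factors K "[N, N]"
    by (rule algebra_factorsI[OF k_algebra_field[OF N]]) (use N in auto)
  have l: "[f, g] ! i \<in> lin_hom K ([M, M] ! i) ([N, N] ! i)" if "i < length [M, M]" for i
    using that f g by (auto simp: less_Suc_eq)
  note tf = M2.tensor_factors N2.tensor_factors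
  show "tensor_map K [N, N] [f, g] \<in> lin_hom K M2.T N2.T"
    by (rule tensor_map_lin[OF tf _ _ l]) simp_all
  show "tensor_map K [N, N] [f, g] (pure_tensor K [M, M] [x, y]) = pure_tensor K [N, N] [f x, g y]"
    if "x \<in> carrier M" "y \<in> carrier M" for x y
    using tensor_map_pure[OF tf _ _ l, of "[x, y]"] that by simp
qed

text \<open>
  \<open>m \<otimes> id\<close> is not multiplicative on \<open>R \<otimes> R\<^sup>o\<^sup>p \<otimes> R\<close>. The hypothesis on one factor is what makes the
  elements satisfying the unit axiom closed under products.
\<close>

lemma m_id_mult:
  assumes R: "k_algebra K R" and X: "X \<in> carrier (tensor_space K (triple R))"
    and Y: "Y \<in> carrier (tensor_space K (triple R))" and u: "u \<in> carrier R"
    and mY: "m_id K R Y = pure_tensor K [R, R] [\<one>\<^bsub>R\<^esub>, u]"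
  shows "m_id K R (X \<otimes>\<^bsub>tensor_algebra K (triple R)\<^esub> Y) =
    tensor_map K [R, R] [\<lambda>x. x, \<lambda>x. x \<otimes>\<^bsub>R\<^esub> u] (m_id K R X)"
proof -
  interpret R: ring R by (rule k_algebra_ring[OF R])
  interpret R3: algebra_factors K "triple R" by (rule algebra_factors_triple[OF R])
  interpret R2: algebra_factors K "[R, R]"
    by (rule algebra_factorsI[OF k_algebra_field[OF R]]) (use R in auto)
  note b = R3.mult_bilinear and l = m_id_lin[OF R] and m = R2.T.module_axioms
  note ru = map2_lin[OF R R lin_hom_ident mult_lin_left[OF R lin_hom_ident u]]
    map2_pure[OF R R lin_hom_ident mult_lin_left[OF R lin_hom_ident u]]
  show ?thesis
    using m lin_hom_compose[OF bilinear_left[OF b Y] l] lin_hom_compose[OF l ru(1)] _ X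
  proof (rule R3.tensor_eqI)
    fix xs assume "xs \<in> words (triple R)"
    then obtain x y z where xs: "xs = [x, y, z]" and c: "x \<in> carrier R" "y \<in> carrier R" "z \<in> carrier R"
      by (auto simp: words3)
    have px: "pure_tensor K (triple R) [x, y, z] \<in> carrier R3.T" using c by (intro R3.pure_closed) simp
    \<comment> \<open>For pure X = x (x) y (x) z the opposite product in the middle slot turns w1
      (x) w2 (x) w3 into x w1 (x) w2 y (x) z w3. Multiplying the first two slots gives x (w1 w2) y,
      so the result depends on Y only through \<open>m_id K R Y\<close>; for 1 (x) u it is xy (x)
      zu.\<close>
    have f: "(\<lambda>w. x \<otimes>\<^bsub>R\<^esub> w \<otimes>\<^bsub>R\<^esub> y) \<in> lin_hom K R R" "(\<lambda>w. z \<otimes>\<^bsub>R\<^esub> w) \<in> lin_hom K R R"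
      by (intro mult_lin_left[OF R] mult_lin_right[OF R] lin_hom_ident c)+
    have "m_id K R (pure_tensor K (triple R) [x, y, z] \<otimes>\<^bsub>R3.TA\<^esub> Y) =
        tensor_map K [R, R] [\<lambda>w. x \<otimes>\<^bsub>R\<^esub> w \<otimes>\<^bsub>R\<^esub> y, \<lambda>w. z \<otimes>\<^bsub>R\<^esub> w] (m_id K R Y)"
      using m lin_hom_compose[OF bilinear_right[OF b px] l] lin_hom_compose[OF l map2_lin[OF R R f]] _ Y
    proof (rule R3.tensor_eqI)
      fix ys assume "ys \<in> words (triple R)"
      then show "m_id K R (pure_tensor K (triple R) [x, y, z] \<otimes>\<^bsub>R3.TA\<^esub> pure_tensor K (triple R) ys) =
          tensor_map K [R, R] [\<lambda>w. x \<otimes>\<^bsub>R\<^esub> w \<otimes>\<^bsub>R\<^esub> y, \<lambda>w. z \<otimes>\<^bsub>R\<^esub> w] (m_id K R (pure_tensor K (triple R) ys))"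
        using c by (auto simp: words3 R3.mult_pure word_mult_def m_id_pure[OF R] map2_pure[OF R R f] R.m_assoc)
    qed
    then show "m_id K R (pure_tensor K (triple R) xs \<otimes>\<^bsub>R3.TA\<^esub> Y) =
        tensor_map K [R, R] [\<lambda>x. x, \<lambda>x. x \<otimes>\<^bsub>R\<^esub> u] (m_id K R (pure_tensor K (triple R) xs))"
      using c u by (simp add: xs mY map2_pure[OF R R f] m_id_pure[OF R] ru(2))
  qed
qed

text \<open>Mirror image of \<open>m_id_mult\<close>. With a pure right factor x (x) y (x) z, the
  last two slots of the product multiply to y (w2 w3) z, so now the left factor enters only through
  its image under \<open>id_m\<close>, and the hypothesis is placed on it.\<close>

lemma id_m_mult:
  assumes R: "k_algebra K R" and X: "X \<in> carrier (tensor_space K (triple R))"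
    and Y: "Y \<in> carrier (tensor_space K (triple R))" and u: "u \<in> carrier R"
    and mX: "id_m K R X = pure_tensor K [R, R] [u, \<one>\<^bsub>R\<^esub>]"
  shows "id_m K R (X \<otimes>\<^bsub>tensor_algebra K (triple R)\<^esub> Y) =
    tensor_map K [R, R] [\<lambda>x. u \<otimes>\<^bsub>R\<^esub> x, \<lambda>x. x] (id_m K R Y)"
proof -
  interpret R: ring R by (rule k_algebra_ring[OF R])
  interpret R3: algebra_factors K "triple R" by (rule algebra_factors_triple[OF R])
  interpret R2: algebra_factors K "[R, R]"
    by (rule algebra_factorsI[OF k_algebra_field[OF R]]) (use R in auto)
  note b = R3.mult_bilinear and l = id_m_lin[OF R] and m = R2.T.module_axioms
  note ru = map2_lin[OF R R mult_lin_right[OF R u lin_hom_ident] lin_hom_ident]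
    map2_pure[OF R R mult_lin_right[OF R u lin_hom_ident] lin_hom_ident]
  show ?thesis
    using m lin_hom_compose[OF bilinear_right[OF b X] l] lin_hom_compose[OF l ru(1)] _ Y
  proof (rule R3.tensor_eqI)
    fix ys assume "ys \<in> words (triple R)"
    then obtain x y z where ys: "ys = [x, y, z]" and c: "x \<in> carrier R" "y \<in> carrier R" "z \<in> carrier R"
      by (auto simp: words3)
    have py: "pure_tensor K (triple R) [x, y, z] \<in> carrier R3.T" using c by (intro R3.pure_closed) simp
    have f: "(\<lambda>w. w \<otimes>\<^bsub>R\<^esub> x) \<in> lin_hom K R R" "(\<lambda>w. y \<otimes>\<^bsub>R\<^esub> w \<otimes>\<^bsub>R\<^esub> z) \<in> lin_hom K R R"
      by (intro mult_lin_left[OF R] mult_lin_right[OF R] lin_hom_ident c)+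
    have "id_m K R (X \<otimes>\<^bsub>R3.TA\<^esub> pure_tensor K (triple R) [x, y, z]) =
        tensor_map K [R, R] [\<lambda>w. w \<otimes>\<^bsub>R\<^esub> x, \<lambda>w. y \<otimes>\<^bsub>R\<^esub> w \<otimes>\<^bsub>R\<^esub> z] (id_m K R X)"
      using m lin_hom_compose[OF bilinear_left[OF b py] l] lin_hom_compose[OF l map2_lin[OF R R f]] _ X
    proof (rule R3.tensor_eqI)
      fix xs assume "xs \<in> words (triple R)"
      then show "id_m K R (pure_tensor K (triple R) xs \<otimes>\<^bsub>R3.TA\<^esub> pure_tensor K (triple R) [x, y, z]) =
          tensor_map K [R, R] [\<lambda>w. w \<otimes>\<^bsub>R\<^esub> x, \<lambda>w. y \<otimes>\<^bsub>R\<^esub> w \<otimes>\<^bsub>R\<^esub> z] (id_m K R (pure_tensor K (triple R) xs))"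
        using c by (auto simp: words3 R3.mult_pure word_mult_def id_m_pure[OF R] map2_pure[OF R R f] R.m_assoc)
    qed
    then show "id_m K R (X \<otimes>\<^bsub>R3.TA\<^esub> pure_tensor K (triple R) ys) =
        tensor_map K [R, R] [\<lambda>x. u \<otimes>\<^bsub>R\<^esub> x, \<lambda>x. x] (id_m K R (pure_tensor K (triple R) ys))"
      using c u by (simp add: ys mX map2_pure[OF R R f] id_m_pure[OF R] ru(2))
  qed
qed

section \<open>Endomorphism algebras\<close>

text \<open>Members are fixed outside the carrier, so that equality of functions is equality of
  endomorphisms; every operation restricts its result accordingly.\<close>

definition lin_endo :: "'k ring \<Rightarrow> ('k, 'a) module \<Rightarrow> ('k, 'a \<Rightarrow> 'a) module" where
  "lin_endo K M = \<lparr>carrier = lin_hom K M M \<inter> extensional (carrier M),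
     mult = (\<lambda>f g. \<lambda>x\<in>carrier M. f (g x)), one = (\<lambda>x\<in>carrier M. x),
     zero = (\<lambda>x\<in>carrier M. \<zero>\<^bsub>M\<^esub>), add = (\<lambda>f g. \<lambda>x\<in>carrier M. f x \<oplus>\<^bsub>M\<^esub> g x),
     smult = (\<lambda>c f. \<lambda>x\<in>carrier M. c \<odot>\<^bsub>M\<^esub> f x)\<rparr>"

lemma lin_endo_simps [simp]:
  "\<one>\<^bsub>lin_endo K M\<^esub> = (\<lambda>x\<in>carrier M. x)" "\<zero>\<^bsub>lin_endo K M\<^esub> = (\<lambda>x\<in>carrier M. \<zero>\<^bsub>M\<^esub>)"
  "f \<otimes>\<^bsub>lin_endo K M\<^esub> g = (\<lambda>x\<in>carrier M. f (g x))"
  "f \<oplus>\<^bsub>lin_endo K M\<^esub> g = (\<lambda>x\<in>carrier M. f x \<oplus>\<^bsub>M\<^esub> g x)"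
  "c \<odot>\<^bsub>lin_endo K M\<^esub> f = (\<lambda>x\<in>carrier M. c \<odot>\<^bsub>M\<^esub> f x)"
  by (simp_all add: lin_endo_def)

context
  fixes K :: "'k ring" and M :: "('k, 'a) module"
  assumes K: "field K" and M: "module K M"
begin

interpretation M: module K M by (rule M)

lemma restrict_in_lin_endo: "f \<in> lin_hom K M M \<Longrightarrow> restrict f (carrier M) \<in> carrier (lin_endo K M)"
  by (auto simp: lin_endo_def lin_hom_def Pi_def)

lemma
  assumes "f \<in> carrier (lin_endo K M)"
  shows lin_endo_lin: "f \<in> lin_hom K M M" and lin_endo_extensional: "f \<in> extensional (carrier M)"
  using assms by (simp_all add: lin_endo_def)

lemma lin_endo_closed: "f \<in> carrier (lin_endo K M) \<Longrightarrow> x \<in> carrier M \<Longrightarrow> f x \<in> carrier M"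
  by (rule lin_hom_closed[OF lin_endo_lin])

lemma lin_endo_eqI:
  "f \<in> carrier (lin_endo K M) \<Longrightarrow> g \<in> carrier (lin_endo K M) \<Longrightarrow>
    (\<And>x. x \<in> carrier M \<Longrightarrow> f x = g x) \<Longrightarrow> f = g"
  using extensionalityI[OF lin_endo_extensional lin_endo_extensional] by blast

lemma lin_endo_ops_closed:
  assumes f: "f \<in> carrier (lin_endo K M)" and g: "g \<in> carrier (lin_endo K M)" and c: "c \<in> carrier K"
  shows "f \<oplus>\<^bsub>lin_endo K M\<^esub> g \<in> carrier (lin_endo K M)" "f \<otimes>\<^bsub>lin_endo K M\<^esub> g \<in> carrier (lin_endo K M)"
    "c \<odot>\<^bsub>lin_endo K M\<^esub> f \<in> carrier (lin_endo K M)"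
  unfolding lin_endo_simps
  by (intro restrict_in_lin_endo lin_hom_plus[OF M] lin_hom_scale[OF M _ c] lin_endo_lin f g
      lin_hom_compose[OF lin_endo_lin[OF g] lin_endo_lin[OF f]])+

lemma lin_endo_one_closed: "\<one>\<^bsub>lin_endo K M\<^esub> \<in> carrier (lin_endo K M)"
  unfolding lin_endo_simps by (intro restrict_in_lin_endo lin_hom_ident)

lemma lin_endo_neg:
  assumes f: "f \<in> carrier (lin_endo K M)"
  shows "(\<lambda>x\<in>carrier M. \<ominus>\<^bsub>M\<^esub> f x) \<in> carrier (lin_endo K M)"
  by (intro restrict_in_lin_endo lin_hom_neg[OF M] lin_endo_lin f)

lemma module_lin_endo: "module K (lin_endo K M)"
proof (rule moduleI)
  show "abelian_group (lin_endo K M)"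
  proof (rule abelian_groupI)
    have "(\<lambda>x. \<zero>\<^bsub>M\<^esub>) \<in> lin_hom K M M" by (rule lin_homI) auto
    then show "\<zero>\<^bsub>lin_endo K M\<^esub> \<in> carrier (lin_endo K M)"
      unfolding lin_endo_simps by (rule restrict_in_lin_endo)
    fix f assume f: "f \<in> carrier (lin_endo K M)"
    show "\<zero>\<^bsub>lin_endo K M\<^esub> \<oplus>\<^bsub>lin_endo K M\<^esub> f = f"
      using f \<open>\<zero>\<^bsub>lin_endo K M\<^esub> \<in> carrier (lin_endo K M)\<close> M.R.zero_closed
      by (intro lin_endo_eqI lin_endo_ops_closed) (auto simp: lin_endo_closed)
    show "\<exists>g\<in>carrier (lin_endo K M). g \<oplus>\<^bsub>lin_endo K M\<^esub> f = \<zero>\<^bsub>lin_endo K M\<^esub>"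
      by (rule bexI[OF _ lin_endo_neg[OF f]]) (auto simp: lin_endo_closed[OF f] M.M.l_neg)
    fix g assume g: "g \<in> carrier (lin_endo K M)"
    show "f \<oplus>\<^bsub>lin_endo K M\<^esub> g \<in> carrier (lin_endo K M)"
      by (rule lin_endo_ops_closed(1)[OF f g M.R.zero_closed])
    show "f \<oplus>\<^bsub>lin_endo K M\<^esub> g = g \<oplus>\<^bsub>lin_endo K M\<^esub> f"
      using f g by (auto simp: lin_endo_closed M.M.a_comm)
    fix h assume "h \<in> carrier (lin_endo K M)"
    then show "f \<oplus>\<^bsub>lin_endo K M\<^esub> g \<oplus>\<^bsub>lin_endo K M\<^esub> h = f \<oplus>\<^bsub>lin_endo K M\<^esub> (g \<oplus>\<^bsub>lin_endo K M\<^esub> h)"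
      using f g by (auto simp: lin_endo_closed M.M.a_assoc)
  qed
  fix c f assume c: "c \<in> carrier K" and f: "f \<in> carrier (lin_endo K M)"
  show "c \<odot>\<^bsub>lin_endo K M\<^esub> f \<in> carrier (lin_endo K M)" by (rule lin_endo_ops_closed(3)[OF f f c])
next
  fix f assume f: "f \<in> carrier (lin_endo K M)"
  show "\<one>\<^bsub>K\<^esub> \<odot>\<^bsub>lin_endo K M\<^esub> f = f"
    using lin_endo_ops_closed(3)[OF f f M.R.one_closed] f by (intro lin_endo_eqI) (auto simp: lin_endo_closed)
qed (use M.R.is_cring in \<open>auto simp: lin_endo_closed M.smult_l_distr M.smult_r_distr M.smult_assoc1 fun_eq_iff\<close>)

lemma k_algebra_lin_endo: "k_algebra K (lin_endo K M)"
proof (rule k_algebraI[OF K module_lin_endo lin_endo_one_closed])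
  note z = M.R.zero_closed
  show "bilinear K (lin_endo K M) (lin_endo K M) (lin_endo K M) (mult (lin_endo K M))"
    unfolding bilinear_def
    by (intro conjI ballI lin_homI; (rule lin_endo_ops_closed(2)[OF _ _ z], assumption+)?)
      (auto simp: lin_endo_closed lin_hom_add[OF lin_endo_lin] lin_hom_smult[OF lin_endo_lin] fun_eq_iff)
  fix f assume f: "f \<in> carrier (lin_endo K M)"
  show "\<one>\<^bsub>lin_endo K M\<^esub> \<otimes>\<^bsub>lin_endo K M\<^esub> f = f" "f \<otimes>\<^bsub>lin_endo K M\<^esub> \<one>\<^bsub>lin_endo K M\<^esub> = f"
    using lin_endo_ops_closed(2)[OF lin_endo_one_closed f z] lin_endo_ops_closed(2)[OF f lin_endo_one_closed z] f
    by (intro lin_endo_eqI; simp add: lin_endo_closed)+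
qed (auto simp: lin_endo_closed fun_eq_iff)

lemma commutator_lin_endo:
  assumes f: "f \<in> carrier (lin_endo K M)" and g: "g \<in> carrier (lin_endo K M)"
  shows "commutator (lin_endo K M) f g = (\<lambda>x\<in>carrier M. f (g x) \<ominus>\<^bsub>M\<^esub> g (f x))"
proof -
  interpret E: ring "lin_endo K M" by (rule k_algebra_ring[OF k_algebra_lin_endo])
  let ?gf = "g \<otimes>\<^bsub>lin_endo K M\<^esub> f"
  have gf: "?gf \<in> carrier (lin_endo K M)" using f g by (rule E.m_closed[rotated])
  have "\<ominus>\<^bsub>lin_endo K M\<^esub> ?gf = (\<lambda>x\<in>carrier M. \<ominus>\<^bsub>M\<^esub> ?gf x)"
    by (rule E.minus_equality[OF _ gf lin_endo_neg[OF gf]])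
      (use f g in \<open>auto simp: lin_endo_closed M.M.l_neg\<close>)
  then show ?thesis
    by (auto simp: commutator_def a_minus_def)
qed

end

text \<open>The regular representation of the Poisson algebra. The commutator of two brackets is the
  Jacobi identity (\<open>jacobi'\<close>), the commutator of a bracket with a multiplication is the
  Leibniz rule in the second argument, and the rule for \<delta> of a product is the Leibniz rule in
  the first argument (\<open>leibniz'\<close>).\<close>

lemma (in enveloping_setup) regular_pair:
  "enveloping_pair K A br (lin_endo K A) (\<lambda>a. \<lambda>x\<in>carrier A. a \<otimes>\<^bsub>A\<^esub> x) (\<lambda>a. restrict (br a) (carrier A))"
proof -
  note KA = k_algebra_field[OF A_algebra] A_module
  interpret AM: module K A by (rule A_module)
  have mult: "(\<lambda>x\<in>carrier A. a \<otimes>\<^bsub>A\<^esub> x) \<in> carrier (lin_endo K A)" if "a \<in> carrier A" for a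
    by (rule restrict_in_lin_endo[OF KA bilinear_right[OF k_algebra_mult_bilinear[OF A_algebra] that]])
  have brc: "restrict (br a) (carrier A) \<in> carrier (lin_endo K A)" if "a \<in> carrier A" for a
    by (rule restrict_in_lin_endo[OF KA bilinear_right[OF br_bilinear that]])
  note bl = bilinear_left[OF br_bilinear] and brr = bilinear_right[OF br_bilinear]
  have leibniz: "br a (b \<otimes>\<^bsub>A\<^esub> c) = br a b \<otimes>\<^bsub>A\<^esub> c \<oplus>\<^bsub>A\<^esub> b \<otimes>\<^bsub>A\<^esub> br a c"
    and jacobi: "br a (br b c) \<oplus>\<^bsub>A\<^esub> br b (br c a) \<oplus>\<^bsub>A\<^esub> br c (br a b) = \<zero>\<^bsub>A\<^esub>"
    if "a \<in> carrier A" "b \<in> carrier A" "c \<in> carrier A" for a b c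
    using poisson that by (simp_all add: poisson_algebra_def)
  have leibniz': "br (a \<otimes>\<^bsub>A\<^esub> b) c = a \<otimes>\<^bsub>A\<^esub> br b c \<oplus>\<^bsub>A\<^esub> b \<otimes>\<^bsub>A\<^esub> br a c"
    if "a \<in> carrier A" "b \<in> carrier A" "c \<in> carrier A" for a b c
    using that
    by (simp add: br_commute[of c "a \<otimes>\<^bsub>A\<^esub> b"] br_commute[of c a] br_commute[of c b] leibniz
        A.minus_add A.l_minus A.r_minus A.a_ac A.m_ac)
  have jacobi': "br (br a b) c = br a (br b c) \<ominus>\<^bsub>A\<^esub> br b (br a c)"
    if c: "a \<in> carrier A" "b \<in> carrier A" "c \<in> carrier A" for a b c
  proof -
    have "br b (br c a) = \<ominus>\<^bsub>A\<^esub> br b (br a c)"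
      using c br_commute[of a c] lin_hom_uminus[OF A_module A_module brr] by simp
    moreover have "br c (br a b) = \<ominus>\<^bsub>A\<^esub> br (br a b) c"
      using c by (intro br_commute br_closed)
    ultimately have "(br a (br b c) \<ominus>\<^bsub>A\<^esub> br b (br a c)) \<oplus>\<^bsub>A\<^esub> \<ominus>\<^bsub>A\<^esub> br (br a b) c = \<zero>\<^bsub>A\<^esub>"
      using jacobi[OF c] by (simp add: a_minus_def)
    from A.minus_equality[OF this] show ?thesis using c by simp
  qed
  show ?thesis
    unfolding enveloping_pair_def
  proof (intro conjI ballI alg_homI lin_homI)
    fix a b assume a: "a \<in> carrier A" and b: "b \<in> carrier A"
    show "restrict (br (br a b)) (carrier A) = commutator (lin_endo K A) (restrict (br a) (carrier A)) (restrict (br b) (carrier A))"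
      using a b by (auto simp: commutator_lin_endo[OF KA brc brc] jacobi')
    have "br a (b \<otimes>\<^bsub>A\<^esub> x) \<ominus>\<^bsub>A\<^esub> b \<otimes>\<^bsub>A\<^esub> br a x = br a b \<otimes>\<^bsub>A\<^esub> x" if "x \<in> carrier A" for x
      using a b that by (simp add: leibniz A.a_comm[of "br a b \<otimes>\<^bsub>A\<^esub> x"] A.plus_minus_cancel')
    then show "(\<lambda>x\<in>carrier A. br a b \<otimes>\<^bsub>A\<^esub> x) = commutator (lin_endo K A) (restrict (br a) (carrier A)) (\<lambda>x\<in>carrier A. b \<otimes>\<^bsub>A\<^esub> x)"
      using a b by (auto simp: commutator_lin_endo[OF KA brc mult])
  qed (auto simp: mult brc A.l_distr A.m_assoc leibniz' lin_hom_add[OF bl] lin_hom_smult[OF bl]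
      lin_hom_smult[OF bilinear_left[OF k_algebra_mult_bilinear[OF A_algebra]]])
qed

lemma (in enveloping_setup) enveloping_nontrivial:
  assumes U: "poisson_enveloping_algebra K A br U \<alpha> \<beta>" and A: "carrier A \<noteq> {\<zero>\<^bsub>A\<^esub>}"
  shows "carrier U \<noteq> {\<zero>\<^bsub>U\<^esub>}"
proof
  assume "carrier U = {\<zero>\<^bsub>U\<^esub>}"
  then have 01: "\<one>\<^bsub>U\<^esub> = \<zero>\<^bsub>U\<^esub>" using U.one_closed by blast
  note E = k_algebra_lin_endo[OF k_algebra_field[OF A_algebra] A_module]
  \<comment> \<open>The target lives in the type of functions on \<open>'a\<close>, so the universal
    property is needed at a type different from those in the definition. If 1 = 0 held in
    \<open>U\<close>, then h would force the identity of \<open>A\<close> to be the zero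
    map.\<close>
  obtain h where "h \<in> enveloping_homs K A U \<alpha> \<beta> (lin_endo K A)
      (\<lambda>a. \<lambda>x\<in>carrier A. a \<otimes>\<^bsub>A\<^esub> x) (\<lambda>a. restrict (br a) (carrier A))"
    using poisson_enveloping_any_type[OF U, where 'b = "'a \<Rightarrow> 'a"] E regular_pair
    unfolding poisson_enveloping_for_def by blast
  then have h: "h \<in> alg_hom K U (lin_endo K A)" by (simp add: enveloping_homs_def)
  have 0: "(\<lambda>x\<in>carrier A. x) = (\<lambda>x\<in>carrier A. \<zero>\<^bsub>A\<^esub>)"
    using alg_hom_one[OF h] lin_hom_zero[OF U_module k_algebra_module[OF E] alg_hom_lin[OF h]] 01 by simp
  have "x = \<zero>\<^bsub>A\<^esub>" if "x \<in> carrier A" for x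
    using fun_cong[OF 0, of x] that by simp
  with A show False using A.zero_closed by blast
qed

section \<open>The Hopf-Galois map of the enveloping algebra\<close>

lemma words5: "xs \<in> words [A, B, C, D, E] \<longleftrightarrow>
    (\<exists>x\<in>carrier A. \<exists>y\<in>carrier B. \<exists>z\<in>carrier C. \<exists>u\<in>carrier D. \<exists>v\<in>carrier E. xs = [x, y, z, u, v])"
  by (auto simp: words_def set_Cons_def)

lemma multilinear5I:
  assumes "\<And>y z u v. y \<in> carrier B \<Longrightarrow> z \<in> carrier C \<Longrightarrow> u \<in> carrier D \<Longrightarrow> v \<in> carrier E \<Longrightarrow> (\<lambda>x. f x y z u v) \<in> lin_hom K A N"
    and "\<And>x z u v. x \<in> carrier A \<Longrightarrow> z \<in> carrier C \<Longrightarrow> u \<in> carrier D \<Longrightarrow> v \<in> carrier E \<Longrightarrow> (\<lambda>y. f x y z u v) \<in> lin_hom K B N"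
    and "\<And>x y u v. x \<in> carrier A \<Longrightarrow> y \<in> carrier B \<Longrightarrow> u \<in> carrier D \<Longrightarrow> v \<in> carrier E \<Longrightarrow> (\<lambda>z. f x y z u v) \<in> lin_hom K C N"
    and "\<And>x y z v. x \<in> carrier A \<Longrightarrow> y \<in> carrier B \<Longrightarrow> z \<in> carrier C \<Longrightarrow> v \<in> carrier E \<Longrightarrow> (\<lambda>u. f x y z u v) \<in> lin_hom K D N"
    and "\<And>x y z u. x \<in> carrier A \<Longrightarrow> y \<in> carrier B \<Longrightarrow> z \<in> carrier C \<Longrightarrow> u \<in> carrier D \<Longrightarrow> (\<lambda>v. f x y z u v) \<in> lin_hom K E N"
  shows "multilinear K [A, B, C, D, E] N (\<lambda>xs. f (xs ! 0) (xs ! 1) (xs ! 2) (xs ! 3) (xs ! 4))"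
proof -
  have "f x y z u v \<in> carrier N"
    if "x \<in> carrier A" "y \<in> carrier B" "z \<in> carrier C" "u \<in> carrier D" "v \<in> carrier E" for x y z u v
    using lin_hom_closed[OF assms(1)[OF that(2-5)] that(1)] .
  with assms show ?thesis
    by (auto simp: multilinear_def words5 less_Suc_eq numeral_eq_Suc)
qed

locale poisson_hopf_setup = enveloping_setup K A br U \<alpha> \<beta>
  for K :: "'k ring" and A :: "('k, 'a) module" and br and U :: "('k, 'u) module" and \<alpha> \<beta> +
  fixes \<mu> :: "'a \<Rightarrow> ('a list \<Rightarrow> 'k) set"
  assumes hopf: "hopf_galois_algebra K A \<mu>"
    and \<mu>_br: "a \<in> carrier A \<Longrightarrow> b \<in> carrier A \<Longrightarrow> \<mu> (br a b) = triple_bracket K A br (\<mu> a) (\<mu> b)"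
    and universal: "poisson_enveloping_algebra K A br U \<alpha> \<beta>"
begin

abbreviation "D \<equiv> env_\<mu> K A \<mu> U \<alpha> \<beta>"

lemma
  shows \<mu>_hom: "\<mu> \<in> alg_hom K A AT.TA"
    and coassoc: "a \<in> carrier A \<Longrightarrow> \<mu>_id_id K A \<mu> (\<mu> a) = id_id_\<mu> K A \<mu> (\<mu> a)"
    and m_id_\<mu>: "a \<in> carrier A \<Longrightarrow> m_id K A (\<mu> a) = pure_tensor K [A, A] [\<one>\<^bsub>A\<^esub>, a]"
    and id_m_\<mu>: "a \<in> carrier A \<Longrightarrow> id_m K A (\<mu> a) = pure_tensor K [A, A] [a, \<one>\<^bsub>A\<^esub>]"
  using hopf by (simp_all add: hopf_galois_algebra_iff)

lemma \<mu>_lin: "\<mu> \<in> lin_hom K A AT.T"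
  using alg_hom_lin[OF \<mu>_hom] by simp

lemmas \<mu>_closed [simp] = lin_hom_closed[OF \<mu>_lin]

text \<open>\<open>D\<close> is a definite description, so its properties are available only after
  unique existence. This is the universal property applied to the pair of \<open>triple_pair\<close>
  pulled back along \<mu>, which preserves brackets.\<close>

lemma D_homs: "D \<in> enveloping_homs K A U \<alpha> \<beta> UT.TA (\<gamma> \<circ> \<mu>) (\<xi> \<circ> \<mu>)"
proof -
  have pair: "enveloping_pair K A br UT.TA (\<gamma> \<circ> \<mu>) (\<xi> \<circ> \<mu>)"
    by (rule enveloping_pair_compose[OF triple_pair \<mu>_hom]) (rule \<mu>_br)
  have "\<forall>(B :: ('k, ('u list \<Rightarrow> 'k) set) module) \<gamma> \<delta>. k_algebra K B \<and> enveloping_pair K A br B \<gamma> \<delta> \<longrightarrow>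
      (\<exists>!h. h \<in> enveloping_homs K A U \<alpha> \<beta> B \<gamma> \<delta>)"
    using poisson_enveloping_any_type[OF universal] unfolding poisson_enveloping_for_def by (elim conjE)
  note this[rule_format, OF conjI[OF UT.tensor_algebra pair]]
  from theI'[OF this] show ?thesis by (simp add: env_\<mu>_def enveloping_map_def)
qed

lemma
  shows D_hom: "D \<in> alg_hom K U UT.TA"
    and D_\<alpha>: "a \<in> carrier A \<Longrightarrow> D (\<alpha> a) = \<gamma> (\<mu> a)"
    and D_\<beta>: "a \<in> carrier A \<Longrightarrow> D (\<beta> a) = \<xi> (\<mu> a)"
  using D_homs by (simp_all add: enveloping_homs_def)

lemma D_lin: "D \<in> lin_hom K U UT.T"
  using alg_hom_lin[OF D_hom] by simp

lemmas D_closed [simp] = lin_hom_closed[OF D_lin]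

lemma generated:
  assumes "k_subalgebra K U S" "\<And>a. a \<in> carrier A \<Longrightarrow> \<alpha> a \<in> S" "\<And>a. a \<in> carrier A \<Longrightarrow> \<beta> a \<in> S"
  shows "carrier U \<subseteq> S"
  by (rule enveloping_generated[OF _ assms(1)])
    (use universal assms in \<open>auto simp: poisson_enveloping_algebra_def\<close>)

sublocale A5: algebra_factors K "quintuple A"
  by (rule algebra_factorsI[OF k_algebra_field[OF A_algebra]]) (use A_algebra k_algebra_op in auto)
sublocale U5: algebra_factors K "quintuple U"
  by (rule algebra_factorsI[OF k_algebra_field[OF A_algebra]]) (use U_algebra k_algebra_op in auto)
sublocale A2: algebra_factors K "[A, A]"
  by (rule algebra_factorsI[OF k_algebra_field[OF A_algebra]]) (use A_algebra in auto)
sublocale U2: algebra_factors K "[U, U]"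
  by (rule algebra_factorsI[OF k_algebra_field[OF A_algebra]]) (use U_algebra in auto)
sublocale AO: algebra_factors K "[A, op_alg A]"
  by (rule algebra_factorsI[OF k_algebra_field[OF A_algebra]]) (use A_algebra k_algebra_op in auto)
sublocale OA: algebra_factors K "[op_alg A, A]"
  by (rule algebra_factorsI[OF k_algebra_field[OF A_algebra]]) (use A_algebra k_algebra_op in auto)
sublocale UO: algebra_factors K "[U, op_alg U]"
  by (rule algebra_factorsI[OF k_algebra_field[OF A_algebra]]) (use U_algebra k_algebra_op in auto)
sublocale OU: algebra_factors K "[op_alg U, U]"
  by (rule algebra_factorsI[OF k_algebra_field[OF A_algebra]]) (use U_algebra k_algebra_op in auto)

abbreviation "\<nu> fs \<equiv> tensor_map K (triple U) fs"
abbreviation "\<nu>\<^sub>5 fs \<equiv> tensor_map K (quintuple U) fs"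

lemma map5_lin:
  assumes "{f, g, h, i, j} \<subseteq> lin_hom K A U"
  shows "\<nu>\<^sub>5 [f, g, h, i, j] \<in> lin_hom K A5.T U5.T"
  by (rule tensor_map_lin[OF A5.tensor_factors U5.tensor_factors])
    (use assms in \<open>auto simp: less_Suc_eq\<close>)

text \<open>Five slots split as 3 + 2 and as 2 + 3, one splitting for each side of coassociativity;
  both are naturality of concatenation.\<close>

lemma map5_append:
  assumes f: "{f, g, h, i, j} \<subseteq> lin_hom K A U" and c: "x \<in> carrier A" "y \<in> carrier A" and X: "X \<in> carrier AT.T"
  shows "\<nu>\<^sub>5 [f, g, h, i, j] (tensor_append K (quintuple A) X (pure_tensor K [op_alg A, A] [x, y])) =
      tensor_append K (quintuple U) (\<nu> [f, g, h] X) (pure_tensor K [op_alg U, U] [i x, j y])"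
    and "\<nu>\<^sub>5 [f, g, h, i, j] (tensor_append K (quintuple A) (pure_tensor K [A, op_alg A] [x, y]) X) =
      tensor_append K (quintuple U) (pure_tensor K [U, op_alg U] [f x, g y]) (\<nu> [h, i, j] X)"
proof -
  have l: "[i, j] ! n \<in> lin_hom K ([op_alg A, A] ! n) ([op_alg U, U] ! n)" if "n < length [op_alg A, A]" for n
    using that f by (auto simp: less_Suc_eq)
  have r: "[f, g] ! n \<in> lin_hom K ([A, op_alg A] ! n) ([U, op_alg U] ! n)" if "n < length [A, op_alg A]" for n
    using that f by (auto simp: less_Suc_eq)
  have l3: "[f, g, h] ! n \<in> lin_hom K (triple A ! n) (triple U ! n)" if "n < length (triple A)" for n
    using that f by (auto simp: less_Suc_eq)
  have r3: "[h, i, j] ! n \<in> lin_hom K (triple A ! n) (triple U ! n)" if "n < length (triple A)" for n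
    using that f by (auto simp: less_Suc_eq)
  have p: "tensor_map K [op_alg U, U] [i, j] (pure_tensor K [op_alg A, A] [x, y]) = pure_tensor K [op_alg U, U] [i x, j y]"
    using tensor_map_pure[OF OA.tensor_factors OU.tensor_factors _ _ l, of "[x, y]"] c by simp
  have q: "tensor_map K [U, op_alg U] [f, g] (pure_tensor K [A, op_alg A] [x, y]) = pure_tensor K [U, op_alg U] [f x, g y]"
    using tensor_map_pure[OF AO.tensor_factors UO.tensor_factors _ _ r, of "[x, y]"] c by simp
  have pc: "pure_tensor K [op_alg A, A] [x, y] \<in> carrier OA.T" and qc: "pure_tensor K [A, op_alg A] [x, y] \<in> carrier AO.T"
    using OA.pure_closed[of "[x, y]"] AO.pure_closed[of "[x, y]"] c by simp_all
  show "\<nu>\<^sub>5 [f, g, h, i, j] (tensor_append K (quintuple A) X (pure_tensor K [op_alg A, A] [x, y])) =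
      tensor_append K (quintuple U) (\<nu> [f, g, h] X) (pure_tensor K [op_alg U, U] [i x, j y])"
    using tensor_map_append[OF AT.tensor_factors OA.tensor_factors UT.tensor_factors OU.tensor_factors _ _ _ _ l3 l X pc]
    by (simp add: p)
  show "\<nu>\<^sub>5 [f, g, h, i, j] (tensor_append K (quintuple A) (pure_tensor K [A, op_alg A] [x, y]) X) =
      tensor_append K (quintuple U) (pure_tensor K [U, op_alg U] [f x, g y]) (\<nu> [h, i, j] X)"
    using tensor_map_append[OF AO.tensor_factors AT.tensor_factors UO.tensor_factors UT.tensor_factors _ _ _ _ r r3 qc X]
    by (simp add: q)
qed

lemma \<gamma>_eq: "\<gamma> = \<nu> [\<alpha>, \<alpha>, \<alpha>]"
  by (simp add: env_\<alpha>\<alpha>\<alpha>_def)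

lemma \<xi>_eq: "\<xi> X = \<nu> [\<alpha>, \<alpha>, \<beta>] X \<oplus>\<^bsub>UT.T\<^esub> \<nu> [\<alpha>, \<beta>, \<alpha>] X \<oplus>\<^bsub>UT.T\<^esub> \<nu> [\<beta>, \<alpha>, \<alpha>] X"
  by (simp add: env_\<xi>_def)

declare \<alpha>_lin [simp] \<beta>_lin [simp]

lemma map3_closed:
  "f \<in> lin_hom K A U \<Longrightarrow> g \<in> lin_hom K A U \<Longrightarrow> h \<in> lin_hom K A U \<Longrightarrow> X \<in> carrier AT.T \<Longrightarrow>
    \<nu> [f, g, h] X \<in> carrier UT.T"
  by (rule lin_hom_closed[OF map3_lin])

lemma map5_closed:
  "{f, g, h, i, j} \<subseteq> lin_hom K A U \<Longrightarrow> X \<in> carrier A5.T \<Longrightarrow> \<nu>\<^sub>5 [f, g, h, i, j] X \<in> carrier U5.T"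
  by (rule lin_hom_closed[OF map5_lin])

text \<open>Expresses \<mu> (x) id (x) id for \<open>U\<close> through the same map for
  \<open>A\<close>, so that coassociativity of \<open>A\<close> becomes applicable. A slot carrying
  \<alpha> stays \<alpha> in all three new slots, whereas \<beta> is spread by \<xi> over the three
  new slots in turn.\<close>

lemma \<mu>_id_id_map:
  assumes X: "X \<in> carrier AT.T" and gh: "g \<in> lin_hom K A U" "h \<in> lin_hom K A U"
  shows "\<mu>_id_id K U D (\<nu> [\<alpha>, g, h] X) = \<nu>\<^sub>5 [\<alpha>, \<alpha>, \<alpha>, g, h] (\<mu>_id_id K A \<mu> X)"
    and "\<mu>_id_id K U D (\<nu> [\<beta>, g, h] X) = \<nu>\<^sub>5 [\<alpha>, \<alpha>, \<beta>, g, h] (\<mu>_id_id K A \<mu> X) \<oplus>\<^bsub>U5.T\<^esub>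
      \<nu>\<^sub>5 [\<alpha>, \<beta>, \<alpha>, g, h] (\<mu>_id_id K A \<mu> X) \<oplus>\<^bsub>U5.T\<^esub> \<nu>\<^sub>5 [\<beta>, \<alpha>, \<alpha>, g, h] (\<mu>_id_id K A \<mu> X)"
proof -
  note PU = \<mu>_id_id_lin[OF U_algebra D_lin] \<mu>_id_id_pure[OF U_algebra D_lin]
    and PA = \<mu>_id_id_lin[OF A_algebra \<mu>_lin] \<mu>_id_id_pure[OF A_algebra \<mu>_lin]
    and cl = lin_hom_closed[OF gh(1)] lin_hom_closed[OF gh(2)]
  have lin5: "(\<lambda>X. \<nu>\<^sub>5 [a, b, c, d, e] (\<mu>_id_id K A \<mu> X)) \<in> lin_hom K AT.T U5.T"
    if "{a, b, c, d, e} \<subseteq> lin_hom K A U" for a b c d e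
    by (rule lin_hom_compose[OF PA(1) map5_lin[OF that]])
  note M = U5.T.module_axioms
  have ap: "(\<lambda>Z. tensor_append K (quintuple U) Z (pure_tensor K [op_alg U, U] [y, z])) \<in> lin_hom K UT.T U5.T"
    if "y \<in> carrier U" "z \<in> carrier U" for y z
    using bilinear_left[OF append_32_bilinear[OF U_algebra]] OU.pure_closed[of "[y, z]"] that by simp
  show "\<mu>_id_id K U D (\<nu> [\<alpha>, g, h] X) = \<nu>\<^sub>5 [\<alpha>, \<alpha>, \<alpha>, g, h] (\<mu>_id_id K A \<mu> X)"
    using M lin_hom_compose[OF map3_lin[OF \<alpha>_lin gh] PU(1)] lin5 _ X
    by (rule AT.tensor_eqI)
      (auto simp: words3 map3_pure gh PU(2) PA(2) cl map5_append(1) D_\<alpha> \<gamma>_eq)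
  have r: "(\<lambda>X. \<nu>\<^sub>5 [\<alpha>, \<alpha>, \<beta>, g, h] (\<mu>_id_id K A \<mu> X) \<oplus>\<^bsub>U5.T\<^esub>
      \<nu>\<^sub>5 [\<alpha>, \<beta>, \<alpha>, g, h] (\<mu>_id_id K A \<mu> X) \<oplus>\<^bsub>U5.T\<^esub> \<nu>\<^sub>5 [\<beta>, \<alpha>, \<alpha>, g, h] (\<mu>_id_id K A \<mu> X)) \<in> lin_hom K AT.T U5.T"
    by (intro lin_hom_plus[OF M] lin5) (simp_all add: gh)
  show "\<mu>_id_id K U D (\<nu> [\<beta>, g, h] X) = \<nu>\<^sub>5 [\<alpha>, \<alpha>, \<beta>, g, h] (\<mu>_id_id K A \<mu> X) \<oplus>\<^bsub>U5.T\<^esub>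
      \<nu>\<^sub>5 [\<alpha>, \<beta>, \<alpha>, g, h] (\<mu>_id_id K A \<mu> X) \<oplus>\<^bsub>U5.T\<^esub> \<nu>\<^sub>5 [\<beta>, \<alpha>, \<alpha>, g, h] (\<mu>_id_id K A \<mu> X)"
    using M lin_hom_compose[OF map3_lin[OF \<beta>_lin gh] PU(1)] r _ X
    by (rule AT.tensor_eqI)
      (auto simp: words3 map3_pure gh PU(2) PA(2) cl map5_append(1) D_\<beta> \<xi>_eq
        lin_hom_add[OF ap] map3_closed)
qed

lemma id_id_\<mu>_map:
  assumes X: "X \<in> carrier AT.T" and gh: "g \<in> lin_hom K A U" "h \<in> lin_hom K A U"
  shows "id_id_\<mu> K U D (\<nu> [g, h, \<alpha>] X) = \<nu>\<^sub>5 [g, h, \<alpha>, \<alpha>, \<alpha>] (id_id_\<mu> K A \<mu> X)"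
    and "id_id_\<mu> K U D (\<nu> [g, h, \<beta>] X) = \<nu>\<^sub>5 [g, h, \<alpha>, \<alpha>, \<beta>] (id_id_\<mu> K A \<mu> X) \<oplus>\<^bsub>U5.T\<^esub>
      \<nu>\<^sub>5 [g, h, \<alpha>, \<beta>, \<alpha>] (id_id_\<mu> K A \<mu> X) \<oplus>\<^bsub>U5.T\<^esub> \<nu>\<^sub>5 [g, h, \<beta>, \<alpha>, \<alpha>] (id_id_\<mu> K A \<mu> X)"
proof -
  note PU = id_id_\<mu>_lin[OF U_algebra D_lin] id_id_\<mu>_pure[OF U_algebra D_lin]
    and PA = id_id_\<mu>_lin[OF A_algebra \<mu>_lin] id_id_\<mu>_pure[OF A_algebra \<mu>_lin]
    and cl = lin_hom_closed[OF gh(1)] lin_hom_closed[OF gh(2)]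
  have lin5: "(\<lambda>X. \<nu>\<^sub>5 [a, b, c, d, e] (id_id_\<mu> K A \<mu> X)) \<in> lin_hom K AT.T U5.T"
    if "{a, b, c, d, e} \<subseteq> lin_hom K A U" for a b c d e
    by (rule lin_hom_compose[OF PA(1) map5_lin[OF that]])
  note M = U5.T.module_axioms
  have ap: "(\<lambda>Z. tensor_append K (quintuple U) (pure_tensor K [U, op_alg U] [y, z]) Z) \<in> lin_hom K UT.T U5.T"
    if "y \<in> carrier U" "z \<in> carrier U" for y z
    using bilinear_right[OF append_23_bilinear[OF U_algebra]] UO.pure_closed[of "[y, z]"] that by simp
  show "id_id_\<mu> K U D (\<nu> [g, h, \<alpha>] X) = \<nu>\<^sub>5 [g, h, \<alpha>, \<alpha>, \<alpha>] (id_id_\<mu> K A \<mu> X)"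
    using M lin_hom_compose[OF map3_lin[OF gh \<alpha>_lin] PU(1)] lin5 _ X
    by (rule AT.tensor_eqI)
      (auto simp: words3 map3_pure gh PU(2) PA(2) cl map5_append(2) D_\<alpha> \<gamma>_eq)
  have r: "(\<lambda>X. \<nu>\<^sub>5 [g, h, \<alpha>, \<alpha>, \<beta>] (id_id_\<mu> K A \<mu> X) \<oplus>\<^bsub>U5.T\<^esub>
      \<nu>\<^sub>5 [g, h, \<alpha>, \<beta>, \<alpha>] (id_id_\<mu> K A \<mu> X) \<oplus>\<^bsub>U5.T\<^esub> \<nu>\<^sub>5 [g, h, \<beta>, \<alpha>, \<alpha>] (id_id_\<mu> K A \<mu> X)) \<in> lin_hom K AT.T U5.T"
    by (intro lin_hom_plus[OF M] lin5) (simp_all add: gh)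
  show "id_id_\<mu> K U D (\<nu> [g, h, \<beta>] X) = \<nu>\<^sub>5 [g, h, \<alpha>, \<alpha>, \<beta>] (id_id_\<mu> K A \<mu> X) \<oplus>\<^bsub>U5.T\<^esub>
      \<nu>\<^sub>5 [g, h, \<alpha>, \<beta>, \<alpha>] (id_id_\<mu> K A \<mu> X) \<oplus>\<^bsub>U5.T\<^esub> \<nu>\<^sub>5 [g, h, \<beta>, \<alpha>, \<alpha>] (id_id_\<mu> K A \<mu> X)"
    using M lin_hom_compose[OF map3_lin[OF gh \<beta>_lin] PU(1)] r _ X
    by (rule AT.tensor_eqI)
      (auto simp: words3 map3_pure gh PU(2) PA(2) cl map5_append(2) D_\<beta> \<xi>_eq
        lin_hom_add[OF ap] map3_closed)
qed

lemma coassoc_U: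
  assumes "u \<in> carrier U"
  shows "\<mu>_id_id K U D (D u) = id_id_\<mu> K U D (D u)"
proof -
  note P = \<mu>_id_id_hom[OF U_algebra D_hom] and Q = id_id_\<mu>_hom[OF U_algebra D_hom]
  note Pl = alg_hom_lin[OF P, unfolded tensor_algebra_simps] and Ql = alg_hom_lin[OF Q, unfolded tensor_algebra_simps]
  have PD: "(\<lambda>u. \<mu>_id_id K U D (D u)) \<in> alg_hom K U U5.TA"
    and QD: "(\<lambda>u. id_id_\<mu> K U D (D u)) \<in> alg_hom K U U5.TA"
    using alg_hom_comp[OF D_hom P] alg_hom_comp[OF D_hom Q] by (simp_all add: comp_def)
  note cl = lin_hom_closed[OF id_id_\<mu>_lin[OF A_algebra \<mu>_lin]]
  have "carrier U \<subseteq> {u \<in> carrier U. \<mu>_id_id K U D (D u) = id_id_\<mu> K U D (D u)}"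
  proof (rule generated[OF equalizer_subalgebra[OF U_algebra PD QD]])
    fix a assume a: "a \<in> carrier A"
    show "\<alpha> a \<in> {u \<in> carrier U. \<mu>_id_id K U D (D u) = id_id_\<mu> K U D (D u)}"
      using a by (simp add: D_\<alpha> \<gamma>_eq \<mu>_id_id_map id_id_\<mu>_map coassoc)
    \<comment> \<open>Both sides become the sum of five terms with \<beta> in one slot and \<alpha>
      in the other four. On the left the first slot splits into three of them, on the right the last
      slot does; only the order of summation differs.\<close>
    show "\<beta> a \<in> {u \<in> carrier U. \<mu>_id_id K U D (D u) = id_id_\<mu> K U D (D u)}"
      using a by (simp add: D_\<beta> \<xi>_eq lin_hom_add[OF Pl] lin_hom_add[OF Ql] map3_closed \<mu>_id_id_map
          id_id_\<mu>_map coassoc map5_closed cl U5.T.M.a_ac)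
  qed
  with assms show ?thesis by auto
qed

end

section \<open>The unit axioms for \<open>D\<close> and the condition on \<beta>\<close>

context poisson_hopf_setup begin

abbreviation "p2 x y \<equiv> pure_tensor K [U, U] [x, y]"

lemmas U2_lin = pure2_lin1[OF U2.tensor_factors] pure2_lin2[OF U2.tensor_factors]

lemma p2_closed: "x \<in> carrier U \<Longrightarrow> y \<in> carrier U \<Longrightarrow> p2 x y \<in> carrier U2.T"
  by (rule U2.pure_closed) simp

lemma p2_uminus:
  assumes "x \<in> carrier U" "y \<in> carrier U"
  shows "p2 (\<ominus>\<^bsub>U\<^esub> x) y = \<ominus>\<^bsub>U2.T\<^esub> p2 x y" "p2 x (\<ominus>\<^bsub>U\<^esub> y) = \<ominus>\<^bsub>U2.T\<^esub> p2 x y"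
  using lin_hom_uminus[OF U_module U2.T.module_axioms, of "\<lambda>x. p2 x y" x]
    lin_hom_uminus[OF U_module U2.T.module_axioms, of "\<lambda>y. p2 x y" y] assms
  by (simp_all add: U2_lin lin_hom_ident)

abbreviation "m3 \<equiv> tensor_lift3 K U (\<lambda>x y z. x \<otimes>\<^bsub>U\<^esub> (y \<otimes>\<^bsub>U\<^esub> z))"

lemma
  shows m3_lin: "m3 \<in> lin_hom K UT.T U"
    and m3_pure: "\<And>x y z. x \<in> carrier U \<Longrightarrow> y \<in> carrier U \<Longrightarrow> z \<in> carrier U \<Longrightarrow>
      m3 (t x y z) = x \<otimes>\<^bsub>U\<^esub> (y \<otimes>\<^bsub>U\<^esub> z)"
proof -
  have m: "multilinear K (triple U) U (\<lambda>xs. xs ! 0 \<otimes>\<^bsub>U\<^esub> (xs ! 1 \<otimes>\<^bsub>U\<^esub> xs ! 2))"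
    by (rule multilinear3I; simp only: lin_hom_op op_alg_simps;
        intro mult_lin_left[OF U_algebra] mult_lin_right[OF U_algebra] lin_hom_ident U.m_closed)
  show "m3 \<in> lin_hom K UT.T U"
    unfolding tensor_lift3_def by (rule UT.lift_lin[OF U_module m])
  show "m3 (t x y z) = x \<otimes>\<^bsub>U\<^esub> (y \<otimes>\<^bsub>U\<^esub> z)" if "x \<in> carrier U" "y \<in> carrier U" "z \<in> carrier U" for x y z
    unfolding tensor_lift3_def using UT.lift_pure[OF U_module m, of "[x, y, z]"] that by simp
qed

text \<open>Merging the first two slots commutes with the slotwise map because both of them carry
  the multiplicative \<alpha>; the third slot is untouched, so any linear h may stand there.\<close>

lemma m_id_map:
  assumes h: "h \<in> lin_hom K A U" and X: "X \<in> carrier AT.T"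
  shows "m_id K U (\<nu> [\<alpha>, \<alpha>, h] X) = tensor_map K [U, U] [\<alpha>, h] (m_id K A X)"
  using U2.T.module_axioms lin_hom_compose[OF map3_lin[OF \<alpha>_lin \<alpha>_lin h] m_id_lin[OF U_algebra]]
    lin_hom_compose[OF m_id_lin[OF A_algebra] map2_lin[OF A_algebra U_algebra \<alpha>_lin h]] _ X
  by (rule AT.tensor_eqI)
    (auto simp: words3 map3_pure h m_id_pure[OF U_algebra] m_id_pure[OF A_algebra] lin_hom_closed[OF h]
      map2_pure[OF A_algebra U_algebra] \<alpha>_mult)

lemma id_m_map:
  assumes h: "h \<in> lin_hom K A U" and X: "X \<in> carrier AT.T"
  shows "id_m K U (\<nu> [h, \<alpha>, \<alpha>] X) = tensor_map K [U, U] [h, \<alpha>] (id_m K A X)"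
  using U2.T.module_axioms lin_hom_compose[OF map3_lin[OF h \<alpha>_lin \<alpha>_lin] id_m_lin[OF U_algebra]]
    lin_hom_compose[OF id_m_lin[OF A_algebra] map2_lin[OF A_algebra U_algebra h \<alpha>_lin]] _ X
  by (rule AT.tensor_eqI)
    (auto simp: words3 map3_pure h id_m_pure[OF U_algebra] id_m_pure[OF A_algebra] lin_hom_closed[OF h]
      map2_pure[OF A_algebra U_algebra] \<alpha>_mult)

lemma \<alpha>_one: "\<alpha> \<one>\<^bsub>A\<^esub> = \<one>\<^bsub>U\<^esub>"
  by (rule alg_hom_one[OF \<alpha>_hom])

lemma unit_maps:
  assumes "h \<in> lin_hom K A U" "a \<in> carrier A"
  shows "m_id K U (\<nu> [\<alpha>, \<alpha>, h] (\<mu> a)) = p2 \<one>\<^bsub>U\<^esub> (h a)" "id_m K U (\<nu> [h, \<alpha>, \<alpha>] (\<mu> a)) = p2 (h a) \<one>\<^bsub>U\<^esub>"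
  using assms by (simp_all add: m_id_map id_m_map m_id_\<mu> id_m_\<mu> map2_pure[OF A_algebra U_algebra] \<alpha>_one)

text \<open>The unit axiom of \<open>A\<close> evaluates only the term with \<beta> in the unmerged
  slot, and that value is already the desired one. The axiom for \<beta>(a) therefore means that the
  other two terms cancel.\<close>

lemma m_id_\<xi>:
  assumes "a \<in> carrier A"
  shows "m_id K U (\<xi> (\<mu> a)) = p2 \<one>\<^bsub>U\<^esub> (\<beta> a) \<oplus>\<^bsub>U2.T\<^esub> m_id K U (\<nu> [\<alpha>, \<beta>, \<alpha>] (\<mu> a)) \<oplus>\<^bsub>U2.T\<^esub>
      m_id K U (\<nu> [\<beta>, \<alpha>, \<alpha>] (\<mu> a))"
  using assms by (simp add: \<xi>_eq lin_hom_add[OF m_id_lin[OF U_algebra]] map3_closed unit_maps)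

lemma id_m_\<xi>:
  assumes "a \<in> carrier A"
  shows "id_m K U (\<xi> (\<mu> a)) = id_m K U (\<nu> [\<alpha>, \<alpha>, \<beta>] (\<mu> a)) \<oplus>\<^bsub>U2.T\<^esub> id_m K U (\<nu> [\<alpha>, \<beta>, \<alpha>] (\<mu> a)) \<oplus>\<^bsub>U2.T\<^esub>
      p2 (\<beta> a) \<one>\<^bsub>U\<^esub>"
  using assms by (simp add: \<xi>_eq lin_hom_add[OF id_m_lin[OF U_algebra]] map3_closed unit_maps)

text \<open>
  If the condition holds, then \<open>\<beta>(a\<^sub>1)\<alpha>(a\<^sub>2) \<otimes> \<alpha>(a\<^sub>3)\<close> is obtained from \<open>\<mu>(a\<^sub>1) \<otimes> a\<^sub>2 \<otimes> a\<^sub>3\<close> by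
  \<open>- \<alpha>\<beta>\<alpha>\<alpha> \<otimes> \<alpha>\<close>, to which coassociativity and the unit axiom of \<open>A\<close> apply.
\<close>

lemma m_id_cancel:
  assumes cond: "\<And>a. a \<in> carrier A \<Longrightarrow> m3 (\<nu> [\<alpha>, \<beta>, \<alpha>] (\<mu> a)) = \<ominus>\<^bsub>U\<^esub> \<beta> a" and a: "a \<in> carrier A"
  shows "m_id K U (\<nu> [\<alpha>, \<beta>, \<alpha>] (\<mu> a)) = \<ominus>\<^bsub>U2.T\<^esub> m_id K U (\<nu> [\<beta>, \<alpha>, \<alpha>] (\<mu> a))"
proof -
  \<comment> \<open>One linear map on five slots that is evaluated on both sides of the
    coassociativity of \<open>A\<close>. On the left the first three slots hold \<mu>(a1), on the
    right the last three hold \<mu>(a3).\<close>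
  let ?\<phi> = "\<lambda>xs. p2 (\<alpha> (xs ! 0) \<otimes>\<^bsub>U\<^esub> (\<beta> (xs ! 1) \<otimes>\<^bsub>U\<^esub> \<alpha> (xs ! 2)) \<otimes>\<^bsub>U\<^esub> \<alpha> (xs ! 3)) (\<alpha> (xs ! 4))"
  define F where "F = tensor_lift K U2.T ?\<phi>"
  note M = U2.T.module_axioms
  have m: "multilinear K (quintuple A) U2.T ?\<phi>"
    by (rule multilinear5I; simp only: lin_hom_op op_alg_simps;
        intro U2_lin mult_lin_left[OF U_algebra] mult_lin_right[OF U_algebra] \<alpha>_lin \<beta>_lin U.m_closed \<alpha>_closed \<beta>_closed)
  note F = A5.lift_lin[OF M m, folded F_def]
  have Fp: "F (pure_tensor K (quintuple A) [x, y, z, u, v]) = p2 (\<alpha> x \<otimes>\<^bsub>U\<^esub> (\<beta> y \<otimes>\<^bsub>U\<^esub> \<alpha> z) \<otimes>\<^bsub>U\<^esub> \<alpha> u) (\<alpha> v)"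
    if "x \<in> carrier A" "y \<in> carrier A" "z \<in> carrier A" "u \<in> carrier A" "v \<in> carrier A" for x y z u v
    using A5.lift_pure[OF M m, of "[x, y, z, u, v]"] that by (simp add: F_def)
  note PA = \<mu>_id_id_lin[OF A_algebra \<mu>_lin] \<mu>_id_id_pure[OF A_algebra \<mu>_lin]
    and QA = id_id_\<mu>_lin[OF A_algebra \<mu>_lin] id_id_\<mu>_pure[OF A_algebra \<mu>_lin]
    and mU = m_id_lin[OF U_algebra] m_id_pure[OF U_algebra]
    and mA = m_id_lin[OF A_algebra] m_id_pure[OF A_algebra]
  have L: "F (tensor_append K (quintuple A) X (pure_tensor K [op_alg A, A] [y, z])) =
      p2 (m3 (\<nu> [\<alpha>, \<beta>, \<alpha>] X) \<otimes>\<^bsub>U\<^esub> \<alpha> y) (\<alpha> z)"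
    if y: "y \<in> carrier A" and z: "z \<in> carrier A" and X: "X \<in> carrier AT.T" for X y z
  proof -
    have w: "pure_tensor K [op_alg A, A] [y, z] \<in> carrier OA.T" using OA.pure_closed[of "[y, z]"] y z by simp
    have r: "(\<lambda>X. p2 (m3 (\<nu> [\<alpha>, \<beta>, \<alpha>] X) \<otimes>\<^bsub>U\<^esub> \<alpha> y) (\<alpha> z)) \<in> lin_hom K AT.T U2.T"
      by (intro U2_lin mult_lin_left[OF U_algebra] lin_hom_compose[OF map3_lin m3_lin] \<alpha>_lin \<beta>_lin \<alpha>_closed y z)
    show ?thesis
      using M lin_hom_compose[OF bilinear_left[OF append_32_bilinear[OF A_algebra] w] F] r _ X
    proof (rule AT.tensor_eqI)
      fix xs assume "xs \<in> words (triple A)"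
      then show "F (tensor_append K (quintuple A) (pure_tensor K (triple A) xs) (pure_tensor K [op_alg A, A] [y, z])) =
          p2 (m3 (\<nu> [\<alpha>, \<beta>, \<alpha>] (pure_tensor K (triple A) xs)) \<otimes>\<^bsub>U\<^esub> \<alpha> y) (\<alpha> z)"
        using y z tensor_append_pure[OF AT.tensor_factors OA.tensor_factors, of xs "[y, z]"]
        by (auto simp: words3 Fp map3_pure m3_pure)
    qed
  qed
  \<comment> \<open>Slots three and four both carry \<alpha> and are adjacent in the product, so
    they merge to \<alpha> of a product in \<open>A\<close>; the map depends on the last three slots
    only through \<open>m_id K A\<close>.\<close>
  have R: "F (tensor_append K (quintuple A) (pure_tensor K [A, op_alg A] [x, y]) X) =
      tensor_map K [U, U] [\<lambda>w. \<alpha> x \<otimes>\<^bsub>U\<^esub> \<beta> y \<otimes>\<^bsub>U\<^esub> \<alpha> w, \<alpha>] (m_id K A X)"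
    if x: "x \<in> carrier A" and y: "y \<in> carrier A" and X: "X \<in> carrier AT.T" for X x y
  proof -
    have w: "pure_tensor K [A, op_alg A] [x, y] \<in> carrier AO.T" using AO.pure_closed[of "[x, y]"] x y by simp
    have f: "(\<lambda>w. \<alpha> x \<otimes>\<^bsub>U\<^esub> \<beta> y \<otimes>\<^bsub>U\<^esub> \<alpha> w) \<in> lin_hom K A U"
      by (intro mult_lin_right[OF U_algebra] \<alpha>_lin U.m_closed \<alpha>_closed \<beta>_closed x y)
    show ?thesis
      using M lin_hom_compose[OF bilinear_right[OF append_23_bilinear[OF A_algebra] w] F]
        lin_hom_compose[OF mA(1) map2_lin[OF A_algebra U_algebra f \<alpha>_lin]] _ X
    proof (rule AT.tensor_eqI)
      fix zs assume "zs \<in> words (triple A)"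
      then show "F (tensor_append K (quintuple A) (pure_tensor K [A, op_alg A] [x, y]) (pure_tensor K (triple A) zs)) =
          tensor_map K [U, U] [\<lambda>w. \<alpha> x \<otimes>\<^bsub>U\<^esub> \<beta> y \<otimes>\<^bsub>U\<^esub> \<alpha> w, \<alpha>] (m_id K A (pure_tensor K (triple A) zs))"
        using x y tensor_append_pure[OF AO.tensor_factors AT.tensor_factors, of "[x, y]" zs]
        by (auto simp: words3 Fp mA map2_pure[OF A_algebra U_algebra f \<alpha>_lin] \<alpha>_mult U.m_assoc)
    qed
  qed
  \<comment> \<open>Here the condition replaces the product over \<mu>(a1) by the negative of
    \<beta>(a1).\<close>
  have left: "F (\<mu>_id_id K A \<mu> X) = \<ominus>\<^bsub>U2.T\<^esub> m_id K U (\<nu> [\<beta>, \<alpha>, \<alpha>] X)" if X: "X \<in> carrier AT.T" for X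
    using M lin_hom_compose[OF PA(1) F] lin_hom_neg[OF M lin_hom_compose[OF map3_lin[OF \<beta>_lin \<alpha>_lin \<alpha>_lin] mU(1)]] _ X
    by (rule AT.tensor_eqI)
      (auto simp: words3 PA(2) L cond map3_pure mU(2) p2_uminus U.l_minus)
  \<comment> \<open>Here the unit axiom of \<open>A\<close> replaces the merged slots by 1, so
    \<alpha>(a1)\<beta>(a2) (x) \<alpha>(a3) remains.\<close>
  have right: "F (id_id_\<mu> K A \<mu> X) = m_id K U (\<nu> [\<alpha>, \<beta>, \<alpha>] X)" if X: "X \<in> carrier AT.T" for X
    using M lin_hom_compose[OF QA(1) F] lin_hom_compose[OF map3_lin[OF \<alpha>_lin \<beta>_lin \<alpha>_lin] mU(1)] _ X
  proof (rule AT.tensor_eqI)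
    fix xs assume "xs \<in> words (triple A)"
    then obtain x y z where xs: "xs = [x, y, z]" and c: "x \<in> carrier A" "y \<in> carrier A" "z \<in> carrier A"
      by (auto simp: words3)
    have f: "(\<lambda>w. \<alpha> x \<otimes>\<^bsub>U\<^esub> \<beta> y \<otimes>\<^bsub>U\<^esub> \<alpha> w) \<in> lin_hom K A U"
      by (intro mult_lin_right[OF U_algebra] \<alpha>_lin U.m_closed \<alpha>_closed \<beta>_closed c)
    show "F (id_id_\<mu> K A \<mu> (pure_tensor K (triple A) xs)) = m_id K U (\<nu> [\<alpha>, \<beta>, \<alpha>] (pure_tensor K (triple A) xs))"
      using c by (simp add: xs QA(2) R m_id_\<mu> map2_pure[OF A_algebra U_algebra f \<alpha>_lin] \<alpha>_one map3_pure mU(2))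
  qed
  show ?thesis
    using left[OF \<mu>_closed[OF a]] right[OF \<mu>_closed[OF a]] coassoc[OF a] by simp
qed

text \<open>The condition is now substituted for the last factor: \<alpha>(a1) (x)
  \<alpha>(a2)\<beta>(a3) is the negative of \<alpha>(a1) (x)
  \<alpha>(a2)\<alpha>(a31)\<beta>(a32)\<alpha>(a33). Coassociativity turns the latter into
  \<alpha>(a11) (x) \<alpha>(a12)\<alpha>(a13)\<beta>(a2)\<alpha>(a3), and the second unit axiom of
  \<open>A\<close> collapses it to \<alpha>(a1) (x) \<beta>(a2)\<alpha>(a3).\<close>

lemma id_m_cancel:
  assumes cond: "\<And>a. a \<in> carrier A \<Longrightarrow> m3 (\<nu> [\<alpha>, \<beta>, \<alpha>] (\<mu> a)) = \<ominus>\<^bsub>U\<^esub> \<beta> a" and a: "a \<in> carrier A"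
  shows "id_m K U (\<nu> [\<alpha>, \<beta>, \<alpha>] (\<mu> a)) = \<ominus>\<^bsub>U2.T\<^esub> id_m K U (\<nu> [\<alpha>, \<alpha>, \<beta>] (\<mu> a))"
proof -
  let ?\<phi> = "\<lambda>xs. p2 (\<alpha> (xs ! 0)) (\<alpha> (xs ! 1) \<otimes>\<^bsub>U\<^esub> (\<alpha> (xs ! 2) \<otimes>\<^bsub>U\<^esub> (\<beta> (xs ! 3) \<otimes>\<^bsub>U\<^esub> \<alpha> (xs ! 4))))"
  define F where "F = tensor_lift K U2.T ?\<phi>"
  note M = U2.T.module_axioms
  have m: "multilinear K (quintuple A) U2.T ?\<phi>"
    by (rule multilinear5I; simp only: lin_hom_op op_alg_simps;
        intro U2_lin mult_lin_left[OF U_algebra] mult_lin_right[OF U_algebra] \<alpha>_lin \<beta>_lin U.m_closed \<alpha>_closed \<beta>_closed)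
  note F = A5.lift_lin[OF M m, folded F_def]
  have Fp: "F (pure_tensor K (quintuple A) [x, y, z, u, v]) = p2 (\<alpha> x) (\<alpha> y \<otimes>\<^bsub>U\<^esub> (\<alpha> z \<otimes>\<^bsub>U\<^esub> (\<beta> u \<otimes>\<^bsub>U\<^esub> \<alpha> v)))"
    if "x \<in> carrier A" "y \<in> carrier A" "z \<in> carrier A" "u \<in> carrier A" "v \<in> carrier A" for x y z u v
    using A5.lift_pure[OF M m, of "[x, y, z, u, v]"] that by (simp add: F_def)
  note PA = \<mu>_id_id_lin[OF A_algebra \<mu>_lin] \<mu>_id_id_pure[OF A_algebra \<mu>_lin]
    and QA = id_id_\<mu>_lin[OF A_algebra \<mu>_lin] id_id_\<mu>_pure[OF A_algebra \<mu>_lin]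
    and mU = id_m_lin[OF U_algebra] id_m_pure[OF U_algebra]
    and mA = id_m_lin[OF A_algebra] id_m_pure[OF A_algebra]
  have R: "F (tensor_append K (quintuple A) (pure_tensor K [A, op_alg A] [x, y]) X) =
      p2 (\<alpha> x) (\<alpha> y \<otimes>\<^bsub>U\<^esub> m3 (\<nu> [\<alpha>, \<beta>, \<alpha>] X))"
    if x: "x \<in> carrier A" and y: "y \<in> carrier A" and X: "X \<in> carrier AT.T" for X x y
  proof -
    have w: "pure_tensor K [A, op_alg A] [x, y] \<in> carrier AO.T" using AO.pure_closed[of "[x, y]"] x y by simp
    have r: "(\<lambda>X. p2 (\<alpha> x) (\<alpha> y \<otimes>\<^bsub>U\<^esub> m3 (\<nu> [\<alpha>, \<beta>, \<alpha>] X))) \<in> lin_hom K AT.T U2.T"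
      by (intro U2_lin mult_lin_right[OF U_algebra] lin_hom_compose[OF map3_lin m3_lin] \<alpha>_lin \<beta>_lin \<alpha>_closed x y)
    show ?thesis
      using M lin_hom_compose[OF bilinear_right[OF append_23_bilinear[OF A_algebra] w] F] r _ X
    proof (rule AT.tensor_eqI)
      fix zs assume "zs \<in> words (triple A)"
      then show "F (tensor_append K (quintuple A) (pure_tensor K [A, op_alg A] [x, y]) (pure_tensor K (triple A) zs)) =
          p2 (\<alpha> x) (\<alpha> y \<otimes>\<^bsub>U\<^esub> m3 (\<nu> [\<alpha>, \<beta>, \<alpha>] (pure_tensor K (triple A) zs)))"
        using x y tensor_append_pure[OF AO.tensor_factors AT.tensor_factors, of "[x, y]" zs]
        by (auto simp: words3 Fp map3_pure m3_pure)
    qed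
  qed
  have L: "F (tensor_append K (quintuple A) X (pure_tensor K [op_alg A, A] [y, z])) =
      tensor_map K [U, U] [\<alpha>, \<lambda>w. \<alpha> w \<otimes>\<^bsub>U\<^esub> (\<beta> y \<otimes>\<^bsub>U\<^esub> \<alpha> z)] (id_m K A X)"
    if y: "y \<in> carrier A" and z: "z \<in> carrier A" and X: "X \<in> carrier AT.T" for X y z
  proof -
    have w: "pure_tensor K [op_alg A, A] [y, z] \<in> carrier OA.T" using OA.pure_closed[of "[y, z]"] y z by simp
    have f: "(\<lambda>w. \<alpha> w \<otimes>\<^bsub>U\<^esub> (\<beta> y \<otimes>\<^bsub>U\<^esub> \<alpha> z)) \<in> lin_hom K A U"
      by (intro mult_lin_left[OF U_algebra] \<alpha>_lin U.m_closed \<alpha>_closed \<beta>_closed y z)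
    show ?thesis
      using M lin_hom_compose[OF bilinear_left[OF append_32_bilinear[OF A_algebra] w] F]
        lin_hom_compose[OF mA(1) map2_lin[OF A_algebra U_algebra \<alpha>_lin f]] _ X
    proof (rule AT.tensor_eqI)
      fix xs assume "xs \<in> words (triple A)"
      then show "F (tensor_append K (quintuple A) (pure_tensor K (triple A) xs) (pure_tensor K [op_alg A, A] [y, z])) =
          tensor_map K [U, U] [\<alpha>, \<lambda>w. \<alpha> w \<otimes>\<^bsub>U\<^esub> (\<beta> y \<otimes>\<^bsub>U\<^esub> \<alpha> z)] (id_m K A (pure_tensor K (triple A) xs))"
        using y z tensor_append_pure[OF AT.tensor_factors OA.tensor_factors, of xs "[y, z]"]
        by (auto simp: words3 Fp mA map2_pure[OF A_algebra U_algebra \<alpha>_lin f] \<alpha>_mult U.m_assoc)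
    qed
  qed
  have right: "F (id_id_\<mu> K A \<mu> X) = \<ominus>\<^bsub>U2.T\<^esub> id_m K U (\<nu> [\<alpha>, \<alpha>, \<beta>] X)" if X: "X \<in> carrier AT.T" for X
    using M lin_hom_compose[OF QA(1) F] lin_hom_neg[OF M lin_hom_compose[OF map3_lin[OF \<alpha>_lin \<alpha>_lin \<beta>_lin] mU(1)]] _ X
    by (rule AT.tensor_eqI)
      (auto simp: words3 QA(2) R cond map3_pure mU(2) p2_uminus U.r_minus)
  have left: "F (\<mu>_id_id K A \<mu> X) = id_m K U (\<nu> [\<alpha>, \<beta>, \<alpha>] X)" if X: "X \<in> carrier AT.T" for X
    using M lin_hom_compose[OF PA(1) F] lin_hom_compose[OF map3_lin[OF \<alpha>_lin \<beta>_lin \<alpha>_lin] mU(1)] _ X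
  proof (rule AT.tensor_eqI)
    fix xs assume "xs \<in> words (triple A)"
    then obtain x y z where xs: "xs = [x, y, z]" and c: "x \<in> carrier A" "y \<in> carrier A" "z \<in> carrier A"
      by (auto simp: words3)
    have f: "(\<lambda>w. \<alpha> w \<otimes>\<^bsub>U\<^esub> (\<beta> y \<otimes>\<^bsub>U\<^esub> \<alpha> z)) \<in> lin_hom K A U"
      by (intro mult_lin_left[OF U_algebra] \<alpha>_lin U.m_closed \<alpha>_closed \<beta>_closed c)
    show "F (\<mu>_id_id K A \<mu> (pure_tensor K (triple A) xs)) = id_m K U (\<nu> [\<alpha>, \<beta>, \<alpha>] (pure_tensor K (triple A) xs))"
      using c by (simp add: xs PA(2) L id_m_\<mu> map2_pure[OF A_algebra U_algebra \<alpha>_lin f] \<alpha>_one map3_pure mU(2))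
  qed
  show ?thesis
    using left[OF \<mu>_closed[OF a]] right[OF \<mu>_closed[OF a]] coassoc[OF a] by simp
qed

lemma m_id_D:
  assumes cond: "\<And>a. a \<in> carrier A \<Longrightarrow> m3 (\<nu> [\<alpha>, \<beta>, \<alpha>] (\<mu> a)) = \<ominus>\<^bsub>U\<^esub> \<beta> a" and u: "u \<in> carrier U"
  shows "m_id K U (D u) = p2 \<one>\<^bsub>U\<^esub> u"
proof -
  let ?S = "{u \<in> carrier U. m_id K U (D u) = p2 \<one>\<^bsub>U\<^esub> u}"
  note l = m_id_lin[OF U_algebra] and p = U2_lin(2)[OF _ lin_hom_ident, OF U.one_closed]
  note lm = map2_pure[OF U_algebra U_algebra lin_hom_ident mult_lin_left[OF U_algebra lin_hom_ident]]
  interpret U: module K U by (rule U_module)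
  have "k_subalgebra K U ?S"
    unfolding k_subalgebra_def
  proof (intro conjI ballI)
    show "\<one>\<^bsub>U\<^esub> \<in> ?S"
      using alg_hom_one[OF D_hom] by (simp add: m_id_pure[OF U_algebra])
    fix u v assume u: "u \<in> ?S" and v: "v \<in> ?S"
    then show "u \<oplus>\<^bsub>U\<^esub> v \<in> ?S"
      by (simp add: lin_hom_add[OF D_lin] lin_hom_add[OF l] lin_hom_add[OF p])
    \<comment> \<open>The axiom for v supplies the hypothesis of \<open>m_id_mult\<close> on the
      right factor; it turns 1 (x) u, the value at u, into 1 (x) uv.\<close>
    show "u \<otimes>\<^bsub>U\<^esub> v \<in> ?S"
      using u v by (simp add: alg_hom_mult[OF D_hom] m_id_mult[OF U_algebra, where u = v] lm)
  next
    fix c u assume "c \<in> carrier K" "u \<in> ?S"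
    then show "c \<odot>\<^bsub>U\<^esub> u \<in> ?S"
      by (simp add: lin_hom_smult[OF D_lin] lin_hom_smult[OF l] lin_hom_smult[OF p])
  qed auto
  moreover have "\<alpha> a \<in> ?S" if "a \<in> carrier A" for a
    using that by (simp add: D_\<alpha> \<gamma>_eq unit_maps)
  \<comment> \<open>By \<open>m_id_cancel\<close> the two terms with \<beta> in a merged slot are
    opposite, which leaves the term evaluated by \<open>unit_maps\<close>.\<close>
  moreover have "\<beta> a \<in> ?S" if "a \<in> carrier A" for a
    using that lin_hom_closed[OF l map3_closed[OF \<beta>_lin \<alpha>_lin \<alpha>_lin]]
    by (simp add: D_\<beta> m_id_\<xi> m_id_cancel[OF cond] U2.T.M.a_assoc U2.T.M.l_neg p2_closed)
  ultimately show ?thesis using generated[of ?S] u by blast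
qed

lemma id_m_D:
  assumes cond: "\<And>a. a \<in> carrier A \<Longrightarrow> m3 (\<nu> [\<alpha>, \<beta>, \<alpha>] (\<mu> a)) = \<ominus>\<^bsub>U\<^esub> \<beta> a" and u: "u \<in> carrier U"
  shows "id_m K U (D u) = p2 u \<one>\<^bsub>U\<^esub>"
proof -
  let ?S = "{u \<in> carrier U. id_m K U (D u) = p2 u \<one>\<^bsub>U\<^esub>}"
  note l = id_m_lin[OF U_algebra] and p = U2_lin(1)[OF lin_hom_ident U.one_closed]
  note lm = map2_pure[OF U_algebra U_algebra mult_lin_right[OF U_algebra _ lin_hom_ident] lin_hom_ident]
  interpret U: module K U by (rule U_module)
  have "k_subalgebra K U ?S"
    unfolding k_subalgebra_def
  proof (intro conjI ballI)
    show "\<one>\<^bsub>U\<^esub> \<in> ?S"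
      using alg_hom_one[OF D_hom] by (simp add: id_m_pure[OF U_algebra])
    fix u v assume u: "u \<in> ?S" and v: "v \<in> ?S"
    then show "u \<oplus>\<^bsub>U\<^esub> v \<in> ?S"
      by (simp add: lin_hom_add[OF D_lin] lin_hom_add[OF l] lin_hom_add[OF p])
    \<comment> \<open>Here the axiom for the left factor u feeds \<open>id_m_mult\<close>, which
      multiplies the first slot of v (x) 1 by u from the left.\<close>
    show "u \<otimes>\<^bsub>U\<^esub> v \<in> ?S"
      using u v by (simp add: alg_hom_mult[OF D_hom] id_m_mult[OF U_algebra, where u = u] lm)
  next
    fix c u assume "c \<in> carrier K" "u \<in> ?S"
    then show "c \<odot>\<^bsub>U\<^esub> u \<in> ?S"
      by (simp add: lin_hom_smult[OF D_lin] lin_hom_smult[OF l] lin_hom_smult[OF p])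
  qed auto
  moreover have "\<alpha> a \<in> ?S" if "a \<in> carrier A" for a
    using that by (simp add: D_\<alpha> \<gamma>_eq unit_maps)
  moreover have "\<beta> a \<in> ?S" if "a \<in> carrier A" for a
    using that lin_hom_closed[OF l map3_closed[OF \<alpha>_lin \<alpha>_lin \<beta>_lin]]
    by (simp add: D_\<beta> id_m_\<xi> id_m_cancel[OF cond] U2.T.M.r_neg p2_closed)
  ultimately show ?thesis using generated[of ?S] u by blast
qed

text \<open>The first unit axiom on \<beta>(a) says that two tensors in two slots sum to zero.
  Multiplying the slots together loses information but yields exactly the condition.\<close>

lemma antipode_condition:
  assumes H: "\<And>a. a \<in> carrier A \<Longrightarrow> m_id K U (D (\<beta> a)) = p2 \<one>\<^bsub>U\<^esub> (\<beta> a)" and a: "a \<in> carrier A"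
  shows "\<beta> a \<oplus>\<^bsub>U\<^esub> m3 (\<nu> [\<alpha>, \<beta>, \<alpha>] (\<mu> a)) = \<zero>\<^bsub>U\<^esub>"
proof -
  define M where "M = tensor_lift K U (\<lambda>xs. xs ! 0 \<otimes>\<^bsub>U\<^esub> xs ! 1)"
  have m: "multilinear K [U, U] U (\<lambda>xs. xs ! 0 \<otimes>\<^bsub>U\<^esub> xs ! 1)"
    by (rule multilinear2I; intro mult_lin_left[OF U_algebra] mult_lin_right[OF U_algebra] lin_hom_ident)
  note M = U2.lift_lin[OF U_module m, folded M_def]
  have Mp: "M (p2 x y) = x \<otimes>\<^bsub>U\<^esub> y" if "x \<in> carrier U" "y \<in> carrier U" for x y
    using U2.lift_pure[OF U_module m, of "[x, y]"] that by (simp add: M_def)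
  note mU = m_id_lin[OF U_algebra] m_id_pure[OF U_algebra]
    and mA = id_m_lin[OF A_algebra] id_m_pure[OF A_algebra]
  have 1: "M (m_id K U (\<nu> [\<alpha>, \<beta>, \<alpha>] X)) = m3 (\<nu> [\<alpha>, \<beta>, \<alpha>] X)" if X: "X \<in> carrier AT.T" for X
    using U_module lin_hom_compose[OF map3_lin[OF \<alpha>_lin \<beta>_lin \<alpha>_lin] lin_hom_compose[OF mU(1) M]]
      lin_hom_compose[OF map3_lin[OF \<alpha>_lin \<beta>_lin \<alpha>_lin] m3_lin] _ X
    by (rule AT.tensor_eqI) (auto simp: words3 map3_pure mU(2) Mp m3_pure U.m_assoc)
  note ba = map2_lin[OF A_algebra U_algebra \<beta>_lin \<alpha>_lin] map2_pure[OF A_algebra U_algebra \<beta>_lin \<alpha>_lin]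
  \<comment> \<open>Reassociating \<beta>(x)\<alpha>(y)\<alpha>(z) moves the multiplication to the
    last two slots, where it can be carried out in \<open>A\<close>. The term thus factors through
    \<open>id_m K A\<close>, and on \<mu>(a) the second unit axiom of \<open>A\<close> evaluates it
    to \<beta>(a).\<close>
  have 2: "M (m_id K U (\<nu> [\<beta>, \<alpha>, \<alpha>] X)) = M (tensor_map K [U, U] [\<beta>, \<alpha>] (id_m K A X))" if X: "X \<in> carrier AT.T" for X
    using U_module lin_hom_compose[OF map3_lin[OF \<beta>_lin \<alpha>_lin \<alpha>_lin] lin_hom_compose[OF mU(1) M]]
      lin_hom_compose[OF mA(1) lin_hom_compose[OF ba(1) M]] _ X
    by (rule AT.tensor_eqI) (auto simp: words3 map3_pure mU(2) Mp mA(2) ba(2) \<alpha>_mult U.m_assoc)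
  note c = map3_closed[THEN lin_hom_closed[OF mU(1)]]
  \<comment> \<open>The term with \<beta> in the third slot equals the right-hand side of the axiom,
    so it cancels and the sum of the other two vanishes.\<close>
  have "p2 \<one>\<^bsub>U\<^esub> (\<beta> a) \<oplus>\<^bsub>U2.T\<^esub> (m_id K U (\<nu> [\<alpha>, \<beta>, \<alpha>] (\<mu> a)) \<oplus>\<^bsub>U2.T\<^esub> m_id K U (\<nu> [\<beta>, \<alpha>, \<alpha>] (\<mu> a))) = p2 \<one>\<^bsub>U\<^esub> (\<beta> a)"
    using H[OF a] a by (simp add: D_\<beta> m_id_\<xi> U2.T.M.a_assoc p2_closed c)
  then have "m_id K U (\<nu> [\<alpha>, \<beta>, \<alpha>] (\<mu> a)) \<oplus>\<^bsub>U2.T\<^esub> m_id K U (\<nu> [\<beta>, \<alpha>, \<alpha>] (\<mu> a)) = \<zero>\<^bsub>U2.T\<^esub>"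
    using a by (simp add: p2_closed c)
  then have "M (m_id K U (\<nu> [\<alpha>, \<beta>, \<alpha>] (\<mu> a)) \<oplus>\<^bsub>U2.T\<^esub> m_id K U (\<nu> [\<beta>, \<alpha>, \<alpha>] (\<mu> a))) = \<zero>\<^bsub>U\<^esub>"
    using lin_hom_zero[OF U2.T.module_axioms U_module M] by simp
  moreover have "M (m_id K U (\<nu> [\<beta>, \<alpha>, \<alpha>] (\<mu> a))) = \<beta> a"
    using a by (simp add: 2 id_m_\<mu> ba(2) Mp \<alpha>_one)
  ultimately have "m3 (\<nu> [\<alpha>, \<beta>, \<alpha>] (\<mu> a)) \<oplus>\<^bsub>U\<^esub> \<beta> a = \<zero>\<^bsub>U\<^esub>"
    using a by (simp add: lin_hom_add[OF M] c 1)
  then show ?thesis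
    using a lin_hom_closed[OF m3_lin map3_closed] by (subst U.a_comm) simp_all
qed

text \<open>Multiplicativity and coassociativity of \<open>D\<close> and the non-triviality of
  \<open>U\<close> hold whether or not the condition does, so the condition decides the unit axioms
  alone.\<close>

lemma hopf_galois_iff:
  "hopf_galois_algebra K U D \<longleftrightarrow>
    (\<forall>a\<in>carrier A. \<beta> a \<oplus>\<^bsub>U\<^esub> m3 (\<nu> [\<alpha>, \<beta>, \<alpha>] (\<mu> a)) = \<zero>\<^bsub>U\<^esub>)"
proof
  assume "hopf_galois_algebra K U D"
  then show "\<forall>a\<in>carrier A. \<beta> a \<oplus>\<^bsub>U\<^esub> m3 (\<nu> [\<alpha>, \<beta>, \<alpha>] (\<mu> a)) = \<zero>\<^bsub>U\<^esub>"
    using antipode_condition by (simp add: hopf_galois_algebra_iff)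
next
  assume c: "\<forall>a\<in>carrier A. \<beta> a \<oplus>\<^bsub>U\<^esub> m3 (\<nu> [\<alpha>, \<beta>, \<alpha>] (\<mu> a)) = \<zero>\<^bsub>U\<^esub>"
  have "m3 (\<nu> [\<alpha>, \<beta>, \<alpha>] (\<mu> a)) = \<ominus>\<^bsub>U\<^esub> \<beta> a" if a: "a \<in> carrier A" for a
  proof (rule U.minus_equality[symmetric])
    have "m3 (\<nu> [\<alpha>, \<beta>, \<alpha>] (\<mu> a)) \<in> carrier U" using a by (simp add: lin_hom_closed[OF m3_lin map3_closed])
    with a c show "m3 (\<nu> [\<alpha>, \<beta>, \<alpha>] (\<mu> a)) \<oplus>\<^bsub>U\<^esub> \<beta> a = \<zero>\<^bsub>U\<^esub>" "m3 (\<nu> [\<alpha>, \<beta>, \<alpha>] (\<mu> a)) \<in> carrier U"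
      by (simp_all add: U.a_comm)
  qed (use a in simp)
  then show "hopf_galois_algebra K U D"
    using U_algebra D_hom coassoc_U m_id_D id_m_D enveloping_nontrivial[OF universal] hopf
    by (simp add: hopf_galois_algebra_iff)
qed

end

theorem theorem5p9:
  fixes K :: "'k ring"
    and A :: "('k, 'a) module" and br :: "'a \<Rightarrow> 'a \<Rightarrow> 'a" and \<mu> :: "'a \<Rightarrow> ('a list \<Rightarrow> 'k) set"
    and U :: "('k, 'u) module" and \<alpha> \<beta> :: "'a \<Rightarrow> 'u"
  assumes "poisson_hopf_galois_algebra K A br \<mu>"
    and "poisson_enveloping_algebra K A br U \<alpha> \<beta>"
  shows "env_\<mu> K A \<mu> U \<alpha> \<beta> \<in> alg_hom K U (tensor_algebra K (triple U)) \<and>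
    (\<forall>a\<in>carrier A. env_\<mu> K A \<mu> U \<alpha> \<beta> (\<alpha> a) = env_\<alpha>\<alpha>\<alpha> K U \<alpha> (\<mu> a)) \<and>
    (\<forall>a\<in>carrier A. env_\<mu> K A \<mu> U \<alpha> \<beta> (\<beta> a) = env_\<xi> K U \<alpha> \<beta> (\<mu> a)) \<and>
    (hopf_galois_algebra K U (env_\<mu> K A \<mu> U \<alpha> \<beta>) \<longleftrightarrow>
      (\<forall>a\<in>carrier A.
         \<beta> a \<oplus>\<^bsub>U\<^esub> tensor_lift3 K U (\<lambda>x y z. x \<otimes>\<^bsub>U\<^esub> (y \<otimes>\<^bsub>U\<^esub> z))
           (tensor_map K (triple U) [\<alpha>, \<beta>, \<alpha>] (\<mu> a)) = \<zero>\<^bsub>U\<^esub>))"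
proof -
  interpret poisson_hopf_setup K A br U \<alpha> \<beta> \<mu>
    using assms
    by unfold_locales
      (simp_all add: poisson_hopf_galois_algebra_def poisson_enveloping_algebra_def poisson_enveloping_for_def)
  show ?thesis
    using D_hom D_\<alpha> D_\<beta> hopf_galois_iff by blast
qed

end
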